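(* Let $K$ be a compact hypergroup and $J\neq\{e\}$ a finite hypergroup, and let $H=K\vee J$ be their (compact) hypergroup join. Let $\lambda_J$ be the Haar measure of $J$ with $\lambda_J(e)=1$. Then there is a bijection $\Phi$ from the disjoint union $(\widehat{K}\setminus\{1\})\cup\widehat{J}$ onto $\widehat{H}$ such that for each $\pi\in(\widehat{K}\setminus\{1\})\cup\widehat{J}$, $d_{\Phi(\pi)}=d_\pi$ and $$k_{\Phi(\pi)}=\begin{cases}k_\pi\,\lambda_J(J) & \text{if }\pi\in\widehat{K}\setminus\{1\},\\ k_\pi & \text{if }\pi\in\widehat{J}.\end{cases}$$
   Context: Hypergroup is meant in the sense of Jewett: a locally compact Hausdorff space $H$ with a bilinear associative convolution $*$ on the space $M(H)$ of bounded Borel measures such that: $\delta_x*\delta_y$ is a compactly supported probability measure for all $x,y\in H$; $*$ is weakly continuous on $M(H)^+\times M(H)^+$; $(x,y)\mapsto\operatorname{supp}(\delta_x*\delta_y)$ is continuous into the space of nonempty compact subsets with the Michael topology; there is an identity $e$ with $\delta_e*\delta_x=\delta_x*\delta_e=\delta_x$; and there is an involutive homeomorphism $x\mapsto\tilde x$ with $(\delta_x*\delta_y)^{\sim}=\delta_{\tilde y}*\delta_{\tilde x}$ and $e\in\operatorname{supp}(\delta_x*\delta_y)$ iff $y=\tilde x$. A Haar measure $\lambda_H$ is a nonzero positive Borel measure with $\int_H\int_H f\,d(\delta_x*\delta_y)\,d\lambda_H(y)=\int_H f\,d\lambda_H$ for all $x\in H$, $f\in C_c(H)$. A representation $\pi$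 of a compact hypergroup $H$ is a $*$-representation of the Banach $*$-algebra $M(H)$ on a Hilbert space $\mathcal H_\pi$ with $\pi(\delta_e)=I$ and such that $\mu\mapsto\langle\pi(\mu)\xi,\eta\rangle$ is weakly continuous on $M(H)^+$ for all $\xi,\eta$; write $\pi(x)=\pi(\delta_x)$. $\widehat H$ is a maximal set of pairwise inequivalent irreducible representations; $1$ is the trivial representation. Each $\pi\in\widehat H$ has finite dimension $d_\pi$ (Vrem), and with coefficient functions $\pi_{i,j}$ taken in an orthonormal basis there is a constant $k_\pi\ge d_\pi$, the hyperdimension of $\pi$, with $\int_H\pi_{i,j}\overline{\sigma_{k,l}}\,d\lambda=\frac1{k_\pi}$ if $\pi=\sigma$, $i=k$, $j=l$, and $0$ otherwise, where $\lambda$ is the Haar measure of $H$ normalized to total mass $1$. Hyperdimensions for $H$, $K$ and $J$ are always defined with respect to the total-mass-$1$ Haar measure of the respective hypergroup. Hypergroup join: let $(K,*_K)$ be a compact hypergroup and $(J,*_J)$ a discrete hypergroup with $K\cap J=\{e\}$, $e$ being the identity of both. Let $H=K\cup J$ have the unique topology for which $K$ and $J$ are closed subspaces, with the involution extending those of $K$ and $J$. Let $\lambda_K$ be the normalized Haar measure of $K$. Define: $\delta_s*\delta_t=\delta_s*_K\delta_t$ for $s,t\in K$; $\delta_s*\delta_t=\delta_s*_J\delta_t$ for $s,t\in J$ with $s\neq\tilde t$; $\delta_s*\delta_t=\delta_t*\delta_s=\delta_t$ for $s\in K$, $t\in J\setminus\{e\}$; and for $s\in J\setminus\{e\}$ with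 $\delta_s*_J\delta_{\tilde s}=\sum_{t\in J}\alpha_t\delta_t$, $\delta_s*\delta_{\tilde s}=\alpha_e\lambda_K+\sum_{t\in J\setminus\{e\}}\alpha_t\delta_t$. Then $H=K\vee J$ is a hypergroup, called the join of $K$ and $J$; it is compact when $J$ is finite. *)

theory Defs
  imports "HOL-Analysis.Analysis"
begin

section \<open>Bounded complex Borel measures on a topological space\<close>

definition borel_of :: "'a topology \<Rightarrow> 'a measure" where
  "borel_of T = sigma (topspace T) {U. openin T U}"

text \<open>A complex measure is its set function, normalized to be 0 off the Borel sets, so that
  equality of measures is equality of functions.\<close>

type_synonym 'a cmeasure = "'a set \<Rightarrow> complex"

definition total_variation :: "'a topology \<Rightarrow> 'a cmeasure \<Rightarrow> 'a set \<Rightarrow> real" where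
  "total_variation T \<mu> A =
    Sup {\<Sum>B\<in>P. cmod (\<mu> B) | P. finite P \<and> disjoint P \<and> P \<subseteq> sets (borel_of T) \<and> \<Union>P \<subseteq> A}"

text \<open>\<open>M(T)\<close>: as usual on locally compact spaces, bounded Borel measures are required to be regular.
  Complex-valued countable additivity already forces finite total variation.\<close>

definition bounded_measures :: "'a topology \<Rightarrow> 'a cmeasure set" where
  "bounded_measures T = {\<mu>.
     (\<forall>A. A \<notin> sets (borel_of T) \<longrightarrow> \<mu> A = 0) \<and>
     (\<forall>A :: nat \<Rightarrow> 'a set. range A \<subseteq> sets (borel_of T) \<and> disjoint_family A \<longrightarrow>
        (\<lambda>i. \<mu> (A i)) sums \<mu> (\<Union>i. A i)) \<and>
     (\<forall>A\<in>sets (borel_of T). \<forall>\<epsilon>>0. \<exists>C U. compactin T C \<and> openin T U \<and> C \<subseteq> A \<and> A \<subseteq> U \<and>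
        total_variation T \<mu> (U - C) < \<epsilon>)}"

definition positive_measures :: "'a topology \<Rightarrow> 'a cmeasure set" where
  "positive_measures T =
     {\<mu> \<in> bounded_measures T. \<forall>A\<in>sets (borel_of T). \<mu> A \<in> \<real>\<^sub>\<ge>\<^sub>0}"

definition probability_measures :: "'a topology \<Rightarrow> 'a cmeasure set" where
  "probability_measures T = {\<mu> \<in> positive_measures T. \<mu> (topspace T) = 1}"

definition dirac :: "'a topology \<Rightarrow> 'a \<Rightarrow> 'a cmeasure" where
  "dirac T x = (\<lambda>A. if A \<in> sets (borel_of T) \<and> x \<in> A then 1 else 0)"

definition msupport :: "'a topology \<Rightarrow> 'a cmeasure \<Rightarrow> 'a set" where
  "msupport T \<mu> = {x \<in> topspace T. \<forall>U. openin T U \<and> x \<in> U \<longrightarrow> total_variation T \<mu> U > 0}"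

text \<open>Integration against a complex measure, through the Jordan decompositions of its real and
  imaginary parts; \<open>upper_variation\<close> is the positive part of a real set function.\<close>

definition upper_variation :: "'a topology \<Rightarrow> ('a set \<Rightarrow> real) \<Rightarrow> 'a measure" where
  "upper_variation T \<nu> = measure_of (topspace T) (sets (borel_of T))
     (\<lambda>A. ennreal (Sup {\<nu> B | B. B \<in> sets (borel_of T) \<and> B \<subseteq> A}))"

definition cintegral :: "'a topology \<Rightarrow> 'a cmeasure \<Rightarrow> ('a \<Rightarrow> complex) \<Rightarrow> complex" where
  "cintegral T \<mu> f =
     (\<integral>x. f x \<partial>upper_variation T (\<lambda>A. Re (\<mu> A))) - (\<integral>x. f x \<partial>upper_variation T (\<lambda>A. - Re (\<mu> A))) +
     \<i> * ((\<integral>x. f x \<partial>upper_variation T (\<lambda>A. Im (\<mu> A))) - (\<integral>x. f x \<partial>upper_variation T (\<lambda>A. - Im (\<mu> A))))"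

definition bounded_continuous :: "'a topology \<Rightarrow> ('a \<Rightarrow> complex) set" where
  "bounded_continuous T = {f. continuous_map T euclidean f \<and> bounded (f ` topspace T)}"

definition compactly_supported_continuous :: "'a topology \<Rightarrow> ('a \<Rightarrow> complex) set" where
  "compactly_supported_continuous T =
     {f. continuous_map T euclidean f \<and> (\<exists>C. compactin T C \<and> (\<forall>x\<in>topspace T - C. f x = 0))}"

text \<open>The weak topology on the positive cone: the initial topology of the maps
  \<open>\<mu> \<mapsto> \<integral>f d\<mu>\<close> with \<open>f\<close> bounded and continuous.\<close>

definition weak_topology :: "'a topology \<Rightarrow> 'a cmeasure topology" where
  "weak_topology T = pullback_topology (positive_measures T)
     (\<lambda>\<mu>. \<lambda>f\<in>bounded_continuous T. cintegral T \<mu> f)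
     (product_topology (\<lambda>_. euclidean) (bounded_continuous T))"

definition michael_topology :: "'a topology \<Rightarrow> 'a set topology" where
  "michael_topology T = topology_generated_by
     {{C. compactin T C \<and> C \<inter> U \<noteq> {} \<and> C \<subseteq> V} | U V. openin T U \<and> openin T V}"

section \<open>Hypergroups in the sense of Jewett\<close>

record 'a hypergroup =
  hg_top :: "'a topology"
  hg_conv :: "'a cmeasure \<Rightarrow> 'a cmeasure \<Rightarrow> 'a cmeasure"
  hg_unit :: 'a
  hg_inv :: "'a \<Rightarrow> 'a"

abbreviation hg_set :: "'a hypergroup \<Rightarrow> 'a set" where
  "hg_set H \<equiv> topspace (hg_top H)"

abbreviation hg_measures :: "'a hypergroup \<Rightarrow> 'a cmeasure set" where
  "hg_measures H \<equiv> bounded_measures (hg_top H)"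

abbreviation hg_dirac :: "'a hypergroup \<Rightarrow> 'a \<Rightarrow> 'a cmeasure" where
  "hg_dirac H \<equiv> dirac (hg_top H)"

definition measure_flip :: "'a hypergroup \<Rightarrow> 'a cmeasure \<Rightarrow> 'a cmeasure" where
  "measure_flip H \<mu> =
     (\<lambda>A. if A \<in> sets (borel_of (hg_top H)) then \<mu> (hg_inv H -` A \<inter> hg_set H) else 0)"

definition measure_adjoint :: "'a hypergroup \<Rightarrow> 'a cmeasure \<Rightarrow> 'a cmeasure" where
  "measure_adjoint H \<mu> = (\<lambda>A. cnj (measure_flip H \<mu> A))"

locale hypergroup =
  fixes H :: "'a hypergroup"
  assumes locally_compact: "locally_compact_space (hg_top H)"
    and Hausdorff: "Hausdorff_space (hg_top H)"
    and conv_closed: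
      "\<lbrakk>\<mu> \<in> hg_measures H; \<nu> \<in> hg_measures H\<rbrakk> \<Longrightarrow> hg_conv H \<mu> \<nu> \<in> hg_measures H"
    and conv_linear_left:
      "\<lbrakk>\<mu> \<in> hg_measures H; \<nu> \<in> hg_measures H; \<rho> \<in> hg_measures H\<rbrakk> \<Longrightarrow>
        hg_conv H (\<lambda>A. a * \<mu> A + b * \<nu> A) \<rho> = (\<lambda>A. a * hg_conv H \<mu> \<rho> A + b * hg_conv H \<nu> \<rho> A)"
    and conv_linear_right:
      "\<lbrakk>\<mu> \<in> hg_measures H; \<nu> \<in> hg_measures H; \<rho> \<in> hg_measures H\<rbrakk> \<Longrightarrow>
        hg_conv H \<rho> (\<lambda>A. a * \<mu> A + b * \<nu> A) = (\<lambda>A. a * hg_conv H \<rho> \<mu> A + b * hg_conv H \<rho> \<nu> A)"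
    and conv_assoc:
      "\<lbrakk>\<mu> \<in> hg_measures H; \<nu> \<in> hg_measures H; \<rho> \<in> hg_measures H\<rbrakk> \<Longrightarrow>
        hg_conv H (hg_conv H \<mu> \<nu>) \<rho> = hg_conv H \<mu> (hg_conv H \<nu> \<rho>)"
    and conv_dirac_probability:
      "\<lbrakk>x \<in> hg_set H; y \<in> hg_set H\<rbrakk> \<Longrightarrow>
        hg_conv H (hg_dirac H x) (hg_dirac H y) \<in> probability_measures (hg_top H)"
    and conv_dirac_compact_support:
      "\<lbrakk>x \<in> hg_set H; y \<in> hg_set H\<rbrakk> \<Longrightarrow>
        compactin (hg_top H) (msupport (hg_top H) (hg_conv H (hg_dirac H x) (hg_dirac H y)))"
    and conv_weakly_continuous:
      "continuous_map (prod_topology (weak_topology (hg_top H)) (weak_topology (hg_top H)))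
        (weak_topology (hg_top H)) (\<lambda>(\<mu>, \<nu>). hg_conv H \<mu> \<nu>)"
    and support_continuous:
      "continuous_map (prod_topology (hg_top H) (hg_top H)) (michael_topology (hg_top H))
        (\<lambda>(x, y). msupport (hg_top H) (hg_conv H (hg_dirac H x) (hg_dirac H y)))"
    and unit_closed: "hg_unit H \<in> hg_set H"
    and unit_left:
      "x \<in> hg_set H \<Longrightarrow> hg_conv H (hg_dirac H (hg_unit H)) (hg_dirac H x) = hg_dirac H x"
    and unit_right:
      "x \<in> hg_set H \<Longrightarrow> hg_conv H (hg_dirac H x) (hg_dirac H (hg_unit H)) = hg_dirac H x"
    and inv_homeomorphic: "homeomorphic_map (hg_top H) (hg_top H) (hg_inv H)"
    and inv_involutive: "x \<in> hg_set H \<Longrightarrow> hg_inv H (hg_inv H x) = x"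
    and inv_conv:
      "\<lbrakk>x \<in> hg_set H; y \<in> hg_set H\<rbrakk> \<Longrightarrow>
        measure_flip H (hg_conv H (hg_dirac H x) (hg_dirac H y)) =
        hg_conv H (hg_dirac H (hg_inv H y)) (hg_dirac H (hg_inv H x))"
    and unit_in_support_iff:
      "\<lbrakk>x \<in> hg_set H; y \<in> hg_set H\<rbrakk> \<Longrightarrow>
        hg_unit H \<in> msupport (hg_top H) (hg_conv H (hg_dirac H x) (hg_dirac H y)) \<longleftrightarrow> y = hg_inv H x"

text \<open>A Haar measure may be infinite when the hypergroup is not compact, so it is a library measure
  rather than an element of \<open>M(H)\<close>; it is a Radon measure.\<close>

definition radon_measure :: "'a topology \<Rightarrow> 'a measure \<Rightarrow> bool" where
  "radon_measure T M \<longleftrightarrow>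
     space M = topspace T \<and> sets M = sets (borel_of T) \<and>
     (\<forall>C. compactin T C \<longrightarrow> emeasure M C < \<infinity>) \<and>
     (\<forall>A\<in>sets M. emeasure M A = (INF U\<in>{U. openin T U \<and> A \<subseteq> U}. emeasure M U)) \<and>
     (\<forall>U. openin T U \<longrightarrow> emeasure M U = (SUP C\<in>{C. compactin T C \<and> C \<subseteq> U}. emeasure M C))"

definition haar_measure :: "'a hypergroup \<Rightarrow> 'a measure \<Rightarrow> bool" where
  "haar_measure H M \<longleftrightarrow>
     radon_measure (hg_top H) M \<and> emeasure M (hg_set H) \<noteq> 0 \<and>
     (\<forall>x\<in>hg_set H. \<forall>f\<in>compactly_supported_continuous (hg_top H).
        (\<integral>y. cintegral (hg_top H) (hg_conv H (hg_dirac H x) (hg_dirac H y)) f \<partial>M) = (\<integral>y. f y \<partial>M))"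

definition normalized_haar_measure :: "'a hypergroup \<Rightarrow> 'a measure \<Rightarrow> bool" where
  "normalized_haar_measure H M \<longleftrightarrow> haar_measure H M \<and> emeasure M (hg_set H) = 1"

text \<open>Well defined when \<open>H\<close> is compact, by existence and uniqueness of Haar measure.\<close>

definition the_normalized_haar :: "'a hypergroup \<Rightarrow> 'a measure" where
  "the_normalized_haar H = (THE M. normalized_haar_measure H M)"

section \<open>The join of a compact and a discrete hypergroup\<close>

definition extend_measure :: "'a hypergroup \<Rightarrow> 'a hypergroup \<Rightarrow> 'a cmeasure \<Rightarrow> 'a cmeasure" where
  "extend_measure H S \<mu> = (\<lambda>A. if A \<in> sets (borel_of (hg_top H)) then \<mu> (A \<inter> hg_set S) else 0)"

text \<open>\<open>hypergroup_join K J lamK H\<close>: \<open>H\<close> is the join of \<open>K\<close> and \<open>J\<close>, where \<open>lamK\<close> is the normalized Haar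
  measure of \<open>K\<close>. The topology of \<open>H\<close> is determined by its restrictions to the closed sets \<open>K\<close> and
  \<open>J\<close>, and its convolution by the values on point masses (by weak continuity and bilinearity). The
  scalars \<open>\<alpha> t\<close> below are nonzero for finitely many \<open>t\<close> only, because a compact support in a
  discrete space is finite.\<close>

definition hypergroup_join ::
  "'a hypergroup \<Rightarrow> 'a hypergroup \<Rightarrow> 'a measure \<Rightarrow> 'a hypergroup \<Rightarrow> bool" where
  "hypergroup_join K J lamK H \<longleftrightarrow>
     hypergroup K \<and> compact_space (hg_top K) \<and> normalized_haar_measure K lamK \<and>
     hypergroup J \<and> hg_top J = discrete_topology (hg_set J) \<and>
     hg_unit J = hg_unit K \<and> hg_set K \<inter> hg_set J = {hg_unit K} \<and>
     hypergroup H \<and> hg_set H = hg_set K \<union> hg_set J \<and>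
     closedin (hg_top H) (hg_set K) \<and> subtopology (hg_top H) (hg_set K) = hg_top K \<and>
     closedin (hg_top H) (hg_set J) \<and> subtopology (hg_top H) (hg_set J) = hg_top J \<and>
     hg_unit H = hg_unit K \<and>
     (\<forall>s\<in>hg_set K. hg_inv H s = hg_inv K s) \<and>
     (\<forall>s\<in>hg_set J. hg_inv H s = hg_inv J s) \<and>
     (\<forall>s\<in>hg_set K. \<forall>t\<in>hg_set K.
        hg_conv H (hg_dirac H s) (hg_dirac H t) =
        extend_measure H K (hg_conv K (hg_dirac K s) (hg_dirac K t))) \<and>
     (\<forall>s\<in>hg_set J. \<forall>t\<in>hg_set J. s \<noteq> hg_inv J t \<longrightarrow>
        hg_conv H (hg_dirac H s) (hg_dirac H t) =
        extend_measure H J (hg_conv J (hg_dirac J s) (hg_dirac J t))) \<and>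
     (\<forall>s\<in>hg_set K. \<forall>t\<in>hg_set J - {hg_unit J}.
        hg_conv H (hg_dirac H s) (hg_dirac H t) = hg_dirac H t \<and>
        hg_conv H (hg_dirac H t) (hg_dirac H s) = hg_dirac H t) \<and>
     (\<forall>s\<in>hg_set J - {hg_unit J}.
        let \<alpha> = (\<lambda>t. hg_conv J (hg_dirac J s) (hg_dirac J (hg_inv J s)) {t})
        in hg_conv H (hg_dirac H s) (hg_dirac H (hg_inv J s)) =
           (\<lambda>A. \<alpha> (hg_unit J) * extend_measure H K (\<lambda>B. of_real (measure lamK B)) A +
                (\<Sum>t\<in>{t \<in> hg_set J - {hg_unit J}. \<alpha> t \<noteq> 0}. \<alpha> t * hg_dirac H t A)))"

section \<open>Complex Hilbert spaces\<close>

text \<open>Hilbert spaces have explicit carriers inside a type, since spaces of all dimensions occur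
  together. The inner product is linear in its first argument.\<close>

record 'h hspace =
  hs_set :: "'h set"
  hs_zero :: 'h
  hs_add :: "'h \<Rightarrow> 'h \<Rightarrow> 'h"
  hs_scale :: "complex \<Rightarrow> 'h \<Rightarrow> 'h"
  hs_inner :: "'h \<Rightarrow> 'h \<Rightarrow> complex"

definition hs_norm :: "'h hspace \<Rightarrow> 'h \<Rightarrow> real" where
  "hs_norm V x = sqrt (Re (hs_inner V x x))"

text \<open>Total symmetry and nonnegativity, off the carrier too, is what \<open>Metric_space\<close> requires.\<close>

definition hs_dist :: "'h hspace \<Rightarrow> 'h \<Rightarrow> 'h \<Rightarrow> real" where
  "hs_dist V x y =
    (if x \<in> hs_set V \<and> y \<in> hs_set V then hs_norm V (hs_add V x (hs_scale V (- 1) y)) else 0)"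

locale hilbert_space =
  fixes V :: "'h hspace"
  assumes zero_closed: "hs_zero V \<in> hs_set V"
    and add_closed: "\<lbrakk>x \<in> hs_set V; y \<in> hs_set V\<rbrakk> \<Longrightarrow> hs_add V x y \<in> hs_set V"
    and scale_closed: "x \<in> hs_set V \<Longrightarrow> hs_scale V a x \<in> hs_set V"
    and add_assoc: "\<lbrakk>x \<in> hs_set V; y \<in> hs_set V; z \<in> hs_set V\<rbrakk> \<Longrightarrow>
      hs_add V (hs_add V x y) z = hs_add V x (hs_add V y z)"
    and add_commute: "\<lbrakk>x \<in> hs_set V; y \<in> hs_set V\<rbrakk> \<Longrightarrow> hs_add V x y = hs_add V y x"
    and add_zero: "x \<in> hs_set V \<Longrightarrow> hs_add V x (hs_zero V) = x"
    and add_negative: "x \<in> hs_set V \<Longrightarrow> hs_add V x (hs_scale V (- 1) x) = hs_zero V"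
    and scale_one: "x \<in> hs_set V \<Longrightarrow> hs_scale V 1 x = x"
    and scale_scale: "x \<in> hs_set V \<Longrightarrow> hs_scale V a (hs_scale V b x) = hs_scale V (a * b) x"
    and scale_add_right: "\<lbrakk>x \<in> hs_set V; y \<in> hs_set V\<rbrakk> \<Longrightarrow>
      hs_scale V a (hs_add V x y) = hs_add V (hs_scale V a x) (hs_scale V a y)"
    and scale_add_left: "x \<in> hs_set V \<Longrightarrow>
      hs_scale V (a + b) x = hs_add V (hs_scale V a x) (hs_scale V b x)"
    and inner_add_left: "\<lbrakk>x \<in> hs_set V; y \<in> hs_set V; z \<in> hs_set V\<rbrakk> \<Longrightarrow>
      hs_inner V (hs_add V x y) z = hs_inner V x z + hs_inner V y z"
    and inner_scale_left: "\<lbrakk>x \<in> hs_set V; y \<in> hs_set V\<rbrakk> \<Longrightarrow>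
      hs_inner V (hs_scale V a x) y = a * hs_inner V x y"
    and inner_commute: "\<lbrakk>x \<in> hs_set V; y \<in> hs_set V\<rbrakk> \<Longrightarrow> hs_inner V y x = cnj (hs_inner V x y)"
    and inner_nonneg: "x \<in> hs_set V \<Longrightarrow> 0 \<le> Re (hs_inner V x x)"
    and inner_definite: "\<lbrakk>x \<in> hs_set V; hs_inner V x x = 0\<rbrakk> \<Longrightarrow> x = hs_zero V"
    and complete: "Metric_space.mcomplete (hs_set V) (hs_dist V)"

definition hs_linear :: "'h hspace \<Rightarrow> 'h hspace \<Rightarrow> ('h \<Rightarrow> 'h) \<Rightarrow> bool" where
  "hs_linear V W f \<longleftrightarrow>
     f \<in> hs_set V \<rightarrow> hs_set W \<and>
     (\<forall>x\<in>hs_set V. \<forall>y\<in>hs_set V. f (hs_add V x y) = hs_add W (f x) (f y)) \<and>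
     (\<forall>a. \<forall>x\<in>hs_set V. f (hs_scale V a x) = hs_scale W a (f x))"

definition hs_bounded_operator :: "'h hspace \<Rightarrow> ('h \<Rightarrow> 'h) \<Rightarrow> bool" where
  "hs_bounded_operator V f \<longleftrightarrow>
     hs_linear V V f \<and> (\<exists>c. \<forall>x\<in>hs_set V. hs_norm V (f x) \<le> c * hs_norm V x)"

definition hs_unitary :: "'h hspace \<Rightarrow> 'h hspace \<Rightarrow> ('h \<Rightarrow> 'h) \<Rightarrow> bool" where
  "hs_unitary V W f \<longleftrightarrow>
     hs_linear V W f \<and> bij_betw f (hs_set V) (hs_set W) \<and>
     (\<forall>x\<in>hs_set V. \<forall>y\<in>hs_set V. hs_inner W (f x) (f y) = hs_inner V x y)"

definition hs_closed_subspace :: "'h hspace \<Rightarrow> 'h set \<Rightarrow> bool" where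
  "hs_closed_subspace V S \<longleftrightarrow>
     hs_zero V \<in> S \<and> (\<forall>x\<in>S. \<forall>y\<in>S. hs_add V x y \<in> S) \<and> (\<forall>a. \<forall>x\<in>S. hs_scale V a x \<in> S) \<and>
     closedin (Metric_space.mtopology (hs_set V) (hs_dist V)) S"

definition orthonormal_basis :: "'h hspace \<Rightarrow> 'h set \<Rightarrow> bool" where
  "orthonormal_basis V B \<longleftrightarrow>
     B \<subseteq> hs_set V \<and> (\<forall>u\<in>B. \<forall>v\<in>B. hs_inner V u v = (if u = v then 1 else 0)) \<and>
     (\<forall>x\<in>hs_set V. (\<forall>u\<in>B. hs_inner V x u = 0) \<longrightarrow> x = hs_zero V)"

text \<open>All orthonormal bases are equipotent; the value is 0 for infinite-dimensional spaces.\<close>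

definition hs_dim :: "'h hspace \<Rightarrow> nat" where
  "hs_dim V = card (SOME B. orthonormal_basis V B)"

section \<open>Representations and the dual\<close>

record ('a, 'h) hg_rep =
  rep_space :: "'h hspace"
  rep_op :: "'a cmeasure \<Rightarrow> 'h \<Rightarrow> 'h"

locale hypergroup_representation =
  fixes H :: "'a hypergroup" and \<pi> :: "('a, 'h) hg_rep"
  assumes rep_hilbert: "hilbert_space (rep_space \<pi>)"
    and rep_bounded: "\<mu> \<in> hg_measures H \<Longrightarrow> hs_bounded_operator (rep_space \<pi>) (rep_op \<pi> \<mu>)"
    and rep_linear:
      "\<lbrakk>\<mu> \<in> hg_measures H; \<nu> \<in> hg_measures H; \<xi> \<in> hs_set (rep_space \<pi>)\<rbrakk> \<Longrightarrow>
        rep_op \<pi> (\<lambda>A. a * \<mu> A + b * \<nu> A) \<xi> =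
        hs_add (rep_space \<pi>) (hs_scale (rep_space \<pi>) a (rep_op \<pi> \<mu> \<xi>))
          (hs_scale (rep_space \<pi>) b (rep_op \<pi> \<nu> \<xi>))"
    and rep_mult:
      "\<lbrakk>\<mu> \<in> hg_measures H; \<nu> \<in> hg_measures H; \<xi> \<in> hs_set (rep_space \<pi>)\<rbrakk> \<Longrightarrow>
        rep_op \<pi> (hg_conv H \<mu> \<nu>) \<xi> = rep_op \<pi> \<mu> (rep_op \<pi> \<nu> \<xi>)"
    and rep_adjoint:
      "\<lbrakk>\<mu> \<in> hg_measures H; \<xi> \<in> hs_set (rep_space \<pi>); \<eta> \<in> hs_set (rep_space \<pi>)\<rbrakk> \<Longrightarrow>
        hs_inner (rep_space \<pi>) (rep_op \<pi> (measure_adjoint H \<mu>) \<xi>) \<eta> =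
        hs_inner (rep_space \<pi>) \<xi> (rep_op \<pi> \<mu> \<eta>)"
    and rep_unit:
      "\<xi> \<in> hs_set (rep_space \<pi>) \<Longrightarrow> rep_op \<pi> (hg_dirac H (hg_unit H)) \<xi> = \<xi>"
    and rep_weakly_continuous:
      "\<lbrakk>\<xi> \<in> hs_set (rep_space \<pi>); \<eta> \<in> hs_set (rep_space \<pi>)\<rbrakk> \<Longrightarrow>
        continuous_map (weak_topology (hg_top H)) euclidean
          (\<lambda>\<mu>. hs_inner (rep_space \<pi>) (rep_op \<pi> \<mu> \<xi>) \<eta>)"

definition irreducible_representation :: "'a hypergroup \<Rightarrow> ('a, 'h) hg_rep \<Rightarrow> bool" where
  "irreducible_representation H \<pi> \<longleftrightarrow>
     hypergroup_representation H \<pi> \<and>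
     hs_set (rep_space \<pi>) \<noteq> {hs_zero (rep_space \<pi>)} \<and>
     (\<forall>S. hs_closed_subspace (rep_space \<pi>) S \<and> (\<forall>\<mu>\<in>hg_measures H. rep_op \<pi> \<mu> ` S \<subseteq> S) \<longrightarrow>
        S = {hs_zero (rep_space \<pi>)} \<or> S = hs_set (rep_space \<pi>))"

definition equivalent_representations ::
  "'a hypergroup \<Rightarrow> ('a, 'h) hg_rep \<Rightarrow> ('a, 'h) hg_rep \<Rightarrow> bool" where
  "equivalent_representations H \<pi> \<sigma> \<longleftrightarrow>
     (\<exists>U. hs_unitary (rep_space \<pi>) (rep_space \<sigma>) U \<and>
        (\<forall>\<mu>\<in>hg_measures H. \<forall>\<xi>\<in>hs_set (rep_space \<pi>). U (rep_op \<pi> \<mu> \<xi>) = rep_op \<sigma> \<mu> (U \<xi>)))"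

definition inequivalent_irreducibles :: "'a hypergroup \<Rightarrow> ('a, 'h) hg_rep set \<Rightarrow> bool" where
  "inequivalent_irreducibles H R \<longleftrightarrow>
     (\<forall>\<pi>\<in>R. irreducible_representation H \<pi>) \<and>
     (\<forall>\<pi>\<in>R. \<forall>\<sigma>\<in>R. \<pi> \<noteq> \<sigma> \<longrightarrow> \<not> equivalent_representations H \<pi> \<sigma>)"

text \<open>A dual of \<open>H\<close>. The representation spaces range over all Hilbert spaces with carrier in the
  type \<open>'h\<close>. Irreducible representations of a compact hypergroup are finite-dimensional, so every
  type of at least continuum cardinality (such as \<open>nat \<Rightarrow> complex\<close>) realizes all of them up to
  equivalence.\<close>

definition hypergroup_dual :: "'a hypergroup \<Rightarrow> ('a, 'h) hg_rep set \<Rightarrow> bool" where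
  "hypergroup_dual H R \<longleftrightarrow>
     inequivalent_irreducibles H R \<and>
     (\<forall>R'. inequivalent_irreducibles H R' \<and> R \<subseteq> R' \<longrightarrow> R' = R)"

text \<open>The trivial representation up to equivalence: \<open>\<mu>\<close> acts on a one-dimensional space as the
  scalar \<open>\<mu>(H)\<close>.\<close>

definition trivial_representation :: "'a hypergroup \<Rightarrow> ('a, 'h) hg_rep \<Rightarrow> bool" where
  "trivial_representation H \<pi> \<longleftrightarrow>
     hypergroup_representation H \<pi> \<and> hs_dim (rep_space \<pi>) = 1 \<and>
     (\<forall>\<mu>\<in>hg_measures H. \<forall>\<xi>\<in>hs_set (rep_space \<pi>).
        rep_op \<pi> \<mu> \<xi> = hs_scale (rep_space \<pi>) (\<mu> (hg_set H)) \<xi>)"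

abbreviation rep_dim :: "('a, 'h) hg_rep \<Rightarrow> nat" where
  "rep_dim \<pi> \<equiv> hs_dim (rep_space \<pi>)"

definition rep_coeff :: "'a hypergroup \<Rightarrow> ('a, 'h) hg_rep \<Rightarrow> 'h \<Rightarrow> 'h \<Rightarrow> 'a \<Rightarrow> complex" where
  "rep_coeff H \<pi> u v x = hs_inner (rep_space \<pi>) (rep_op \<pi> (hg_dirac H x) v) u"

text \<open>The defining orthogonality relation of the hyperdimension (the relation between inequivalent
  representations does not involve the constant). Matrix indices are the basis vectors
  themselves. The relation determines \<open>k\<close>; \<open>k \<ge> d\<close> is a consequence and not part of the definition.\<close>

definition has_hyperdim :: "'a hypergroup \<Rightarrow> ('a, 'h) hg_rep \<Rightarrow> real \<Rightarrow> bool" where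
  "has_hyperdim H \<pi> k \<longleftrightarrow>
     k > 0 \<and>
     (\<forall>B. orthonormal_basis (rep_space \<pi>) B \<longrightarrow>
        (\<forall>i\<in>B. \<forall>j\<in>B. \<forall>k'\<in>B. \<forall>l\<in>B.
           (\<integral>x. rep_coeff H \<pi> i j x * cnj (rep_coeff H \<pi> k' l x) \<partial>the_normalized_haar H) =
           (if i = k' \<and> j = l then complex_of_real (1 / k) else 0)))"

text \<open>By Vrem's theorem the first branch applies to every irreducible representation of a compact
  hypergroup.\<close>

definition hyperdim :: "'a hypergroup \<Rightarrow> ('a, 'h) hg_rep \<Rightarrow> real" where
  "hyperdim H \<pi> = (if \<exists>k. has_hyperdim H \<pi> k then THE k. has_hyperdim H \<pi> k else 0)"

end

theory Submission
  imports Defs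
begin

text \<open>Let \<open>m\<close> be the Haar measure of \<open>K\<close>, viewed as a measure on \<open>H\<close>. It is a central idempotent of
  \<open>M(H)\<close>, so an irreducible representation of \<open>H\<close> maps it to \<open>0\<close> or to the identity. Sending the unit
  of \<open>J\<close> to \<open>m\<close> embeds \<open>M(J)\<close> into \<open>M(H)\<close> with image \<open>m * M(H)\<close>, so the representations with
  \<open>m \<mapsto> 1\<close> are those of \<open>J\<close>. Since \<open>t = m * t\<close> for \<open>t \<in> J - {e}\<close>, the representations with
  \<open>m \<mapsto> 0\<close> vanish on \<open>J - {e}\<close>; they are the representations of \<open>K\<close> killing \<open>m\<close>, that is, the
  nontrivial ones. The Haar measure of \<open>H\<close> is the image of that of \<open>J\<close>, and it gives \<open>K\<close> the mass
  \<open>1 / \<lambda>\<^sub>J(J)\<close>, whence the hyperdimensions.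

  Convolution is weakly continuous and combinations of point masses are weakly dense among the positive
  measures, so every identity in \<open>M(H)\<close> needs to be checked on point masses only.\<close>

section \<open>Complex measures on compact Hausdorff spaces\<close>

subsection \<open>Borel sets\<close>

text \<open>The weak topology lives on positive measures only, while representations act on all of
  \<open>M(H)\<close>. Hence the notion \<open>measure_map\<close>: linear everywhere, weakly
  continuous between the positive cones. Jordan parts carry identities from the cone to complex
  measures. Elements of \<open>M(H)\<close> are regular, so each measure that is constructed has to
  be shown regular. Restriction of measures from \<open>H\<close> to \<open>K\<close> is not
  multiplicative: for t in \<open>J - {e}\<close> it kills t and its inverse, but their product has
  the part \<alpha>_e m on \<open>K\<close>. The defect is always a multiple of m, so restriction
  becomes multiplicative under a representation of \<open>K\<close> that kills m; the true
  homomorphism is \<open>proj\<close>, restriction corrected by a multiple of m. The trivial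
  representation of \<open>H\<close> comes from that of \<open>J\<close>. Existence of
  hyperdimensions (Vrem's theorem) is not proved. The defining relations on \<open>H\<close> and on
  the factor are shown equivalent, so the formulas hold for the default value 0 as well. Existence
  of Haar measure is given for the factors and proved by construction for \<open>H\<close>;
  uniqueness comes from the flip.\<close>

lemma space_borel_of [simp]: "space (borel_of T) = topspace T"
  by (simp add: borel_of_def space_measure_of_conv)

lemma sets_borel_of: "sets (borel_of T) = sigma_sets (topspace T) {U. openin T U}"
  unfolding borel_of_def by (rule sets_measure_of) (auto dest: openin_subset)

lemma openin_borel [intro]: "openin T U \<Longrightarrow> U \<in> sets (borel_of T)"
  by (auto simp: sets_borel_of)

lemma borel_of_subset: "A \<in> sets (borel_of T) \<Longrightarrow> A \<subseteq> topspace T"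
  using sets.sets_into_space[of A "borel_of T"] by simp

lemma closedin_borel [intro]:
  assumes "closedin T C" shows "C \<in> sets (borel_of T)"
proof -
  have "space (borel_of T) - (topspace T - C) \<in> sets (borel_of T)"
    using assms by (intro sets.compl_sets openin_borel) (auto simp: closedin_def)
  then show ?thesis
    using closedin_subset[OF assms] by (simp add: Diff_Diff_Int inf_absorb2)
qed

lemma topspace_borel [simp, intro]: "topspace T \<in> sets (borel_of T)"
  by (rule openin_borel) simp

lemma continuous_map_borel:
  assumes "continuous_map T T' r" shows "r \<in> measurable (borel_of T) (borel_of T')"
  unfolding borel_of_def[of T']
proof (rule measurable_measure_of)
  show "{U. openin T' U} \<subseteq> Pow (topspace T')" by (auto dest: openin_subset)
  show "r \<in> space (borel_of T) \<rightarrow> topspace T'"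
    using assms by (auto simp: continuous_map_def)
  fix U assume "U \<in> {U. openin T' U}"
  then have "openin T {x \<in> topspace T. r x \<in> U}"
    using assms by (auto simp: continuous_map_def)
  moreover have "r -` U \<inter> space (borel_of T) = {x \<in> topspace T. r x \<in> U}" by auto
  ultimately show "r -` U \<inter> space (borel_of T) \<in> sets (borel_of T)" by auto
qed

lemma borel_of_euclidean: "borel_of euclidean = borel"
  by (simp add: borel_of_def borel_def)

lemma continuous_map_borel_measurable:
  "continuous_map T euclidean f \<Longrightarrow> f \<in> borel_measurable (borel_of T)"
  using continuous_map_borel[of T euclidean f] by (simp add: borel_of_euclidean)

subsection \<open>Signed measures\<close>

text \<open>Real and imaginary parts of complex measures are the instances in mind, so that
  boundedness and the Jordan decomposition are proved once.\<close>

locale signed_measure =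
  fixes M :: "'a measure" and \<nu> :: "'a set \<Rightarrow> real"
  assumes sums: "\<And>A :: nat \<Rightarrow> 'a set. \<lbrakk>range A \<subseteq> sets M; disjoint_family A\<rbrakk> \<Longrightarrow>
    (\<lambda>i. \<nu> (A i)) sums \<nu> (\<Union>i. A i)"
begin

lemma empty [simp]: "\<nu> {} = 0"
proof -
  have "(\<lambda>i::nat. \<nu> {}) sums \<nu> {}"
    using sums[of "\<lambda>_. {}"] by (simp add: disjoint_family_on_def)
  then have "(\<lambda>i::nat. \<nu> {}) \<longlonglongrightarrow> 0"
    using summable_LIMSEQ_zero sums_summable by blast
  then show ?thesis by (simp add: LIMSEQ_const_iff)
qed

lemma Un:
  assumes "A \<in> sets M" "B \<in> sets M" "A \<inter> B = {}"
  shows "\<nu> (A \<union> B) = \<nu> A + \<nu> B"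
proof -
  have "(\<lambda>i. \<nu> (binaryset A B i)) sums \<nu> (\<Union>i. binaryset A B i)"
    using assms by (intro sums) (auto simp: disjoint_family_on_def binaryset_def)
  moreover have "(\<lambda>i. \<nu> (binaryset A B i)) sums (\<nu> A + \<nu> B)"
    by (rule binaryset_sums) simp
  ultimately show ?thesis
    by (metis sums_unique2 UN_binaryset_eq)
qed

lemma Diff:
  assumes "A \<in> sets M" "B \<in> sets M" "B \<subseteq> A"
  shows "\<nu> (A - B) = \<nu> A - \<nu> B"
  using Un[of B "A - B"] assms by (simp add: Un_absorb1)

lemma Union:
  assumes "finite P" "disjoint P" "P \<subseteq> sets M"
  shows "\<nu> (\<Union>P) = (\<Sum>B\<in>P. \<nu> B)"
  using assms
proof (induction P)
  case (insert B P)
  have "B \<inter> \<Union>P = {}"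
    using insert.prems insert.hyps by (auto simp: pairwise_insert disjnt_iff)
  moreover have "\<Union>P \<in> sets M" using insert by (auto intro!: sets.finite_Union)
  ultimately show ?case
    using insert Un[of B "\<Union>P"] by (auto simp: pairwise_insert)
qed simp

lemma uminus: "signed_measure M (\<lambda>A. - \<nu> A)"
  by unfold_locales (intro sums_minus sums)

text \<open>If \<open>\<nu>\<close> is unbounded on the subsets of \<open>A\<close>, then
  \<open>A\<close> splits into two sets with values above 1 in modulus, and \<open>\<nu>\<close> is
  unbounded on the subsets of one of them. Iterating gives disjoint differences with values above 1,
  against summability.\<close>

lemma bounded: "\<exists>C. \<forall>A\<in>sets M. \<bar>\<nu> A\<bar> \<le> C"
proof (rule ccontr)
  define unb where
    "unb A \<longleftrightarrow> A \<in> sets M \<and> (\<forall>C. \<exists>B\<in>sets M. B \<subseteq> A \<and> \<bar>\<nu> B\<bar> > C)" for A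
  assume "\<nexists>C. \<forall>A\<in>sets M. \<bar>\<nu> A\<bar> \<le> C"
  then have start: "unb (space M)"
    unfolding unb_def by (meson linorder_not_le sets.sets_into_space sets.top)
  have step: "\<exists>A'. unb A' \<and> A' \<subseteq> A \<and> \<bar>\<nu> (A - A')\<bar> > 1" if A: "unb A" for A
  proof -
    obtain B where B: "B \<in> sets M" "B \<subseteq> A" "\<bar>\<nu> B\<bar> > \<bar>\<nu> A\<bar> + 1"
      using A unfolding unb_def by blast
    have AM: "A \<in> sets M" using A by (simp add: unb_def)
    have big: "\<bar>\<nu> (A - B)\<bar> > 1" using Diff[OF AM B(1,2)] B(3) by linarith
    have "unb B \<or> unb (A - B)"
    proof (rule ccontr)
      assume "\<not> (unb B \<or> unb (A - B))"
      moreover have "A - B \<in> sets M" using AM B by auto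
      ultimately obtain C1 C2 where
        C1: "\<And>E. \<lbrakk>E \<in> sets M; E \<subseteq> B\<rbrakk> \<Longrightarrow> \<bar>\<nu> E\<bar> \<le> C1" and
        C2: "\<And>E. \<lbrakk>E \<in> sets M; E \<subseteq> A - B\<rbrakk> \<Longrightarrow> \<bar>\<nu> E\<bar> \<le> C2"
        unfolding unb_def using B(1) by (metis linorder_not_le)
      obtain E where E: "E \<in> sets M" "E \<subseteq> A" "\<bar>\<nu> E\<bar> > C1 + C2"
        using A unfolding unb_def by blast
      have "\<nu> E = \<nu> (E \<inter> B) + \<nu> (E - B)"
        using Un[of "E \<inter> B" "E - B"] E(1) B(1) by (simp add: Int_Diff_Un Int_Diff_disjoint)
      moreover have "\<bar>\<nu> (E \<inter> B)\<bar> \<le> C1" using E B by (intro C1) auto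
      moreover have "\<bar>\<nu> (E - B)\<bar> \<le> C2" using E B by (intro C2) auto
      ultimately show False using E(3) by linarith
    qed
    then show ?thesis
    proof
      assume "unb B" then show ?thesis using B big by blast
    next
      assume "unb (A - B)"
      moreover have "A - (A - B) = B" using B by auto
      ultimately show ?thesis using B(3) by (intro exI[of _ "A - B"]) auto
    qed
  qed
  obtain S where S: "\<And>n. unb (S n)" "\<And>n. S (Suc n) \<subseteq> S n \<and> \<bar>\<nu> (S n - S (Suc n))\<bar> > 1"
    using dependent_nat_choice[of "\<lambda>_. unb" "\<lambda>_ A A'. A' \<subseteq> A \<and> \<bar>\<nu> (A - A')\<bar> > 1"] start step
    by metis
  define D where "D n = S n - S (Suc n)" for n
  have dec: "S m \<subseteq> S n" if "n \<le> m" for m n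
    using that lift_Suc_antimono_le[of S] S(2) by blast
  have "D m \<inter> D n = {}" if "m < n" for m n
    using dec[of "Suc m" n] that by (auto simp: D_def)
  then have "disjoint_family D"
    unfolding disjoint_family_on_def by (metis inf_commute linorder_neqE_nat)
  moreover have "range D \<subseteq> sets M" using S(1) by (auto simp: D_def unb_def)
  ultimately have "(\<lambda>n. \<nu> (D n)) \<longlonglongrightarrow> 0"
    using sums sums_summable summable_LIMSEQ_zero by blast
  then obtain n where "\<bar>\<nu> (D n)\<bar> < 1"
    by (metis LIMSEQ_D diff_zero order_refl real_norm_def zero_less_one)
  with S(2)[of n] show False by (simp add: D_def)
qed

text \<open>Positive part of the Jordan decomposition, written as in \<open>upper_variation\<close>.
  The supremum over subsets takes the place of a Hahn decomposition.\<close>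

definition pos_part :: "'a set \<Rightarrow> real" where
  "pos_part A = Sup {\<nu> B | B. B \<in> sets M \<and> B \<subseteq> A}"

lemma pos_part_upper: "\<lbrakk>B \<in> sets M; B \<subseteq> A\<rbrakk> \<Longrightarrow> \<nu> B \<le> pos_part A"
proof -
  obtain C where "\<forall>A\<in>sets M. \<bar>\<nu> A\<bar> \<le> C" using bounded by blast
  then have "bdd_above {\<nu> B | B. B \<in> sets M \<and> B \<subseteq> A}"
    by (intro bdd_aboveI[of _ C]) fastforce
  then show "\<lbrakk>B \<in> sets M; B \<subseteq> A\<rbrakk> \<Longrightarrow> \<nu> B \<le> pos_part A"
    unfolding pos_part_def by (intro cSup_upper) auto
qed

lemma pos_part_least: "(\<And>B. \<lbrakk>B \<in> sets M; B \<subseteq> A\<rbrakk> \<Longrightarrow> \<nu> B \<le> c) \<Longrightarrow> pos_part A \<le> c"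
  unfolding pos_part_def by (intro cSup_least) (auto intro!: exI[of _ "{}"])

lemma pos_part_nonneg: "0 \<le> pos_part A"
  using pos_part_upper[of "{}" A] by simp

lemma pos_part_mono: "A \<subseteq> B \<Longrightarrow> pos_part A \<le> pos_part B"
  by (rule pos_part_least) (auto intro: pos_part_upper)

text \<open>Measurable subsets of the two sets combine to one of the union; the two suprema are
  taken one after the other.\<close>

lemma pos_part_superadditive:
  assumes "A \<inter> B = {}" shows "pos_part A + pos_part B \<le> pos_part (A \<union> B)"
proof -
  have "\<nu> A' + \<nu> B' \<le> pos_part (A \<union> B)"
    if "A' \<in> sets M" "A' \<subseteq> A" "B' \<in> sets M" "B' \<subseteq> B" for A' B'
    using that assms Un[of A' B'] pos_part_upper[of "A' \<union> B'" "A \<union> B"] by fastforce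
  then have "\<nu> B' \<le> pos_part (A \<union> B) - \<nu> A'"
    if "A' \<in> sets M" "A' \<subseteq> A" "B' \<in> sets M" "B' \<subseteq> B" for A' B'
    using that by fastforce
  then have "pos_part B \<le> pos_part (A \<union> B) - \<nu> A'" if "A' \<in> sets M" "A' \<subseteq> A" for A'
    using that by (intro pos_part_least)
  then have "\<nu> A' \<le> pos_part (A \<union> B) - pos_part B" if "A' \<in> sets M" "A' \<subseteq> A" for A'
    using that by fastforce
  then have "pos_part A \<le> pos_part (A \<union> B) - pos_part B"
    by (intro pos_part_least)
  then show ?thesis by simp
qed

text \<open>Superadditivity bounds the partial sums; conversely, any measurable subset of the union
  is cut along the \<open>A i\<close>.\<close>

lemma pos_part_sums:
  assumes "range A \<subseteq> sets M" "disjoint_family A"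
  shows "(\<lambda>i. pos_part (A i)) sums pos_part (\<Union>i. A i)"
proof -
  have part: "(\<Sum>i<n. pos_part (A i)) \<le> pos_part (\<Union>i<n. A i)" for n
  proof (induction n)
    case (Suc n)
    have "(\<Union>i<n. A i) \<inter> A n = {}"
      using assms(2) by (auto simp: disjoint_family_on_def disjoint_iff dest: less_imp_neq)
    from pos_part_superadditive[OF this] Suc show ?case
      by (simp add: lessThan_Suc Un_commute)
  qed (simp add: pos_part_nonneg)
  have le: "(\<Sum>i<n. pos_part (A i)) \<le> pos_part (\<Union>i. A i)" for n
    by (rule order_trans[OF part pos_part_mono]) auto
  then have summable: "summable (\<lambda>i. pos_part (A i))"
    by (intro summableI_nonneg_bounded[where x = "pos_part (\<Union>i. A i)"] pos_part_nonneg)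
  have "pos_part (\<Union>i. A i) \<le> (\<Sum>i. pos_part (A i))"
  proof (rule pos_part_least)
    fix B assume B: "B \<in> sets M" "B \<subseteq> (\<Union>i. A i)"
    have *: "(\<lambda>i. \<nu> (B \<inter> A i)) sums \<nu> (\<Union>i. B \<inter> A i)"
      using assms B by (intro sums) (auto simp: disjoint_family_on_def)
    also have "(\<Union>i. B \<inter> A i) = B" using B by auto
    finally have "\<nu> B = (\<Sum>i. \<nu> (B \<inter> A i))" by (simp add: sums_unique)
    also have "\<dots> \<le> (\<Sum>i. pos_part (A i))"
      using assms B sums_summable[OF *] summable
      by (intro suminf_le) (auto intro!: pos_part_upper)
    finally show "\<nu> B \<le> (\<Sum>i. pos_part (A i))" .
  qed
  moreover have "(\<Sum>i. pos_part (A i)) \<le> pos_part (\<Union>i. A i)"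
    by (intro suminf_le_const summable le)
  ultimately show ?thesis using summable by (metis order_antisym summable_sums)
qed

text \<open>Complementation within \<open>A\<close> exchanges the two suprema up to the shift
  \<open>\<nu> A\<close>, because \<open>\<nu> B = \<nu> A - \<nu> (A - B)\<close>.\<close>

lemma pos_part_diff:
  assumes "A \<in> sets M"
  shows "\<nu> A = pos_part A - signed_measure.pos_part M (\<lambda>A. - \<nu> A) A"
proof -
  interpret neg: signed_measure M "\<lambda>A. - \<nu> A" by (rule uminus)
  have "pos_part A \<le> neg.pos_part A + \<nu> A"
  proof (rule pos_part_least)
    fix B assume "B \<in> sets M" "B \<subseteq> A"
    then show "\<nu> B \<le> neg.pos_part A + \<nu> A"
      using neg.pos_part_upper[of "A - B" A] Diff[of A B] assms by auto
  qed
  moreover have "neg.pos_part A \<le> pos_part A - \<nu> A"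
  proof (rule neg.pos_part_least)
    fix B assume "B \<in> sets M" "B \<subseteq> A"
    then show "- \<nu> B \<le> pos_part A - \<nu> A"
      using pos_part_upper[of "A - B" A] Diff[of A B] assms by auto
  qed
  ultimately show ?thesis by linarith
qed

text \<open>The members of \<open>P\<close> with nonnegative value are merged into one set, the
  others into a second one; each of the two contributes at most \<open>C\<close>.\<close>

lemma sum_abs_le:
  assumes "finite P" "disjoint P" "P \<subseteq> sets M" "\<Union>P \<subseteq> D"
    and le: "\<And>B. \<lbrakk>B \<in> sets M; B \<subseteq> D\<rbrakk> \<Longrightarrow> \<bar>\<nu> B\<bar> \<le> C"
  shows "(\<Sum>B\<in>P. \<bar>\<nu> B\<bar>) \<le> 2 * C"
proof -
  define Q where "Q = {B \<in> P. \<nu> B \<ge> 0}"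
  have "(\<Sum>B\<in>P. \<bar>\<nu> B\<bar>) = (\<Sum>B\<in>Q. \<bar>\<nu> B\<bar>) + (\<Sum>B\<in>P - Q. \<bar>\<nu> B\<bar>)"
    using assms(1) by (metis (no_types, lifting) Q_def add.commute mem_Collect_eq subsetI sum.subset_diff)
  also have "(\<Sum>B\<in>Q. \<bar>\<nu> B\<bar>) = \<nu> (\<Union>Q)"
    using assms by (subst Union) (auto simp: Q_def pairwise_def)
  also have "(\<Sum>B\<in>P - Q. \<bar>\<nu> B\<bar>) = - \<nu> (\<Union>(P - Q))"
    using assms by (subst Union) (auto simp: Q_def pairwise_def sum_negf[symmetric] intro!: sum.cong)
  also have "\<nu> (\<Union>Q) + - \<nu> (\<Union>(P - Q)) \<le> \<bar>\<nu> (\<Union>Q)\<bar> + \<bar>\<nu> (\<Union>(P - Q))\<bar>" by linarith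
  also have "\<dots> \<le> C + C"
    using assms(1,3,4) by (intro add_mono le sets.finite_Union) (auto simp: Q_def)
  finally show ?thesis by simp
qed

end

subsection \<open>Bounded complex measures\<close>

lemma bounded_measures_null: "\<mu> \<in> bounded_measures T \<Longrightarrow> A \<notin> sets (borel_of T) \<Longrightarrow> \<mu> A = 0"
  by (simp add: bounded_measures_def)

lemma bounded_measures_sums:
  "\<lbrakk>\<mu> \<in> bounded_measures T; range A \<subseteq> sets (borel_of T); disjoint_family A\<rbrakk> \<Longrightarrow>
    (\<lambda>i. \<mu> (A i)) sums \<mu> (\<Union>i. A i)" for A :: "nat \<Rightarrow> 'a set"
  by (simp add: bounded_measures_def)

lemma cmeasure_eqI:
  assumes "\<mu> \<in> bounded_measures T" "\<nu> \<in> bounded_measures T"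
    and "\<And>A. A \<in> sets (borel_of T) \<Longrightarrow> \<mu> A = \<nu> A"
  shows "\<mu> = \<nu>"
  using assms bounded_measures_null by (metis ext)

text \<open>The factor 4 is 2 for real and imaginary part times the 2 of
  \<open>sum_abs_le\<close>.\<close>

lemma sum_cmod_le:
  assumes "signed_measure (borel_of T) (\<lambda>A. Re (\<mu> A))" "signed_measure (borel_of T) (\<lambda>A. Im (\<mu> A))"
    and P: "finite P" "disjoint P" "P \<subseteq> sets (borel_of T)" "\<Union>P \<subseteq> D"
    and le: "\<And>B. \<lbrakk>B \<in> sets (borel_of T); B \<subseteq> D\<rbrakk> \<Longrightarrow> cmod (\<mu> B) \<le> C"
  shows "(\<Sum>B\<in>P. cmod (\<mu> B)) \<le> 4 * C"
proof -
  have "(\<Sum>B\<in>P. cmod (\<mu> B)) \<le> (\<Sum>B\<in>P. \<bar>Re (\<mu> B)\<bar> + \<bar>Im (\<mu> B)\<bar>)"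
    by (intro sum_mono cmod_le)
  also have "\<dots> = (\<Sum>B\<in>P. \<bar>Re (\<mu> B)\<bar>) + (\<Sum>B\<in>P. \<bar>Im (\<mu> B)\<bar>)"
    by (rule sum.distrib)
  also have "\<dots> \<le> 2 * C + 2 * C"
  proof (rule add_mono)
    show "(\<Sum>B\<in>P. \<bar>Re (\<mu> B)\<bar>) \<le> 2 * C"
      by (rule signed_measure.sum_abs_le[OF assms(1) P]) (meson le order_trans abs_Re_le_cmod)
    show "(\<Sum>B\<in>P. \<bar>Im (\<mu> B)\<bar>) \<le> 2 * C"
      by (rule signed_measure.sum_abs_le[OF assms(2) P]) (meson le order_trans abs_Im_le_cmod)
  qed
  finally show ?thesis by simp
qed

lemma signed_measure_Re:
  assumes "\<And>A :: nat \<Rightarrow> 'a set. \<lbrakk>range A \<subseteq> sets M; disjoint_family A\<rbrakk> \<Longrightarrow> (\<lambda>i. \<mu> (A i)) sums \<mu> (\<Union>i. A i)"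
  shows "signed_measure M (\<lambda>A. Re (\<mu> A))" and "signed_measure M (\<lambda>A. Im (\<mu> A))"
  using assms by unfold_locales (auto simp: sums_complex_iff)

lemma bounded_measures_signed:
  assumes "\<mu> \<in> bounded_measures T"
  shows "signed_measure (borel_of T) (\<lambda>A. Re (\<mu> A))" and "signed_measure (borel_of T) (\<lambda>A. Im (\<mu> A))"
  using signed_measure_Re[of "borel_of T" \<mu>] bounded_measures_sums[OF assms] by auto

lemma bounded_measures_Un:
  assumes "\<mu> \<in> bounded_measures T" "A \<in> sets (borel_of T)" "B \<in> sets (borel_of T)" "A \<inter> B = {}"
  shows "\<mu> (A \<union> B) = \<mu> A + \<mu> B"
  using assms signed_measure.Un[OF bounded_measures_signed(1)[OF assms(1)]]
    signed_measure.Un[OF bounded_measures_signed(2)[OF assms(1)]]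
  by (auto simp: complex_eq_iff)

lemma bounded_measures_empty [simp]: "\<mu> \<in> bounded_measures T \<Longrightarrow> \<mu> {} = 0"
  using signed_measure.empty[OF bounded_measures_signed(1)] signed_measure.empty[OF bounded_measures_signed(2)]
  by (auto simp: complex_eq_iff)

lemma bounded_measures_UNION:
  assumes "\<mu> \<in> bounded_measures T" "finite I" "\<And>i. i \<in> I \<Longrightarrow> A i \<in> sets (borel_of T)"
    "disjoint_family_on A I"
  shows "\<mu> (\<Union>i\<in>I. A i) = (\<Sum>i\<in>I. \<mu> (A i))"
  using assms(2-)
proof (induction I)
  case (insert i I)
  have "A i \<inter> (\<Union>i\<in>I. A i) = {}"
    using insert by (auto simp: disjoint_family_on_def)
  moreover have "disjoint_family_on A I"
    using insert.prems by (auto simp: disjoint_family_on_def)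
  moreover have "(\<Union>i\<in>I. A i) \<in> sets (borel_of T)"
    using insert by (intro sets.finite_UN) auto
  ultimately have "\<mu> (A i \<union> (\<Union>i\<in>I. A i)) = \<mu> (A i) + (\<Sum>i\<in>I. \<mu> (A i))"
    using insert by (subst bounded_measures_Un[OF assms(1)]) auto
  then show ?case using insert by simp
qed (use bounded_measures_empty[OF assms(1)] in simp)

lemma bounded_measures_bounded:
  assumes "\<mu> \<in> bounded_measures T"
  shows "\<exists>C. \<forall>A\<in>sets (borel_of T). cmod (\<mu> A) \<le> C"
proof -
  obtain C D where "\<forall>A\<in>sets (borel_of T). \<bar>Re (\<mu> A)\<bar> \<le> C" "\<forall>A\<in>sets (borel_of T). \<bar>Im (\<mu> A)\<bar> \<le> D"
    using signed_measure.bounded[OF bounded_measures_signed(1)[OF assms]]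
      signed_measure.bounded[OF bounded_measures_signed(2)[OF assms]] by blast
  then show ?thesis
    by (intro exI[of _ "C + D"]) (force intro: order_trans[OF cmod_le])
qed

lemma cmod_le_total_variation:
  assumes "\<mu> \<in> bounded_measures T" "B \<in> sets (borel_of T)" "B \<subseteq> D"
  shows "cmod (\<mu> B) \<le> total_variation T \<mu> D"
proof -
  obtain C where C: "\<forall>A\<in>sets (borel_of T). cmod (\<mu> A) \<le> C"
    using bounded_measures_bounded[OF assms(1)] by blast
  have "bdd_above {\<Sum>B\<in>P. cmod (\<mu> B) | P. finite P \<and> disjoint P \<and> P \<subseteq> sets (borel_of T) \<and> \<Union>P \<subseteq> D}"
    using sum_cmod_le[OF bounded_measures_signed[OF assms(1)]] C
    by (intro bdd_aboveI[of _ "4 * C"]) auto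
  moreover have "cmod (\<mu> B) \<in> {\<Sum>B\<in>P. cmod (\<mu> B) | P. finite P \<and> disjoint P \<and> P \<subseteq> sets (borel_of T) \<and> \<Union>P \<subseteq> D}"
    using assms by (auto intro!: exI[of _ "{B}"])
  ultimately show ?thesis
    unfolding total_variation_def by (rule cSup_upper[rotated])
qed

text \<open>Up to the factor 4 of \<open>sum_cmod_le\<close>, the total variation of a set is the
  supremum of \<open>\<mu>\<close> over its Borel subsets, so regularity can be stated without total variations.\<close>

lemma bounded_measures_regular:
  assumes "\<mu> \<in> bounded_measures T" "A \<in> sets (borel_of T)" "\<epsilon> > 0"
  obtains C U where "compactin T C" "openin T U" "C \<subseteq> A" "A \<subseteq> U"
    "\<And>B. \<lbrakk>B \<in> sets (borel_of T); B \<subseteq> U - C\<rbrakk> \<Longrightarrow> cmod (\<mu> B) < \<epsilon>"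
proof -
  obtain C U where *: "compactin T C" "openin T U" "C \<subseteq> A" "A \<subseteq> U" "total_variation T \<mu> (U - C) < \<epsilon>"
    using assms unfolding bounded_measures_def by blast
  show thesis
  proof (rule that[OF *(1-4)])
    fix B assume "B \<in> sets (borel_of T)" "B \<subseteq> U - C"
    then show "cmod (\<mu> B) < \<epsilon>"
      using cmod_le_total_variation[OF assms(1)] *(5) by (meson le_less_trans)
  qed
qed

lemma bounded_measuresI:
  assumes null: "\<And>A. A \<notin> sets (borel_of T) \<Longrightarrow> \<mu> A = 0"
    and sums: "\<And>A :: nat \<Rightarrow> 'a set. \<lbrakk>range A \<subseteq> sets (borel_of T); disjoint_family A\<rbrakk> \<Longrightarrow>
      (\<lambda>i. \<mu> (A i)) sums \<mu> (\<Union>i. A i)"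
    and reg: "\<And>A \<epsilon>. \<lbrakk>A \<in> sets (borel_of T); \<epsilon> > 0\<rbrakk> \<Longrightarrow> \<exists>C U. compactin T C \<and> openin T U \<and>
      C \<subseteq> A \<and> A \<subseteq> U \<and> (\<forall>B\<in>sets (borel_of T). B \<subseteq> U - C \<longrightarrow> cmod (\<mu> B) \<le> \<epsilon>)"
  shows "\<mu> \<in> bounded_measures T"
proof -
  have "\<exists>C U. compactin T C \<and> openin T U \<and> C \<subseteq> A \<and> A \<subseteq> U \<and> total_variation T \<mu> (U - C) < \<epsilon>"
    if A: "A \<in> sets (borel_of T)" "\<epsilon> > 0" for A \<epsilon>
  proof -
    \<comment> \<open>With a fifth of \<open>\<epsilon>\<close> the factor 4 of
      \<open>sum_cmod_le\<close> still leaves a strict inequality.\<close>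
    obtain C U where CU: "compactin T C" "openin T U" "C \<subseteq> A" "A \<subseteq> U"
      and le: "\<And>B. \<lbrakk>B \<in> sets (borel_of T); B \<subseteq> U - C\<rbrakk> \<Longrightarrow> cmod (\<mu> B) \<le> \<epsilon> / 5"
      using reg[OF A(1), of "\<epsilon> / 5"] A(2) by auto
    have "total_variation T \<mu> (U - C) \<le> 4 * (\<epsilon> / 5)"
      unfolding total_variation_def
    proof (rule cSup_least)
      let ?S = "{\<Sum>B\<in>P. cmod (\<mu> B) | P. finite P \<and> disjoint P \<and> P \<subseteq> sets (borel_of T) \<and> \<Union>P \<subseteq> U - C}"
      have "0 \<in> ?S" by (rule CollectI, rule exI[of _ "{}"]) simp
      then show "?S \<noteq> {}" by (metis (mono_tags) empty_iff)
      fix x assume "x \<in> ?S"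
      then obtain P where P: "x = (\<Sum>B\<in>P. cmod (\<mu> B))"
        "finite P" "disjoint P" "P \<subseteq> sets (borel_of T)" "\<Union>P \<subseteq> U - C" by (elim CollectE exE conjE)
      show "x \<le> 4 * (\<epsilon> / 5)"
        unfolding P(1) by (rule sum_cmod_le[OF signed_measure_Re[OF sums] P(2-5) le])
    qed
    also have "\<dots> < \<epsilon>" using A(2) by simp
    finally show ?thesis using CU by blast
  qed
  then show ?thesis
    using null sums unfolding bounded_measures_def by blast
qed

lemma bounded_measures_lincomb:
  assumes \<mu>: "\<mu> \<in> bounded_measures T" and \<nu>: "\<nu> \<in> bounded_measures T"
  shows "(\<lambda>A. a * \<mu> A + b * \<nu> A) \<in> bounded_measures T"
proof (rule bounded_measuresI)
  show "\<And>A. A \<notin> sets (borel_of T) \<Longrightarrow> a * \<mu> A + b * \<nu> A = 0"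
    using assms by (simp add: bounded_measures_null)
  show "(\<lambda>i. a * \<mu> (A i) + b * \<nu> (A i)) sums (a * \<mu> (\<Union>i. A i) + b * \<nu> (\<Union>i. A i))"
    if "range A \<subseteq> sets (borel_of T)" "disjoint_family A" for A :: "nat \<Rightarrow> 'a set"
    using that assms by (intro sums_add sums_mult bounded_measures_sums)
next
  fix A and \<epsilon> :: real assume A: "A \<in> sets (borel_of T)" "\<epsilon> > 0"
  \<comment> \<open>The summand 1 keeps the denominator positive when \<open>a\<close> and
    \<open>b\<close> vanish.\<close>
  define \<delta> where "\<delta> = \<epsilon> / (cmod a + cmod b + 1)"
  have \<delta>: "\<delta> > 0" using A by (auto simp: \<delta>_def intro!: divide_pos_pos add_nonneg_pos)
  obtain C U where CU: "compactin T C" "openin T U" "C \<subseteq> A" "A \<subseteq> U"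
    "\<And>B. \<lbrakk>B \<in> sets (borel_of T); B \<subseteq> U - C\<rbrakk> \<Longrightarrow> cmod (\<mu> B) < \<delta>"
    using bounded_measures_regular[OF \<mu> A(1) \<delta>] by blast
  obtain C' U' where CU': "compactin T C'" "openin T U'" "C' \<subseteq> A" "A \<subseteq> U'"
    "\<And>B. \<lbrakk>B \<in> sets (borel_of T); B \<subseteq> U' - C'\<rbrakk> \<Longrightarrow> cmod (\<nu> B) < \<delta>"
    using bounded_measures_regular[OF \<nu> A(1) \<delta>] by blast
  have "cmod (a * \<mu> B + b * \<nu> B) \<le> \<epsilon>"
    if B: "B \<in> sets (borel_of T)" "B \<subseteq> U \<inter> U' - (C \<union> C')" for B
  proof -
    have "cmod (\<mu> B) < \<delta>" "cmod (\<nu> B) < \<delta>" using B by (intro CU CU'; blast)+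
    then have "cmod (a * \<mu> B + b * \<nu> B) \<le> cmod a * \<delta> + cmod b * \<delta>"
      by (intro norm_triangle_le add_mono) (auto simp: norm_mult intro!: mult_left_mono)
    also have "\<dots> \<le> (cmod a + cmod b + 1) * \<delta>" using \<delta> by (simp add: algebra_simps)
    also have "\<dots> = \<epsilon>"
    proof -
      have "cmod a + cmod b + 1 \<noteq> 0" using norm_ge_zero[of a] norm_ge_zero[of b] by linarith
      then show ?thesis by (simp add: \<delta>_def)
    qed
    finally show ?thesis .
  qed
  moreover have "C \<union> C' \<subseteq> A" "A \<subseteq> U \<inter> U'" using CU(3,4) CU'(3,4) by auto
  moreover have "compactin T (C \<union> C')" "openin T (U \<inter> U')"
    using CU(1,2) CU'(1,2) by (auto intro: compactin_Un)
  ultimately show "\<exists>C U. compactin T C \<and> openin T U \<and> C \<subseteq> A \<and> A \<subseteq> U \<and>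
      (\<forall>B\<in>sets (borel_of T). B \<subseteq> U - C \<longrightarrow> cmod (a * \<mu> B + b * \<nu> B) \<le> \<epsilon>)"
    by (intro exI[of _ "C \<union> C'"] exI[of _ "U \<inter> U'"] conjI ballI impI)
qed

lemma bounded_measures_scale: "\<mu> \<in> bounded_measures T \<Longrightarrow> (\<lambda>A. a * \<mu> A) \<in> bounded_measures T"
  using bounded_measures_lincomb[of \<mu> T \<mu> a 0] by simp

lemma bounded_measures_zero: "(\<lambda>A. 0) \<in> bounded_measures T"
proof (rule bounded_measuresI)
  fix A assume "A \<in> sets (borel_of T)"
  then show "\<exists>C U. compactin T C \<and> openin T U \<and> C \<subseteq> A \<and> A \<subseteq> U \<and>
      (\<forall>B\<in>sets (borel_of T). B \<subseteq> U - C \<longrightarrow> cmod 0 \<le> \<epsilon>)" if "\<epsilon> > 0" for \<epsilon> :: real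
    using that by (intro exI[of _ "{}"] exI[of _ "topspace T"]) (simp add: borel_of_subset)
qed simp_all

lemma bounded_measures_sum:
  "(\<And>i. i \<in> I \<Longrightarrow> \<mu> i \<in> bounded_measures T) \<Longrightarrow> (\<lambda>A. \<Sum>i\<in>I. c i * \<mu> i A) \<in> bounded_measures T"
proof (induction I rule: infinite_finite_induct)
  case (insert i I)
  then show ?case
    using bounded_measures_lincomb[of "\<mu> i" T "\<lambda>A. \<Sum>i\<in>I. c i * \<mu> i A" "c i" 1] by simp
qed (simp_all add: bounded_measures_zero)

subsection \<open>Positive measures\<close>

lemma positive_measures_bounded [dest]: "\<mu> \<in> positive_measures T \<Longrightarrow> \<mu> \<in> bounded_measures T"
  by (simp add: positive_measures_def)

lemma positive_measures_nonneg: "\<mu> \<in> positive_measures T \<Longrightarrow> \<mu> A \<in> \<real>\<^sub>\<ge>\<^sub>0"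
  by (cases "A \<in> sets (borel_of T)") (auto simp: positive_measures_def bounded_measures_null)

lemma positive_measures_of_real: "\<mu> \<in> positive_measures T \<Longrightarrow> \<mu> A = of_real (Re (\<mu> A))"
  using positive_measures_nonneg[of \<mu> T A] by (auto elim: nonneg_Reals_cases)

lemma positive_measures_Re: "\<mu> \<in> positive_measures T \<Longrightarrow> 0 \<le> Re (\<mu> A)"
  using positive_measures_nonneg[of \<mu> T A] by (auto elim: nonneg_Reals_cases)

lemma positive_measures_lincomb:
  assumes "\<mu> \<in> positive_measures T" "\<nu> \<in> positive_measures T" "a \<in> \<real>\<^sub>\<ge>\<^sub>0" "b \<in> \<real>\<^sub>\<ge>\<^sub>0"
  shows "(\<lambda>A. a * \<mu> A + b * \<nu> A) \<in> positive_measures T"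
  using assms bounded_measures_lincomb[of \<mu> T \<nu>]
  by (auto simp: positive_measures_def intro!: nonneg_Reals_add_I nonneg_Reals_mult_I)

lemma positive_measures_scale:
  "\<mu> \<in> positive_measures T \<Longrightarrow> a \<in> \<real>\<^sub>\<ge>\<^sub>0 \<Longrightarrow> (\<lambda>A. a * \<mu> A) \<in> positive_measures T"
  using positive_measures_lincomb[of \<mu> T \<mu> a 0] by simp

lemma positive_measures_zero: "(\<lambda>A. 0) \<in> positive_measures T"
  by (simp add: positive_measures_def bounded_measures_zero)

lemma positive_measures_sum:
  "(\<And>i. i \<in> I \<Longrightarrow> \<mu> i \<in> positive_measures T) \<Longrightarrow> (\<And>i. i \<in> I \<Longrightarrow> c i \<in> \<real>\<^sub>\<ge>\<^sub>0) \<Longrightarrow>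
    (\<lambda>A. \<Sum>i\<in>I. c i * \<mu> i A) \<in> positive_measures T"
proof (induction I rule: infinite_finite_induct)
  case (insert i I)
  then show ?case
    using positive_measures_lincomb[of "\<mu> i" T "\<lambda>A. \<Sum>i\<in>I. c i * \<mu> i A" "c i" 1] by simp
qed (simp_all add: positive_measures_zero)

text \<open>Domination hands the regularity of \<open>\<mu>\<close> over: on subsets of
  \<open>U - C\<close> all values of \<open>\<nu>\<close> are small, hence so is their supremum. It
  is applied to the real and imaginary parts of \<open>\<mu>\<close> with either sign.\<close>

lemma pos_part_positive_measure:
  assumes \<mu>: "\<mu> \<in> bounded_measures T" and "signed_measure (borel_of T) \<nu>"
    and le: "\<And>A. \<bar>\<nu> A\<bar> \<le> cmod (\<mu> A)"
  shows "(\<lambda>A. if A \<in> sets (borel_of T) then of_real (signed_measure.pos_part (borel_of T) \<nu> A) else 0)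
    \<in> positive_measures T" (is "?p \<in> _")
proof -
  interpret signed_measure "borel_of T" \<nu> by fact
  have "?p \<in> bounded_measures T"
  proof (rule bounded_measuresI)
    fix A :: "nat \<Rightarrow> 'a set" assume A: "range A \<subseteq> sets (borel_of T)" "disjoint_family A"
    then have "(\<lambda>i. complex_of_real (pos_part (A i))) sums of_real (pos_part (\<Union>i. A i))"
      by (intro sums_of_real pos_part_sums)
    moreover have "(\<Union>i. A i) \<in> sets (borel_of T)" "\<And>i. A i \<in> sets (borel_of T)" using A(1) by auto
    ultimately show "(\<lambda>i. ?p (A i)) sums ?p (\<Union>i. A i)" by simp
  next
    fix A and \<epsilon> :: real assume A: "A \<in> sets (borel_of T)" "\<epsilon> > 0"
    obtain C U where CU: "compactin T C" "openin T U" "C \<subseteq> A" "A \<subseteq> U"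
      "\<And>B. \<lbrakk>B \<in> sets (borel_of T); B \<subseteq> U - C\<rbrakk> \<Longrightarrow> cmod (\<mu> B) < \<epsilon>"
      using bounded_measures_regular[OF \<mu> A] by blast
    have "pos_part B \<le> \<epsilon>" if "B \<subseteq> U - C" for B
    proof (rule pos_part_least)
      fix E assume E: "E \<in> sets (borel_of T)" "E \<subseteq> B"
      then have "cmod (\<mu> E) < \<epsilon>" using CU(5)[of E] that by auto
      then show "\<nu> E \<le> \<epsilon>" using le[of E] by linarith
    qed
    then have "\<forall>B\<in>sets (borel_of T). B \<subseteq> U - C \<longrightarrow> cmod (?p B) \<le> \<epsilon>"
      by (simp add: pos_part_nonneg)
    then show "\<exists>C U. compactin T C \<and> openin T U \<and> C \<subseteq> A \<and> A \<subseteq> U \<and>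
        (\<forall>B\<in>sets (borel_of T). B \<subseteq> U - C \<longrightarrow> cmod (?p B) \<le> \<epsilon>)"
      using CU(1-4) by blast
  qed simp
  then show ?thesis by (simp add: positive_measures_def pos_part_nonneg)
qed

text \<open>Each element of \<open>M(T)\<close> is a combination of its four Jordan parts, so a
  statement stable under linear combinations only has to be proved on the positive cone, where the
  weak topology is available.\<close>

lemma bounded_measures_induct [consumes 1, case_names positive lincomb]:
  assumes \<mu>: "\<mu> \<in> bounded_measures T"
    and pos: "\<And>\<mu>. \<mu> \<in> positive_measures T \<Longrightarrow> P \<mu>"
    and lincomb: "\<And>\<mu> \<nu> a b. \<lbrakk>\<mu> \<in> bounded_measures T; \<nu> \<in> bounded_measures T; P \<mu>; P \<nu>\<rbrakk> \<Longrightarrow>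
      P (\<lambda>A. a * \<mu> A + b * \<nu> A)"
  shows "P \<mu>"
proof -
  define part where "part \<nu> A =
    (if A \<in> sets (borel_of T) then complex_of_real (signed_measure.pos_part (borel_of T) \<nu> A) else 0)"
    for \<nu> :: "'a set \<Rightarrow> real" and A
  have real: "P (\<lambda>A. of_real (\<nu> A)) \<and> (\<lambda>A. of_real (\<nu> A)) \<in> bounded_measures T"
    if \<nu>: "signed_measure (borel_of T) \<nu>" and le: "\<And>A. \<bar>\<nu> A\<bar> \<le> cmod (\<mu> A)" for \<nu>
  proof -
    have p: "part \<nu> \<in> positive_measures T" "part (\<lambda>A. - \<nu> A) \<in> positive_measures T"
      unfolding part_def using le \<nu>
      by (intro pos_part_positive_measure[OF \<mu>] signed_measure.uminus; simp)+
    have "\<nu> A = 0" if "A \<notin> sets (borel_of T)" for A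
      using le[of A] bounded_measures_null[OF \<mu> that] by simp
    then have "(\<lambda>A. complex_of_real (\<nu> A)) = (\<lambda>A. 1 * part \<nu> A + (- 1) * part (\<lambda>A. - \<nu> A) A)"
      using signed_measure.pos_part_diff[OF \<nu>] by (auto simp: part_def fun_eq_iff simp flip: of_real_diff)
    then show ?thesis
      using lincomb[of "part \<nu>" "part (\<lambda>A. - \<nu> A)" 1 "- 1"] p pos
        bounded_measures_lincomb[of "part \<nu>" T "part (\<lambda>A. - \<nu> A)" 1 "- 1"] by auto
  qed
  have "P (\<lambda>A. 1 * of_real (Re (\<mu> A)) + \<i> * of_real (Im (\<mu> A)))"
    using real[of "\<lambda>A. Re (\<mu> A)"] real[of "\<lambda>A. Im (\<mu> A)"] bounded_measures_signed[OF \<mu>]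
    by (intro lincomb) (auto simp: abs_Re_le_cmod abs_Im_le_cmod)
  moreover have "(\<lambda>A. 1 * of_real (Re (\<mu> A)) + \<i> * of_real (Im (\<mu> A))) = \<mu>"
    by (simp add: fun_eq_iff complex_eq_iff)
  ultimately show ?thesis by simp
qed

subsection \<open>Integration against positive measures\<close>

text \<open>Of the four library measures inside \<open>cintegral\<close>, this is the only one that
  can be nonzero when \<open>\<mu>\<close> is positive; it then represents \<open>\<mu>\<close>
  itself.\<close>

definition borel_measure :: "'a topology \<Rightarrow> 'a cmeasure \<Rightarrow> 'a measure" where
  "borel_measure T \<mu> = upper_variation T (\<lambda>A. Re (\<mu> A))"

lemma sets_borel_measure [simp]: "sets (borel_measure T \<mu>) = sets (borel_of T)"
  unfolding borel_measure_def upper_variation_def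
  by (subst sets_measure_of) (auto dest: borel_of_subset simp: sets.sigma_sets_eq[of "borel_of T", simplified])

lemma space_borel_measure [simp]: "space (borel_measure T \<mu>) = topspace T"
  unfolding borel_measure_def upper_variation_def by (simp add: space_measure_of_conv)

lemma measurable_borel_measure [simp]:
  "measurable (borel_measure T \<mu>) N = measurable (borel_of T) N"
  by (intro measurable_cong_sets) auto

text \<open>Positivity makes \<open>\<mu>\<close> monotone, so the supremum in the upper variation
  is attained at \<open>A\<close> itself.\<close>

lemma emeasure_borel_measure:
  assumes \<mu>: "\<mu> \<in> positive_measures T" and A: "A \<in> sets (borel_of T)"
  shows "emeasure (borel_measure T \<mu>) A = ennreal (Re (\<mu> A))"
proof -
  have \<mu>': "\<mu> \<in> bounded_measures T" using \<mu> by auto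
  interpret signed_measure "borel_of T" "\<lambda>A. Re (\<mu> A)" by (rule bounded_measures_signed[OF \<mu>'])
  have sup: "Sup {Re (\<mu> B) | B. B \<in> sets (borel_of T) \<and> B \<subseteq> A} = Re (\<mu> A)"
    if "A \<in> sets (borel_of T)" for A
  proof (rule cSup_eq_maximum)
    fix x assume "x \<in> {Re (\<mu> B) | B. B \<in> sets (borel_of T) \<and> B \<subseteq> A}"
    then obtain B where "x = Re (\<mu> B)" "B \<in> sets (borel_of T)" "B \<subseteq> A" by auto
    then show "x \<le> Re (\<mu> A)"
      using Diff[of A B] positive_measures_Re[OF \<mu>, of "A - B"] that by auto
  qed (use that in auto)
  define f where "f A = ennreal (Sup {Re (\<mu> B) | B. B \<in> sets (borel_of T) \<and> B \<subseteq> A})" for A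
  have f: "f A = ennreal (Re (\<mu> A))" if "A \<in> sets (borel_of T)" for A
    using sup[OF that] by (simp add: f_def)
  have "countably_additive (sets (borel_of T)) f"
  proof (rule countably_additiveI)
    fix A :: "nat \<Rightarrow> 'a set"
    assume A: "range A \<subseteq> sets (borel_of T)" "disjoint_family A" "(\<Union>i. A i) \<in> sets (borel_of T)"
    have "(\<Sum>i. f (A i)) = (\<Sum>i. ennreal (Re (\<mu> (A i))))"
      using A(1) by (intro suminf_cong f) auto
    also have "\<dots> = ennreal (Re (\<mu> (\<Union>i. A i)))"
      using sums[OF A(1,2)] positive_measures_Re[OF \<mu>] by (intro suminf_ennreal_eq)
    also have "\<dots> = f (\<Union>i. A i)" using f[OF A(3)] by simp
    finally show "(\<Sum>i. f (A i)) = f (\<Union>i. A i)" .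
  qed
  moreover have "positive (sets (borel_of T)) f"
    using f[of "{}"] by (simp add: positive_def)
  ultimately have "emeasure (measure_of (topspace T) (sets (borel_of T)) f) A = f A"
    using A sets.sigma_algebra_axioms[of "borel_of T"]
    by (intro emeasure_measure_of_sigma) auto
  then show ?thesis
    using f[OF A] unfolding borel_measure_def upper_variation_def f_def by simp
qed

lemma measure_borel_measure:
  assumes "\<mu> \<in> positive_measures T" shows "measure (borel_measure T \<mu>) A = Re (\<mu> A)"
proof (cases "A \<in> sets (borel_of T)")
  case True
  then show ?thesis
    using emeasure_borel_measure[OF assms] positive_measures_Re[OF assms] by (simp add: measure_def)
next
  case False
  then show ?thesis
    using bounded_measures_null[OF positive_measures_bounded[OF assms] False]
    by (simp add: measure_notin_sets)
qed

lemma finite_measure_borel_measure: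
  "\<mu> \<in> positive_measures T \<Longrightarrow> finite_measure (borel_measure T \<mu>)"
  by (intro finite_measureI) (simp add: emeasure_borel_measure)

lemma integral_upper_variation_zero:
  assumes "\<And>A. \<nu> A \<le> 0" "\<nu> {} = 0"
  shows "(\<integral>x. f x \<partial>upper_variation T \<nu>) = (0::complex)"
proof -
  have "Sup {\<nu> B | B. B \<in> sets (borel_of T) \<and> B \<subseteq> A} = 0" for A
    using assms by (intro cSup_eq_maximum) (auto intro!: exI[of _ "{}"])
  \<comment> \<open>Outside its sigma-algebra \<open>measure_of\<close> yields 0 anyway, so
    \<open>A\<close> may be any set.\<close>
  then have "emeasure (upper_variation T \<nu>) A = 0" for A
    unfolding upper_variation_def by (simp add: emeasure_measure_of_conv)
  then have "AE x in upper_variation T \<nu>. f x = 0"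
    by (intro AE_I[of _ _ "space (upper_variation T \<nu>)"]) auto
  then show ?thesis by (rule integral_eq_zero_AE)
qed

lemma cintegral_positive:
  assumes "\<mu> \<in> positive_measures T"
  shows "cintegral T \<mu> f = (\<integral>x. f x \<partial>borel_measure T \<mu>)"
proof -
  have Im: "Im (\<mu> A) = 0" for A
    using positive_measures_of_real[OF assms, of A] by (metis Im_complex_of_real)
  have "\<mu> {} = 0" using assms by auto
  then have "(\<integral>x. f x \<partial>upper_variation T (\<lambda>A. - Re (\<mu> A))) = 0"
      "(\<integral>x. f x \<partial>upper_variation T (\<lambda>A. Im (\<mu> A))) = 0"
      "(\<integral>x. f x \<partial>upper_variation T (\<lambda>A. - Im (\<mu> A))) = 0"
    using positive_measures_Re[OF assms] by (intro integral_upper_variation_zero; simp add: Im)+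
  then show ?thesis unfolding cintegral_def borel_measure_def by simp
qed

text \<open>Inverse to \<open>borel_measure\<close> on finite regular measures.
  \<open>measure\<close> is 0 off the measurable sets, which matches the normalization of
  \<open>M(T)\<close>.\<close>

definition cmeasure_of :: "'a measure \<Rightarrow> 'a cmeasure" where
  "cmeasure_of M = (\<lambda>A. complex_of_real (measure M A))"

lemma borel_measure_cmeasure_of:
  assumes "finite_measure M" "sets M = sets (borel_of T)" "cmeasure_of M \<in> positive_measures T"
  shows "borel_measure T (cmeasure_of M) = M"
proof (rule measure_eqI)
  fix A assume "A \<in> sets (borel_measure T (cmeasure_of M))"
  then show "emeasure (borel_measure T (cmeasure_of M)) A = emeasure M A"
    using emeasure_borel_measure[OF assms(3), of A] assms(1)
    by (simp add: cmeasure_of_def finite_measure.emeasure_eq_measure)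
qed (use assms in simp)

lemma cmeasure_of_positive:
  assumes "finite_measure M" and M: "sets M = sets (borel_of T)"
    and reg: "\<And>A \<epsilon>. \<lbrakk>A \<in> sets M; \<epsilon> > 0\<rbrakk> \<Longrightarrow>
      \<exists>C U. compactin T C \<and> openin T U \<and> C \<in> sets M \<and> C \<subseteq> A \<and> A \<subseteq> U \<and> measure M (U - C) \<le> \<epsilon>"
  shows "cmeasure_of M \<in> positive_measures T"
proof -
  interpret finite_measure M by fact
  have "cmeasure_of M \<in> bounded_measures T"
  proof (rule bounded_measuresI)
    fix A assume "A \<notin> sets (borel_of T)"
    then show "cmeasure_of M A = 0" by (simp add: cmeasure_of_def measure_notin_sets M)
  next
    fix A :: "nat \<Rightarrow> 'a set" assume "range A \<subseteq> sets (borel_of T)" "disjoint_family A"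
    then show "(\<lambda>i. cmeasure_of M (A i)) sums cmeasure_of M (\<Union>i. A i)"
      unfolding cmeasure_of_def by (intro sums_of_real finite_measure_UNION) (auto simp: M)
  next
    fix A and \<epsilon> :: real assume "A \<in> sets (borel_of T)" "\<epsilon> > 0"
    then obtain C U where CU: "compactin T C" "openin T U" "C \<in> sets M" "C \<subseteq> A" "A \<subseteq> U" "measure M (U - C) \<le> \<epsilon>"
      using reg[of A \<epsilon>] M by auto
    have "measure M B \<le> \<epsilon>" if "B \<subseteq> U - C" for B
    proof -
      have "U - C \<in> sets M" using CU(2,3) M by auto
      then show ?thesis using CU(6) finite_measure_mono[OF that] by linarith
    qed
    then show "\<exists>C U. compactin T C \<and> openin T U \<and> C \<subseteq> A \<and> A \<subseteq> U \<and>
        (\<forall>B\<in>sets (borel_of T). B \<subseteq> U - C \<longrightarrow> cmod (cmeasure_of M B) \<le> \<epsilon>)"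
      using CU by (auto simp: cmeasure_of_def)
  qed
  then show ?thesis by (simp add: positive_measures_def cmeasure_of_def)
qed

section \<open>Approximation of integrals by Riemann sums\<close>

lemma continuous_map_bounded:
  assumes "compact_space T" "continuous_map T euclidean (f :: 'a \<Rightarrow> complex)"
  obtains B where "B \<ge> 0" "\<And>x. x \<in> topspace T \<Longrightarrow> cmod (f x) \<le> B"
proof -
  have "compact (f ` topspace T)"
    using image_compactin[OF assms(1)[unfolded compact_space_def] assms(2)] by simp
  then obtain B where "\<forall>x\<in>topspace T. cmod (f x) \<le> B"
    using compact_imp_bounded bounded_iff by (metis (no_types, opaque_lifting) imageI)
  then show thesis using that[of "max B 0"] by (simp add: le_max_iff_disj)
qed

lemma bounded_continuous_iff:
  "compact_space T \<Longrightarrow> f \<in> bounded_continuous T \<longleftrightarrow> continuous_map T euclidean f"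
  unfolding bounded_continuous_def
  by (auto simp: bounded_iff) (metis continuous_map_bounded)

lemma integrable_borel_measure:
  assumes "compact_space T" "\<mu> \<in> positive_measures T" "continuous_map T euclidean (f :: 'a \<Rightarrow> complex)"
  shows "integrable (borel_measure T \<mu>) f"
proof -
  interpret finite_measure "borel_measure T \<mu>" by (rule finite_measure_borel_measure) fact
  obtain B where "\<And>x. x \<in> topspace T \<Longrightarrow> cmod (f x) \<le> B"
    using continuous_map_bounded[OF assms(1,3)] by metis
  then show ?thesis
    using continuous_map_borel_measurable[OF assms(3)]
    by (intro integrable_const_bound[of _ B]) (auto intro!: AE_I2)
qed

text \<open>A selection \<open>s\<close> with finitely many values plays the role of a partition with sample points.\<close>

definition sample_selection :: "'a topology \<Rightarrow> ('a \<Rightarrow> 'a) \<Rightarrow> bool" where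
  "sample_selection T s \<longleftrightarrow> s \<in> topspace T \<rightarrow> topspace T \<and> finite (s ` topspace T) \<and>
     (\<forall>x. {y \<in> topspace T. s y = x} \<in> sets (borel_of T))"

definition riemann_sum :: "'a topology \<Rightarrow> ('a \<Rightarrow> 'a) \<Rightarrow> 'a cmeasure \<Rightarrow> ('a \<Rightarrow> complex) \<Rightarrow> complex" where
  "riemann_sum T s \<mu> f = (\<Sum>x\<in>s ` topspace T. \<mu> {y \<in> topspace T. s y = x} * f x)"

text \<open>The Riemann sum is the integral of the step function \<open>f \<circ> s\<close>, called
  \<open>g\<close> in the proof, which is uniformly within \<open>\<epsilon>\<close> of
  \<open>f\<close>.\<close>

lemma riemann_sum_approx:
  assumes T: "compact_space T" and \<mu>: "\<mu> \<in> positive_measures T"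
    and f: "continuous_map T euclidean f" and s: "sample_selection T s"
    and le: "\<And>y. y \<in> topspace T \<Longrightarrow> cmod (f y - f (s y)) \<le> \<epsilon>"
  shows "cmod (cintegral T \<mu> f - riemann_sum T s \<mu> f) \<le> \<epsilon> * Re (\<mu> (topspace T))"
proof -
  let ?M = "borel_measure T \<mu>"
  let ?S = "\<lambda>x. {y \<in> topspace T. s y = x}"
  interpret finite_measure ?M by (rule finite_measure_borel_measure) fact
  have S: "?S x \<in> sets ?M" for x using s by (simp add: sample_selection_def)
  define g where "g y = (\<Sum>x\<in>s ` topspace T. indicator (?S x) y *\<^sub>R f x)" for y
  have g: "g y = f (s y)" if "y \<in> topspace T" for y
  proof -
    have "g y = (\<Sum>x\<in>s ` topspace T. if x = s y then f x else 0)"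
      unfolding g_def using that by (intro sum.cong) (auto simp: indicator_def)
    then show ?thesis using s that by (simp add: sample_selection_def)
  qed
  have int: "integrable ?M (\<lambda>y. indicator (?S x) y *\<^sub>R f x)" for x
    using S[of x] by (intro integrable_scaleR_left integrable_real_indicator) (auto simp: emeasure_eq_measure)
  then have intg: "integrable ?M g" unfolding g_def by (intro Bochner_Integration.integrable_sum)
  have "(\<integral>y. g y \<partial>?M) = (\<Sum>x\<in>s ` topspace T. measure ?M (?S x) *\<^sub>R f x)"
    unfolding g_def
  proof (subst Bochner_Integration.integral_sum)
    have "(\<integral>y. indicator (?S x) y *\<^sub>R f x \<partial>?M) = measure ?M (?S x) *\<^sub>R f x" for x
      using sets.Int_space_eq2[OF S[of x]] S[of x]
      by (subst integral_scaleR_left) (auto intro!: integrable_real_indicator simp: emeasure_eq_measure)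
    then show "(\<Sum>x\<in>s ` topspace T. \<integral>y. indicator (?S x) y *\<^sub>R f x \<partial>?M) =
        (\<Sum>x\<in>s ` topspace T. measure ?M (?S x) *\<^sub>R f x)" by simp
  qed (rule int)
  also have "\<dots> = riemann_sum T s \<mu> f"
    unfolding riemann_sum_def
    by (simp add: measure_borel_measure[OF \<mu>] scaleR_conv_of_real flip: positive_measures_of_real[OF \<mu>])
  finally have "cintegral T \<mu> f - riemann_sum T s \<mu> f = (\<integral>y. f y - g y \<partial>?M)"
    using intg integrable_borel_measure[OF T \<mu> f] by (simp add: cintegral_positive[OF \<mu>])
  also have "cmod \<dots> \<le> (\<integral>y. cmod (f y - g y) \<partial>?M)"
    by (rule integral_norm_bound)
  also have "\<dots> \<le> (\<integral>y. \<epsilon> \<partial>?M)"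
    using intg integrable_borel_measure[OF T \<mu> f] g le
    by (intro integral_mono integrable_norm Bochner_Integration.integrable_diff) auto
  also have "\<dots> = \<epsilon> * Re (\<mu> (topspace T))"
    using measure_borel_measure[OF \<mu>] by (simp add: mult.commute)
  finally show ?thesis .
qed

text \<open>By compactness finitely many sets \<open>V x\<close> cover the space, and on each of
  them every \<open>f\<close> in \<open>F\<close> stays within \<open>\<epsilon>\<close> of its
  value at \<open>x\<close>. A point in several of them is assigned to the one added last, which
  keeps the fibres Borel. In the density argument one selection has to serve several functions at
  once.\<close>

lemma sample_selection_exists:
  fixes F :: "('a \<Rightarrow> complex) set"
  assumes T: "compact_space T" and F: "finite F" "\<And>f. f \<in> F \<Longrightarrow> continuous_map T euclidean f" and "\<epsilon> > 0"
  obtains s where "sample_selection T s"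
    "\<And>f y. \<lbrakk>f \<in> F; y \<in> topspace T\<rbrakk> \<Longrightarrow> cmod (f y - f (s y)) \<le> \<epsilon>"
proof -
  define V where "V x = {y \<in> topspace T. \<forall>f\<in>F. f y \<in> ball (f x) \<epsilon>}" for x
  have V: "openin T (V x)" for x
  proof -
    have "V x = topspace T \<inter> (\<Inter>f\<in>F. {y \<in> topspace T. f y \<in> ball (f x) \<epsilon>})"
      by (auto simp: V_def)
    also have "openin T \<dots>"
    proof (cases "F = {}")
      case False
      have "openin T {y \<in> topspace T. f y \<in> ball (f x) \<epsilon>}" if "f \<in> F" for f
        using openin_continuous_map_preimage[OF F(2)[OF that], of "ball (f x) \<epsilon>"] by simp
      with F(1) False show ?thesis
        by (intro openin_Int openin_INT2 openin_topspace)
    qed simp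
    finally show ?thesis .
  qed
  have "topspace T \<subseteq> \<Union>(V ` topspace T)" using \<open>\<epsilon> > 0\<close> by (auto simp: V_def)
  then obtain \<F> where "finite \<F>" "\<F> \<subseteq> V ` topspace T" "topspace T \<subseteq> \<Union>\<F>"
    using T V unfolding compact_space_alt by (metis (no_types, lifting) imageE)
  then obtain X where X: "finite X" "X \<subseteq> topspace T" "topspace T \<subseteq> \<Union>(V ` X)"
    by (metis finite_subset_image)
  have "\<exists>s. (\<forall>y\<in>\<Union>(V ` Y). s y \<in> Y \<and> y \<in> V (s y)) \<and>
      (\<forall>x. {y \<in> \<Union>(V ` Y). s y = x} \<in> sets (borel_of T))" if "finite Y" for Y
    using that
  proof (induction Y)
    case (insert a Y)
    then obtain s where s: "\<forall>y\<in>\<Union>(V ` Y). s y \<in> Y \<and> y \<in> V (s y)"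
      "\<And>x. {y \<in> \<Union>(V ` Y). s y = x} \<in> sets (borel_of T)" by blast
    define t where "t y = (if y \<in> V a then a else s y)" for y
    have "{y \<in> \<Union>(V ` insert a Y). t y = x} \<in> sets (borel_of T)" for x
    proof -
      have "{y \<in> \<Union>(V ` insert a Y). t y = x} =
          (if x = a then V a else {}) \<union> ({y \<in> \<Union>(V ` Y). s y = x} - V a)"
        by (auto simp: t_def)
      then show ?thesis using s(2)[of x] openin_borel[OF V[of a]] by auto
    qed
    moreover have "\<forall>y\<in>\<Union>(V ` insert a Y). t y \<in> insert a Y \<and> y \<in> V (t y)"
      using s(1) by (auto simp: t_def)
    ultimately show ?case by blast
  qed simp
  then obtain s where s: "\<forall>y\<in>\<Union>(V ` X). s y \<in> X \<and> y \<in> V (s y)"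
    "\<And>x. {y \<in> \<Union>(V ` X). s y = x} \<in> sets (borel_of T)" using X(1) by meson
  have "\<Union>(V ` X) = topspace T" using X(3) by (auto simp: V_def)
  with s have s: "\<And>y. y \<in> topspace T \<Longrightarrow> s y \<in> X \<and> y \<in> V (s y)"
    "\<And>x. {y \<in> topspace T. s y = x} \<in> sets (borel_of T)" by auto
  show thesis
  proof (rule that)
    show "sample_selection T s"
      using s X by (auto simp: sample_selection_def intro: finite_subset[of "s ` topspace T" X])
    show "cmod (f y - f (s y)) \<le> \<epsilon>" if "f \<in> F" "y \<in> topspace T" for f y
      using s(1)[OF that(2)] that(1) by (auto simp: V_def dist_norm norm_minus_commute intro: less_imp_le)
  qed
qed

subsection \<open>Linearity and uniqueness\<close>

text \<open>Fitted to estimates whose error is \<open>\<epsilon>\<close> times a total mass.\<close>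

lemma complex_zeroI:
  assumes "\<And>\<epsilon>. \<epsilon> > 0 \<Longrightarrow> cmod z \<le> \<epsilon> * c"
  shows "z = 0"
proof (rule ccontr)
  assume "z \<noteq> 0"
  define k where "k = \<bar>c\<bar> + 1"
  have k: "k > 0" "c \<le> k" by (auto simp: k_def)
  have "cmod z \<le> cmod z / (2 * k) * c" using \<open>z \<noteq> 0\<close> k by (intro assms) simp
  also have "\<dots> \<le> cmod z / (2 * k) * k" using k by (intro mult_left_mono) auto
  also have "\<dots> = cmod z / 2" using k by simp
  finally show False using \<open>z \<noteq> 0\<close> by simp
qed

lemma riemann_sum_lincomb:
  "riemann_sum T s (\<lambda>A. a * \<mu> A + b * \<nu> A) f = a * riemann_sum T s \<mu> f + b * riemann_sum T s \<nu> f"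
  unfolding riemann_sum_def by (simp add: sum_distrib_left sum.distrib[symmetric] algebra_simps)

text \<open>The suprema behind \<open>cintegral\<close> are not visibly additive in the measure.
  Riemann sums are, and one selection approximates all three integrals.\<close>

lemma cintegral_lincomb:
  assumes T: "compact_space T" and \<mu>: "\<mu> \<in> positive_measures T" and \<nu>: "\<nu> \<in> positive_measures T"
    and ab: "a \<in> \<real>\<^sub>\<ge>\<^sub>0" "b \<in> \<real>\<^sub>\<ge>\<^sub>0" and f: "continuous_map T euclidean f"
  shows "cintegral T (\<lambda>A. a * \<mu> A + b * \<nu> A) f = a * cintegral T \<mu> f + b * cintegral T \<nu> f"
proof -
  let ?\<rho> = "\<lambda>A. a * \<mu> A + b * \<nu> A" and ?m = "\<lambda>\<mu>. Re (\<mu> (topspace T))"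
  have \<rho>: "?\<rho> \<in> positive_measures T" by (rule positive_measures_lincomb[OF \<mu> \<nu> ab])
  have "cintegral T ?\<rho> f - (a * cintegral T \<mu> f + b * cintegral T \<nu> f) = 0"
  proof (rule complex_zeroI)
    fix \<epsilon> :: real assume "\<epsilon> > 0"
    obtain s where s: "sample_selection T s" "\<And>y. y \<in> topspace T \<Longrightarrow> cmod (f y - f (s y)) \<le> \<epsilon>"
      using sample_selection_exists[OF T, of "{f}" \<epsilon>] f \<open>\<epsilon> > 0\<close>
      by (metis finite.emptyI finite.insertI insertI1 singletonD)
    define d where "d \<mu> = cintegral T \<mu> f - riemann_sum T s \<mu> f" for \<mu>
    have d: "cmod (d \<mu>) \<le> \<epsilon> * ?m \<mu>" if "\<mu> \<in> positive_measures T" for \<mu>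
      using riemann_sum_approx[OF T that f s] unfolding d_def .
    have eq: "cintegral T ?\<rho> f - (a * cintegral T \<mu> f + b * cintegral T \<nu> f) = d ?\<rho> - (a * d \<mu> + b * d \<nu>)"
      by (simp add: d_def riemann_sum_lincomb algebra_simps)
    have "cmod (d ?\<rho> - (a * d \<mu> + b * d \<nu>)) \<le> cmod (d ?\<rho>) + (cmod a * cmod (d \<mu>) + cmod b * cmod (d \<nu>))"
      using norm_triangle_ineq4[of "d ?\<rho>" "a * d \<mu> + b * d \<nu>"]
        norm_triangle_ineq[of "a * d \<mu>" "b * d \<nu>"] unfolding norm_mult by linarith
    moreover have "cmod a * cmod (d \<mu>) \<le> cmod a * (\<epsilon> * ?m \<mu>)" "cmod b * cmod (d \<nu>) \<le> cmod b * (\<epsilon> * ?m \<nu>)"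
      by (rule mult_left_mono[OF d[OF \<mu>] norm_ge_zero], rule mult_left_mono[OF d[OF \<nu>] norm_ge_zero])
    ultimately have "cmod (d ?\<rho> - (a * d \<mu> + b * d \<nu>)) \<le>
        \<epsilon> * ?m ?\<rho> + (cmod a * (\<epsilon> * ?m \<mu>) + cmod b * (\<epsilon> * ?m \<nu>))"
      using d[OF \<rho>] by linarith
    then show "cmod (cintegral T ?\<rho> f - (a * cintegral T \<mu> f + b * cintegral T \<nu> f)) \<le>
        \<epsilon> * (?m ?\<rho> + (cmod a * ?m \<mu> + cmod b * ?m \<nu>))"
      unfolding eq by (simp only: distrib_left mult.left_commute)
  qed
  then show ?thesis by simp
qed

lemma cintegral_zero_measure: "cintegral T (\<lambda>A. 0) f = 0"
  unfolding cintegral_def by (simp add: integral_upper_variation_zero)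

lemma cintegral_scale:
  assumes "compact_space T" "\<mu> \<in> positive_measures T" "a \<in> \<real>\<^sub>\<ge>\<^sub>0" "continuous_map T euclidean f"
  shows "cintegral T (\<lambda>A. a * \<mu> A) f = a * cintegral T \<mu> f"
  using cintegral_lincomb[of T \<mu> \<mu> a 0 f] assms by simp

lemma cintegral_sum:
  assumes "compact_space T" "\<And>i. i \<in> I \<Longrightarrow> \<mu> i \<in> positive_measures T" "\<And>i. i \<in> I \<Longrightarrow> c i \<in> \<real>\<^sub>\<ge>\<^sub>0"
    "continuous_map T euclidean f"
  shows "cintegral T (\<lambda>A. \<Sum>i\<in>I. c i * \<mu> i A) f = (\<Sum>i\<in>I. c i * cintegral T (\<mu> i) f)"
  using assms(2,3)
proof (induction I rule: infinite_finite_induct)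
  case (insert i I)
  then have "(\<lambda>A. \<Sum>i\<in>I. c i * \<mu> i A) \<in> positive_measures T" by (intro positive_measures_sum) auto
  then show ?case
    using insert cintegral_lincomb[of T "\<mu> i" "\<lambda>A. \<Sum>i\<in>I. c i * \<mu> i A" "c i" 1 f] assms(1,4) by simp
qed (simp_all add: cintegral_zero_measure)

text \<open>Regularity rests on points being closed: \<open>{x}\<close> is the inner set if
  \<open>x\<close> lies in \<open>A\<close>, its complement the outer set otherwise.\<close>

lemma dirac_positive:
  assumes "Hausdorff_space T" "x \<in> topspace T"
  shows "dirac T x \<in> positive_measures T"
proof -
  have "dirac T x \<in> bounded_measures T"
  proof (rule bounded_measuresI)
    fix A :: "nat \<Rightarrow> 'a set" assume A: "range A \<subseteq> sets (borel_of T)" "disjoint_family A"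
    have AU: "(\<Union>i. A i) \<in> sets (borel_of T)" "\<And>i. A i \<in> sets (borel_of T)" using A(1) by auto
    show "(\<lambda>i. dirac T x (A i)) sums dirac T x (\<Union>i. A i)"
    proof (cases "\<exists>n. x \<in> A n")
      case True
      then obtain n where n: "x \<in> A n" by blast
      then have "x \<notin> A i" if "i \<noteq> n" for i
        using A(2) that unfolding disjoint_family_on_def by blast
      then have "(\<lambda>i. dirac T x (A i)) = (\<lambda>i. if i = n then 1 else 0)"
        using n AU by (auto simp: dirac_def fun_eq_iff)
      moreover have "dirac T x (\<Union>i. A i) = 1" using AU n by (auto simp: dirac_def)
      ultimately show ?thesis using sums_single[of n "\<lambda>_. 1 :: complex"] by simp
    next
      case False
      then show ?thesis by (simp add: dirac_def)
    qed
  next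
    fix A and \<epsilon> :: real assume A: "A \<in> sets (borel_of T)" "\<epsilon> > 0"
    have "closedin T {x}"
      using assms by (simp add: Hausdorff_imp_t1_space closedin_t1_singleton)
    then have o: "openin T (topspace T - {x})" by (simp add: openin_diff)
    show "\<exists>C U. compactin T C \<and> openin T U \<and> C \<subseteq> A \<and> A \<subseteq> U \<and>
        (\<forall>B\<in>sets (borel_of T). B \<subseteq> U - C \<longrightarrow> cmod (dirac T x B) \<le> \<epsilon>)"
    proof (cases "x \<in> A")
      case True
      with A assms borel_of_subset[of A T] show ?thesis
        by (intro exI[of _ "{x}"] exI[of _ "topspace T"]) (auto simp: dirac_def)
    next
      case False
      with A o borel_of_subset[of A T] show ?thesis
        by (intro exI[of _ "{}"] exI[of _ "topspace T - {x}"]) (auto simp: dirac_def)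
    qed
  qed (simp add: dirac_def)
  then show ?thesis by (simp add: positive_measures_def dirac_def)
qed

text \<open>Only the fibre of \<open>s\<close> that contains \<open>x\<close> has mass, so the
  Riemann sum is \<open>f (s x)\<close>, which is close to \<open>f x\<close>.\<close>

lemma cintegral_dirac:
  assumes T: "compact_space T" "Hausdorff_space T" and x: "x \<in> topspace T"
    and f: "continuous_map T euclidean f"
  shows "cintegral T (dirac T x) f = f x"
proof -
  have "cintegral T (dirac T x) f - f x = 0"
  proof (rule complex_zeroI)
    fix \<epsilon> :: real assume "\<epsilon> > 0"
    obtain s where s: "sample_selection T s" "\<And>y. y \<in> topspace T \<Longrightarrow> cmod (f y - f (s y)) \<le> \<epsilon>"
      using sample_selection_exists[OF T(1), of "{f}" \<epsilon>] f \<open>\<epsilon> > 0\<close>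
      by (metis finite.emptyI finite.insertI insertI1 singletonD)
    have "riemann_sum T s (dirac T x) f = (\<Sum>y\<in>s ` topspace T. if y = s x then f y else 0)"
      unfolding riemann_sum_def using s(1) x
      by (intro sum.cong) (auto simp: dirac_def sample_selection_def)
    also have "\<dots> = f (s x)" using s(1) x by (simp add: sample_selection_def)
    finally have "cmod (cintegral T (dirac T x) f - f (s x)) \<le> \<epsilon>"
      using riemann_sum_approx[OF T(1) dirac_positive[OF T(2) x] f s] x by (simp add: dirac_def)
    then show "cmod (cintegral T (dirac T x) f - f x) \<le> \<epsilon> * 2"
      using s(2)[OF x] norm_triangle_ineq4[of "cintegral T (dirac T x) f - f (s x)" "f x - f (s x)"]
      by (simp add: algebra_simps)
  qed
  then show ?thesis by simp
qed

lemma continuous_map_of_real: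
  assumes "continuous_map T euclideanreal f"
  shows "continuous_map T euclidean (\<lambda>x. complex_of_real (f x))"
proof -
  have "continuous_map euclideanreal euclidean complex_of_real"
    unfolding continuous_map_iff_continuous2 by (rule continuous_on_of_real_id)
  from continuous_map_compose[OF assms this] show ?thesis by (simp add: o_def)
qed

text \<open>Off \<open>U - C\<close> the function \<open>f\<close> agrees with the indicator of
  \<open>A\<close>, and on \<open>U - C\<close> the two differ by at most 1.\<close>

lemma cintegral_urysohn:
  assumes T: "compact_space T" "Hausdorff_space T" and \<mu>: "\<mu> \<in> positive_measures T"
    and CU: "C \<in> sets (borel_of T)" "openin T U" "C \<subseteq> A" "A \<subseteq> U" "A \<in> sets (borel_of T)"
    and f: "continuous_map T euclideanreal f" "\<And>x. x \<in> topspace T \<Longrightarrow> 0 \<le> f x \<and> f x \<le> 1"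
    and f1: "\<And>x. x \<in> C \<Longrightarrow> f x = 1" and f0: "\<And>x. x \<in> topspace T - U \<Longrightarrow> f x = 0"
  shows "cmod (\<mu> A - cintegral T \<mu> (\<lambda>x. of_real (f x))) \<le> Re (\<mu> (U - C))"
proof -
  let ?M = "borel_measure T \<mu>"
  interpret finite_measure ?M by (rule finite_measure_borel_measure) fact
  have cf: "continuous_map T euclidean (\<lambda>x. complex_of_real (f x))"
    by (rule continuous_map_of_real[OF f(1)])
  have int: "integrable ?M (\<lambda>x. complex_of_real (indicator B x))" if "B \<in> sets (borel_of T)" for B
    using that by (intro integrable_of_real integrable_real_indicator) (auto simp: emeasure_eq_measure)
  have meas: "(\<integral>x. complex_of_real (indicator B x) \<partial>?M) = \<mu> B" if "B \<in> sets (borel_of T)" for B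
    using borel_of_subset[OF that]
    by (simp add: measure_borel_measure[OF \<mu>] Int_absorb2 positive_measures_of_real[OF \<mu>, symmetric])
  have UC: "U - C \<in> sets (borel_of T)" using CU by auto
  have "\<mu> A - cintegral T \<mu> (\<lambda>x. of_real (f x)) =
      (\<integral>x. complex_of_real (indicator A x) - of_real (f x) \<partial>?M)"
    using int[OF CU(5)] integrable_borel_measure[OF T(1) \<mu> cf] meas[OF CU(5)]
    by (subst Bochner_Integration.integral_diff) (simp_all only: cintegral_positive[OF \<mu>])
  also have "cmod \<dots> \<le> (\<integral>x. cmod (complex_of_real (indicator A x) - of_real (f x)) \<partial>?M)"
    by (rule integral_norm_bound)
  also have "\<dots> \<le> (\<integral>x. indicator (U - C) x \<partial>?M)"
  proof (rule integral_mono)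
    show "integrable ?M (\<lambda>x. cmod (complex_of_real (indicator A x) - of_real (f x)))"
      using int[OF CU(5)] integrable_borel_measure[OF T(1) \<mu> cf]
      by (intro integrable_norm Bochner_Integration.integrable_diff)
    show "integrable ?M (indicator (U - C) :: _ \<Rightarrow> real)"
      using UC by (intro integrable_real_indicator) (auto simp: emeasure_eq_measure)
    fix x assume "x \<in> space ?M"
    then have x: "x \<in> topspace T" by simp
    have "\<bar>indicator A x - f x\<bar> \<le> (indicator (U - C) x :: real)"
      using f(2)[OF x] f1[of x] f0[of x] x CU(3,4)
      by (cases "x \<in> C"; cases "x \<in> U"; cases "x \<in> A") auto
    then show "cmod (complex_of_real (indicator A x) - of_real (f x)) \<le> indicator (U - C) x"
      by (simp only: norm_of_real flip: of_real_diff)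
  qed
  also have "\<dots> = Re (\<mu> (U - C))"
    using UC borel_of_subset[OF UC] by (simp add: measure_borel_measure[OF \<mu>] Int_absorb2)
  finally show ?thesis .
qed

text \<open>By regularity \<open>\<mu> A\<close> is a limit of integrals of Urysohn functions that
  separate an inner compact set from the complement of an outer open set.\<close>

lemma positive_measures_eqI:
  assumes T: "compact_space T" "Hausdorff_space T"
    and \<mu>: "\<mu> \<in> positive_measures T" and \<nu>: "\<nu> \<in> positive_measures T"
    and eq: "\<And>f. continuous_map T euclidean f \<Longrightarrow> cintegral T \<mu> f = cintegral T \<nu> f"
  shows "\<mu> = \<nu>"
proof (rule cmeasure_eqI)
  fix A assume A: "A \<in> sets (borel_of T)"
  have "\<mu> A - \<nu> A = 0"
  proof (rule complex_zeroI)
    fix \<epsilon> :: real assume \<epsilon>: "\<epsilon> > 0"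
    have b: "\<mu> \<in> bounded_measures T" "\<nu> \<in> bounded_measures T" using \<mu> \<nu> by auto
    obtain C U where CU: "compactin T C" "openin T U" "C \<subseteq> A" "A \<subseteq> U"
      "\<And>B. \<lbrakk>B \<in> sets (borel_of T); B \<subseteq> U - C\<rbrakk> \<Longrightarrow> cmod (\<mu> B) < \<epsilon>"
      using bounded_measures_regular[OF b(1) A \<epsilon>] by blast
    obtain C' U' where CU': "compactin T C'" "openin T U'" "C' \<subseteq> A" "A \<subseteq> U'"
      "\<And>B. \<lbrakk>B \<in> sets (borel_of T); B \<subseteq> U' - C'\<rbrakk> \<Longrightarrow> cmod (\<nu> B) < \<epsilon>"
      using bounded_measures_regular[OF b(2) A \<epsilon>] by blast
    \<comment> \<open>One Urysohn function has to serve both measures, so the two approximating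
      pairs are merged into a tighter one.\<close>
    let ?C = "C \<union> C'" and ?U = "U \<inter> U'"
    have C: "closedin T ?C"
      using CU(1) CU'(1) T(2) compactin_imp_closedin by blast
    have U: "openin T ?U" using CU(2) CU'(2) by blast
    have "?C \<subseteq> ?U" using CU CU' by blast
    have UC: "?U - ?C \<in> sets (borel_of T)" using U C by auto
    have "normal_space T"
      using T compact_Hausdorff_or_regular_imp_normal_space by blast
    moreover have "closedin T (topspace T - ?U)" using U by auto
    moreover have "disjnt (topspace T - ?U) ?C" using \<open>?C \<subseteq> ?U\<close> by (auto simp: disjnt_iff)
    ultimately obtain f where f: "continuous_map T (top_of_set {0..1::real}) f"
      "f ` (topspace T - ?U) \<subseteq> {0}" "f ` ?C \<subseteq> {1}"
      using Urysohn_lemma[OF _ _ C _ zero_le_one[where 'a = real]] by metis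
    then have f': "continuous_map T euclideanreal f" "\<And>x. x \<in> topspace T \<Longrightarrow> 0 \<le> f x \<and> f x \<le> 1"
      by (auto simp: continuous_map_in_subtopology)
    have cf: "continuous_map T euclidean (\<lambda>x. complex_of_real (f x))"
      by (rule continuous_map_of_real[OF f'(1)])
    have *: "cmod (\<rho> A - cintegral T \<rho> (\<lambda>x. of_real (f x))) \<le> Re (\<rho> (?U - ?C))"
      if "\<rho> \<in> positive_measures T" for \<rho>
      by (rule cintegral_urysohn[OF T that closedin_borel[OF C] U _ _ A f'])
        (use CU CU' f in auto)
    have "cmod (\<mu> (?U - ?C)) < \<epsilon>" by (rule CU(5)[OF UC]) auto
    moreover have "cmod (\<nu> (?U - ?C)) < \<epsilon>" by (rule CU'(5)[OF UC]) auto
    ultimately have "cmod (\<mu> A - cintegral T \<mu> (\<lambda>x. of_real (f x))) \<le> \<epsilon>"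
      "cmod (\<nu> A - cintegral T \<mu> (\<lambda>x. of_real (f x))) \<le> \<epsilon>"
      using *[OF \<mu>] *[OF \<nu>] eq[OF cf] complex_Re_le_cmod[of "\<mu> (?U - ?C)"] complex_Re_le_cmod[of "\<nu> (?U - ?C)"]
      by auto
    then show "cmod (\<mu> A - \<nu> A) \<le> \<epsilon> * 2"
      using norm_triangle_ineq4[of "\<mu> A - cintegral T \<mu> (\<lambda>x. of_real (f x))" "\<nu> A - cintegral T \<mu> (\<lambda>x. of_real (f x))"]
      by simp
  qed
  then show "\<mu> A = \<nu> A" by simp
qed (use \<mu> \<nu> in auto)

subsection \<open>The weak topology\<close>

lemma topspace_weak_topology [simp]: "topspace (weak_topology T) = positive_measures T"
  unfolding weak_topology_def by (auto simp: topspace_pullback_topology)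

lemma continuous_map_weak_topology_cintegral:
  assumes "f \<in> bounded_continuous T"
  shows "continuous_map (weak_topology T) euclidean (\<lambda>\<mu>. cintegral T \<mu> f)"
proof -
  have "continuous_map (product_topology (\<lambda>_. euclidean) (bounded_continuous T)) euclidean (\<lambda>g. g f :: complex)"
    using assms by (rule continuous_map_product_projection)
  from continuous_map_pullback[OF this, of "positive_measures T" "\<lambda>\<mu>. \<lambda>f\<in>bounded_continuous T. cintegral T \<mu> f"]
  show ?thesis using assms unfolding weak_topology_def by (simp add: o_def)
qed

lemma continuous_map_into_weak_topology:
  assumes "\<And>x. x \<in> topspace X \<Longrightarrow> g x \<in> positive_measures T"
    and "\<And>f. f \<in> bounded_continuous T \<Longrightarrow> continuous_map X euclidean (\<lambda>x. cintegral T (g x) f)"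
  shows "continuous_map X (weak_topology T) g"
  unfolding weak_topology_def
proof (rule continuous_map_pullback')
  show "continuous_map X (product_topology (\<lambda>_. euclidean) (bounded_continuous T))
      ((\<lambda>\<mu>. \<lambda>f\<in>bounded_continuous T. cintegral T \<mu> f) \<circ> g)"
    using assms(2) by (auto simp: continuous_map_componentwise)
  show "topspace X \<subseteq> g -` positive_measures T" using assms(1) by auto
qed

text \<open>An open set of a product contains a box with finitely many restricted coordinates; their
  radii then shrink to a common \<open>\<delta>\<close>.\<close>

lemma weak_neighbourhood:
  assumes L: "continuous_map (weak_topology T) euclidean (L :: 'a cmeasure \<Rightarrow> complex)"
    and \<mu>: "\<mu> \<in> positive_measures T" and "\<epsilon> > 0"
  obtains F \<delta> where "finite F" "F \<subseteq> bounded_continuous T" "\<delta> > 0"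
    "\<And>\<nu>. \<lbrakk>\<nu> \<in> positive_measures T; \<And>f. f \<in> F \<Longrightarrow> cmod (cintegral T \<nu> f - cintegral T \<mu> f) < \<delta>\<rbrakk> \<Longrightarrow>
      cmod (L \<nu> - L \<mu>) < \<epsilon>"
proof -
  let ?I = "bounded_continuous T" and ?c = "\<lambda>\<mu>. \<lambda>f\<in>bounded_continuous T. cintegral T \<mu> f"
  have "openin (weak_topology T) {\<nu> \<in> topspace (weak_topology T). L \<nu> \<in> ball (L \<mu>) \<epsilon>}"
    by (rule openin_continuous_map_preimage[OF L]) simp
  then obtain W where W: "openin (product_topology (\<lambda>_. euclidean) ?I) W"
    "{\<nu> \<in> topspace (weak_topology T). L \<nu> \<in> ball (L \<mu>) \<epsilon>} = ?c -` W \<inter> positive_measures T"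
    unfolding weak_topology_def openin_pullback_topology by blast
  have "\<mu> \<in> {\<nu> \<in> topspace (weak_topology T). L \<nu> \<in> ball (L \<mu>) \<epsilon>}" using \<mu> \<open>\<epsilon> > 0\<close> by simp
  then have "?c \<mu> \<in> W" using W(2) by auto
  then obtain U where U: "finite {i \<in> ?I. U i \<noteq> (UNIV :: complex set)}" "\<And>i. i \<in> ?I \<Longrightarrow> open (U i)"
    "?c \<mu> \<in> Pi\<^sub>E ?I U" "Pi\<^sub>E ?I U \<subseteq> W"
    using W(1) unfolding openin_product_topology_alt by auto
  let ?F = "{i \<in> ?I. U i \<noteq> UNIV}"
  have "\<forall>f\<in>?F. eventually (\<lambda>\<delta>. ball (cintegral T \<mu> f) \<delta> \<subseteq> U f) (at_right 0)"
  proof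
    fix f assume "f \<in> ?F"
    then have "open (U f)" "cintegral T \<mu> f \<in> U f" using U(2,3) by auto
    then obtain d where "d > 0" "ball (cintegral T \<mu> f) d \<subseteq> U f" using open_contains_ball by blast
    then show "eventually (\<lambda>\<delta>. ball (cintegral T \<mu> f) \<delta> \<subseteq> U f) (at_right 0)"
      unfolding eventually_at_right_field by (meson less_imp_le order_trans subset_ball)
  qed
  then have "eventually (\<lambda>\<delta>. \<forall>f\<in>?F. ball (cintegral T \<mu> f) \<delta> \<subseteq> U f) (at_right (0::real))"
    by (rule eventually_ball_finite[OF U(1)])
  then obtain \<delta> :: real where \<delta>: "\<delta> > 0" "\<forall>f\<in>?F. ball (cintegral T \<mu> f) \<delta> \<subseteq> U f"
    unfolding eventually_at_right_field by (meson dense)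
  show thesis
  proof (rule that[OF U(1) _ \<delta>(1)])
    fix \<nu> assume \<nu>: "\<nu> \<in> positive_measures T"
      "\<And>f. f \<in> ?F \<Longrightarrow> cmod (cintegral T \<nu> f - cintegral T \<mu> f) < \<delta>"
    have "cintegral T \<nu> f \<in> U f" if "f \<in> ?I" for f
    proof (cases "U f = UNIV")
      case False
      then have "f \<in> ?F" using that by simp
      then have "cintegral T \<nu> f \<in> ball (cintegral T \<mu> f) \<delta>"
        using \<nu>(2) by (simp add: dist_norm norm_minus_commute)
      then show ?thesis using \<delta>(2) \<open>f \<in> ?F\<close> by blast
    qed simp
    then have "?c \<nu> \<in> Pi\<^sub>E ?I U" by (intro PiE_I) simp_all
    then have "?c \<nu> \<in> W" using U(4) by blast
    then have "\<nu> \<in> ?c -` W \<inter> positive_measures T" using \<nu>(1) by simp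
    then have "L \<nu> \<in> ball (L \<mu>) \<epsilon>" using W(2) by blast
    then show "cmod (L \<nu> - L \<mu>) < \<epsilon>" by (simp add: dist_norm norm_minus_commute)
  qed simp
qed

text \<open>Integrating a test function against point masses returns the test function.\<close>

lemma continuous_map_dirac:
  assumes T: "compact_space T" "Hausdorff_space T"
  shows "continuous_map T (weak_topology T) (dirac T)"
proof (rule continuous_map_into_weak_topology)
  show "\<And>x. x \<in> topspace T \<Longrightarrow> dirac T x \<in> positive_measures T"
    using dirac_positive[OF T(2)] .
  fix f assume "f \<in> bounded_continuous T"
  then have f: "continuous_map T euclidean f" using T by (simp add: bounded_continuous_iff)
  show "continuous_map T euclidean (\<lambda>x. cintegral T (dirac T x) f)"
    by (rule continuous_map_eq[OF f]) (simp add: cintegral_dirac[OF T _ f])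
qed

text \<open>Riemann sums are integrals against combinations of point masses, so these are weakly dense.\<close>

lemma weakly_continuous_functional:
  assumes T: "compact_space T" "Hausdorff_space T"
    and L: "continuous_map (weak_topology T) euclidean (L :: 'a cmeasure \<Rightarrow> complex)"
    and lin: "\<And>\<mu> \<nu> a b. \<lbrakk>\<mu> \<in> positive_measures T; \<nu> \<in> positive_measures T; a \<in> \<real>\<^sub>\<ge>\<^sub>0; b \<in> \<real>\<^sub>\<ge>\<^sub>0\<rbrakk> \<Longrightarrow>
      L (\<lambda>A. a * \<mu> A + b * \<nu> A) = a * L \<mu> + b * L \<nu>"
    and \<mu>: "\<mu> \<in> positive_measures T"
  shows "L \<mu> = cintegral T \<mu> (\<lambda>x. L (dirac T x))"
proof -
  let ?g = "\<lambda>x. L (dirac T x)" and ?m = "Re (\<mu> (topspace T))"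
  have g: "continuous_map T euclidean ?g"
    using continuous_map_compose[OF continuous_map_dirac[OF T] L] by (simp add: o_def)
  have L0: "L (\<lambda>A. 0) = 0" using lin[OF \<mu> \<mu>, of 0 0] by simp
  have Lsum: "L (\<lambda>A. \<Sum>i\<in>I. c i * \<mu> i A) = (\<Sum>i\<in>I. c i * L (\<mu> i))"
    if "\<And>i. i \<in> I \<Longrightarrow> \<mu> i \<in> positive_measures T" "\<And>i. i \<in> I \<Longrightarrow> c i \<in> \<real>\<^sub>\<ge>\<^sub>0"
    for I and c and \<mu> :: "'a \<Rightarrow> 'a cmeasure"
    using that
  proof (induction I rule: infinite_finite_induct)
    case (insert i I)
    then have "(\<lambda>A. \<Sum>i\<in>I. c i * \<mu> i A) \<in> positive_measures T" by (intro positive_measures_sum) auto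
    then show ?case
      using insert lin[of "\<mu> i" "\<lambda>A. \<Sum>i\<in>I. c i * \<mu> i A" "c i" 1] by simp
  qed (simp_all add: L0)
  have m: "?m \<ge> 0" by (rule positive_measures_Re[OF \<mu>])
  have "L \<mu> - cintegral T \<mu> ?g = 0"
  proof (rule complex_zeroI)
    fix \<epsilon> :: real assume "\<epsilon> > 0"
    obtain F \<delta> where F: "finite F" "F \<subseteq> bounded_continuous T" "\<delta> > 0"
      and near: "\<And>\<nu>. \<lbrakk>\<nu> \<in> positive_measures T; \<And>f. f \<in> F \<Longrightarrow> cmod (cintegral T \<nu> f - cintegral T \<mu> f) < \<delta>\<rbrakk> \<Longrightarrow>
        cmod (L \<nu> - L \<mu>) < \<epsilon>"
      using weak_neighbourhood[OF L \<mu> \<open>\<epsilon> > 0\<close>] by blast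
    have Fc: "continuous_map T euclidean f" if "f \<in> F" for f
      using F(2) that T by (auto simp: bounded_continuous_iff)
    \<comment> \<open>Chosen so that \<open>\<eta>\<close> times the mass of \<open>\<mu>\<close>
      stays below both \<open>\<delta>\<close> and \<open>\<epsilon>\<close>; the added 1 covers
      mass 0.\<close>
    define \<eta> where "\<eta> = min \<delta> \<epsilon> / (?m + 1)"
    have \<eta>: "\<eta> > 0" using F(3) \<open>\<epsilon> > 0\<close> m by (simp add: \<eta>_def)
    have "\<eta> * ?m < \<eta> * (?m + 1)" using \<eta> by simp
    also have "\<dots> = min \<delta> \<epsilon>" using m by (simp add: \<eta>_def)
    finally have \<eta>m: "\<eta> * ?m < \<delta>" "\<eta> * ?m < \<epsilon>" by auto
    \<comment> \<open>\<open>?g\<close> joins the test functions of the neighbourhood: the same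
      discrete measure has to be weakly near \<open>\<mu>\<close> and to give nearly the same
      integral of \<open>?g\<close>.\<close>
    obtain s where s: "sample_selection T s"
      and osc: "\<And>f y. \<lbrakk>f \<in> insert ?g F; y \<in> topspace T\<rbrakk> \<Longrightarrow> cmod (f y - f (s y)) \<le> \<eta>"
      using sample_selection_exists[OF T(1), of "insert ?g F" \<eta>] F(1) Fc g \<eta> by (metis finite.insertI insertE)
    have sx: "x \<in> topspace T" if "x \<in> s ` topspace T" for x
      using s that by (auto simp: sample_selection_def)
    define \<nu> where "\<nu> A = (\<Sum>x\<in>s ` topspace T. \<mu> {y \<in> topspace T. s y = x} * dirac T x A)" for A
    have \<nu>: "\<nu> \<in> positive_measures T"
      unfolding \<nu>_def by (intro positive_measures_sum dirac_positive[OF T(2)] sx positive_measures_nonneg[OF \<mu>])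
    have int: "cintegral T \<nu> f = riemann_sum T s \<mu> f" if "continuous_map T euclidean f" for f
      unfolding \<nu>_def riemann_sum_def
      by (subst cintegral_sum[OF T(1) dirac_positive[OF T(2) sx] positive_measures_nonneg[OF \<mu>] that])
        (auto intro!: sum.cong cintegral_dirac[OF T _ that] sx)
    have approx: "cmod (cintegral T \<mu> f - riemann_sum T s \<mu> f) \<le> \<eta> * ?m" if "f \<in> insert ?g F" for f
    proof -
      have "continuous_map T euclidean f" using that g Fc by blast
      then show ?thesis by (intro riemann_sum_approx[OF T(1) \<mu> _ s] osc[OF that])
    qed
    have "cmod (L \<nu> - L \<mu>) < \<epsilon>"
    proof (rule near[OF \<nu>])
      fix f assume "f \<in> F"
      then show "cmod (cintegral T \<nu> f - cintegral T \<mu> f) < \<delta>"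
        using approx[of f] int[OF Fc] \<eta>m by (simp add: norm_minus_commute)
    qed
    moreover have "L \<nu> = riemann_sum T s \<mu> ?g"
      unfolding \<nu>_def riemann_sum_def
      by (intro Lsum dirac_positive[OF T(2)] sx positive_measures_nonneg[OF \<mu>])
    ultimately show "cmod (L \<mu> - cintegral T \<mu> ?g) \<le> \<epsilon> * 2"
      using approx[of ?g] \<eta>m norm_triangle_ineq4[of "riemann_sum T s \<mu> ?g - cintegral T \<mu> ?g" "L \<nu> - L \<mu>"]
      by (simp add: norm_minus_commute)
  qed
  then show ?thesis by simp
qed

subsection \<open>Weakly continuous linear maps between spaces of measures\<close>

text \<open>Continuity between the weak topologies includes that positive measures go to positive
  measures, since these are the points of the two spaces.\<close>

definition measure_map :: "'a topology \<Rightarrow> 'b topology \<Rightarrow> ('a cmeasure \<Rightarrow> 'b cmeasure) \<Rightarrow> bool" where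
  "measure_map T T' \<Phi> \<longleftrightarrow> continuous_map (weak_topology T) (weak_topology T') \<Phi> \<and>
     (\<forall>\<mu>\<in>bounded_measures T. \<Phi> \<mu> \<in> bounded_measures T') \<and>
     (\<forall>\<mu>\<in>bounded_measures T. \<forall>\<nu>\<in>bounded_measures T. \<forall>a b.
        \<Phi> (\<lambda>A. a * \<mu> A + b * \<nu> A) = (\<lambda>A. a * \<Phi> \<mu> A + b * \<Phi> \<nu> A))"

lemma measure_map_bounded: "\<lbrakk>measure_map T T' \<Phi>; \<mu> \<in> bounded_measures T\<rbrakk> \<Longrightarrow> \<Phi> \<mu> \<in> bounded_measures T'"
  by (simp add: measure_map_def)

lemma measure_map_positive: "\<lbrakk>measure_map T T' \<Phi>; \<mu> \<in> positive_measures T\<rbrakk> \<Longrightarrow> \<Phi> \<mu> \<in> positive_measures T'"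
  using continuous_map_image_subset_topspace[of "weak_topology T" "weak_topology T'" \<Phi>]
  unfolding measure_map_def by auto

lemma measure_map_lincomb:
  "\<lbrakk>measure_map T T' \<Phi>; \<mu> \<in> bounded_measures T; \<nu> \<in> bounded_measures T\<rbrakk> \<Longrightarrow>
    \<Phi> (\<lambda>A. a * \<mu> A + b * \<nu> A) = (\<lambda>A. a * \<Phi> \<mu> A + b * \<Phi> \<nu> A)"
  unfolding measure_map_def by blast

lemma measure_map_scale:
  "\<lbrakk>measure_map T T' \<Phi>; \<mu> \<in> bounded_measures T\<rbrakk> \<Longrightarrow> \<Phi> (\<lambda>A. a * \<mu> A) = (\<lambda>A. a * \<Phi> \<mu> A)"
  using measure_map_lincomb[of T T' \<Phi> \<mu> \<mu> a 0] by simp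

lemma measure_map_compose:
  assumes "measure_map T T' \<Phi>" "measure_map T' T'' \<Psi>"
  shows "measure_map T T'' (\<lambda>\<mu>. \<Psi> (\<Phi> \<mu>))"
  using assms continuous_map_compose[of "weak_topology T" "weak_topology T'" \<Phi> "weak_topology T''" \<Psi>]
  unfolding measure_map_def o_def by simp

lemma measure_map_functional:
  assumes T: "compact_space T" "compact_space T'" and \<Phi>: "measure_map T T' \<Phi>"
    and f: "continuous_map T' euclidean f"
  shows "continuous_map (weak_topology T) euclidean (\<lambda>\<mu>. cintegral T' (\<Phi> \<mu>) f)"
    and "\<lbrakk>\<mu> \<in> positive_measures T; \<nu> \<in> positive_measures T; a \<in> \<real>\<^sub>\<ge>\<^sub>0; b \<in> \<real>\<^sub>\<ge>\<^sub>0\<rbrakk> \<Longrightarrow>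
      cintegral T' (\<Phi> (\<lambda>A. a * \<mu> A + b * \<nu> A)) f = a * cintegral T' (\<Phi> \<mu>) f + b * cintegral T' (\<Phi> \<nu>) f"
proof -
  have "f \<in> bounded_continuous T'" using f T(2) by (simp add: bounded_continuous_iff)
  from continuous_map_compose[OF _ continuous_map_weak_topology_cintegral[OF this]] \<Phi>
  show "continuous_map (weak_topology T) euclidean (\<lambda>\<mu>. cintegral T' (\<Phi> \<mu>) f)"
    unfolding measure_map_def o_def by blast
  show "\<lbrakk>\<mu> \<in> positive_measures T; \<nu> \<in> positive_measures T; a \<in> \<real>\<^sub>\<ge>\<^sub>0; b \<in> \<real>\<^sub>\<ge>\<^sub>0\<rbrakk> \<Longrightarrow>
      cintegral T' (\<Phi> (\<lambda>A. a * \<mu> A + b * \<nu> A)) f = a * cintegral T' (\<Phi> \<mu>) f + b * cintegral T' (\<Phi> \<nu>) f"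
    using measure_map_lincomb[OF \<Phi>, of \<mu> \<nu>] cintegral_lincomb[OF T(2) _ _ _ _ f] measure_map_positive[OF \<Phi>]
    by (simp add: positive_measures_bounded)
qed

text \<open>For fixed \<open>f\<close> the left side is a weakly continuous additive functional of
  \<open>\<mu>\<close>, hence integration against its values on point masses. With convolution as
  \<open>\<Phi>\<close> this is the double integral in the definition of Haar measure.\<close>

lemma cintegral_measure_map:
  assumes T: "compact_space T" "Hausdorff_space T" "compact_space T'" and \<Phi>: "measure_map T T' \<Phi>"
    and \<mu>: "\<mu> \<in> positive_measures T" and f: "continuous_map T' euclidean f"
  shows "cintegral T' (\<Phi> \<mu>) f = cintegral T \<mu> (\<lambda>x. cintegral T' (\<Phi> (dirac T x)) f)"
  by (rule weakly_continuous_functional[OF T(1,2) measure_map_functional[OF T(1,3) \<Phi> f] \<mu>])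

lemma cintegral_cong:
  assumes "\<mu> \<in> positive_measures T" "\<And>x. x \<in> topspace T \<Longrightarrow> f x = g x"
  shows "cintegral T \<mu> f = cintegral T \<mu> g"
  unfolding cintegral_positive[OF assms(1)] by (rule Bochner_Integration.integral_cong) (auto simp: assms(2))

text \<open>Integrals against \<open>\<Phi> \<mu>\<close> depend on \<open>\<Phi>\<close> only
  through point masses by \<open>cintegral_measure_map\<close>; Jordan parts extend this to complex
  \<open>\<mu>\<close>.\<close>

lemma measure_map_eqI:
  assumes T: "compact_space T" "Hausdorff_space T" "compact_space T'" "Hausdorff_space T'"
    and \<Phi>: "measure_map T T' \<Phi>" and \<Psi>: "measure_map T T' \<Psi>"
    and eq: "\<And>x. x \<in> topspace T \<Longrightarrow> \<Phi> (dirac T x) = \<Psi> (dirac T x)"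
    and \<mu>: "\<mu> \<in> bounded_measures T"
  shows "\<Phi> \<mu> = \<Psi> \<mu>"
  using \<mu>
proof (induction rule: bounded_measures_induct)
  case (positive \<mu>)
  show ?case
  proof (rule positive_measures_eqI[OF T(3,4) measure_map_positive[OF \<Phi> positive] measure_map_positive[OF \<Psi> positive]])
    fix f :: "'b \<Rightarrow> complex" assume f: "continuous_map T' euclidean f"
    show "cintegral T' (\<Phi> \<mu>) f = cintegral T' (\<Psi> \<mu>) f"
      unfolding cintegral_measure_map[OF T(1-3) \<Phi> positive f] cintegral_measure_map[OF T(1-3) \<Psi> positive f]
      by (rule cintegral_cong[OF positive]) (simp add: eq)
  qed
next
  case (lincomb \<mu> \<nu> a b)
  then show ?case by (simp add: measure_map_lincomb[OF \<Phi>] measure_map_lincomb[OF \<Psi>])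
qed

text \<open>\<open>E\<close> is the transpose of \<open>\<Phi>\<close>, acting on continuous
  functions; its existence makes \<open>\<Phi>\<close> weakly continuous.\<close>

lemma measure_mapI:
  assumes T: "compact_space T" "compact_space T'"
    and "\<And>\<mu>. \<mu> \<in> bounded_measures T \<Longrightarrow> \<Phi> \<mu> \<in> bounded_measures T'"
    and "\<And>\<mu> \<nu> a b. \<lbrakk>\<mu> \<in> bounded_measures T; \<nu> \<in> bounded_measures T\<rbrakk> \<Longrightarrow>
      \<Phi> (\<lambda>A. a * \<mu> A + b * \<nu> A) = (\<lambda>A. a * \<Phi> \<mu> A + b * \<Phi> \<nu> A)"
    and pos: "\<And>\<mu>. \<mu> \<in> positive_measures T \<Longrightarrow> \<Phi> \<mu> \<in> positive_measures T'"
    and E: "\<And>f. continuous_map T' euclidean f \<Longrightarrow> continuous_map T euclidean (E f)"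
      "\<And>f \<mu>. \<lbrakk>continuous_map T' euclidean f; \<mu> \<in> positive_measures T\<rbrakk> \<Longrightarrow>
        cintegral T' (\<Phi> \<mu>) f = cintegral T \<mu> (E f)"
  shows "measure_map T T' \<Phi>"
proof -
  have "continuous_map (weak_topology T) (weak_topology T') \<Phi>"
  proof (rule continuous_map_into_weak_topology)
    fix f assume "f \<in> bounded_continuous T'"
    then have f: "continuous_map T' euclidean f" using T by (simp add: bounded_continuous_iff)
    then have "E f \<in> bounded_continuous T" using E(1) T by (simp add: bounded_continuous_iff)
    from continuous_map_weak_topology_cintegral[OF this]
    show "continuous_map (weak_topology T) euclidean (\<lambda>\<mu>. cintegral T' (\<Phi> \<mu>) f)"
      by (rule continuous_map_eq) (simp add: E(2)[OF f])
  qed (simp add: pos)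
  then show ?thesis using assms(3,4) unfolding measure_map_def by simp
qed

subsection \<open>Image measures\<close>

definition push :: "'a topology \<Rightarrow> 'b topology \<Rightarrow> ('a \<Rightarrow> 'b) \<Rightarrow> 'a cmeasure \<Rightarrow> 'b cmeasure" where
  "push T T' r \<mu> = (\<lambda>A. if A \<in> sets (borel_of T') then \<mu> (r -` A \<inter> topspace T) else 0)"

lemma borel_vimage:
  "\<lbrakk>continuous_map T T' r; A \<in> sets (borel_of T')\<rbrakk> \<Longrightarrow> r -` A \<inter> topspace T \<in> sets (borel_of T)"
  using measurable_sets[OF continuous_map_borel, of T T' r A] by simp

text \<open>Inner compact sets are images of compact sets. Images of open sets need not be open, so
  the outer open set is the complement of the image of a compact set that lies in the complement of
  the preimage of \<open>A\<close>.\<close>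

lemma push_bounded:
  assumes T: "compact_space T" "Hausdorff_space T'" and r: "continuous_map T T' r"
    and \<mu>: "\<mu> \<in> bounded_measures T"
  shows "push T T' r \<mu> \<in> bounded_measures T'"
proof (rule bounded_measuresI)
  let ?v = "\<lambda>A. r -` A \<inter> topspace T"
  fix A :: "nat \<Rightarrow> 'b set" assume A: "range A \<subseteq> sets (borel_of T')" "disjoint_family A"
  have "(\<lambda>i. \<mu> (?v (A i))) sums \<mu> (\<Union>i. ?v (A i))"
    using A borel_vimage[OF r] by (intro bounded_measures_sums[OF \<mu>]) (auto simp: disjoint_family_on_def)
  moreover have "(\<Union>i. ?v (A i)) = ?v (\<Union>i. A i)" by auto
  moreover have "(\<Union>i. A i) \<in> sets (borel_of T')" "\<And>i. A i \<in> sets (borel_of T')" using A(1) by auto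
  ultimately show "(\<lambda>i. push T T' r \<mu> (A i)) sums push T T' r \<mu> (\<Union>i. A i)"
    by (simp add: push_def)
next
  let ?v = "\<lambda>A. r -` A \<inter> topspace T"
  fix A and \<epsilon> :: real assume A: "A \<in> sets (borel_of T')" "\<epsilon> > 0"
  have vA: "?v A \<in> sets (borel_of T)" "topspace T - ?v A \<in> sets (borel_of T)"
    using borel_vimage[OF r A(1)] by auto
  obtain C U where CU: "compactin T C" "openin T U" "C \<subseteq> ?v A" "?v A \<subseteq> U"
    "\<And>B. \<lbrakk>B \<in> sets (borel_of T); B \<subseteq> U - C\<rbrakk> \<Longrightarrow> cmod (\<mu> B) < \<epsilon> / 2"
    using bounded_measures_regular[OF \<mu> vA(1), of "\<epsilon> / 2"] A(2) by auto
  obtain D V where DV: "compactin T D" "openin T V" "D \<subseteq> topspace T - ?v A" "topspace T - ?v A \<subseteq> V"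
    "\<And>B. \<lbrakk>B \<in> sets (borel_of T); B \<subseteq> V - D\<rbrakk> \<Longrightarrow> cmod (\<mu> B) < \<epsilon> / 2"
    using bounded_measures_regular[OF \<mu> vA(2), of "\<epsilon> / 2"] A(2) by auto
  have C': "compactin T' (r ` C)" and D': "compactin T' (r ` D)"
    using CU(1) DV(1) r by (auto intro: image_compactin)
  have U': "openin T' (topspace T' - r ` D)"
    using compactin_imp_closedin[OF T(2) D'] by auto
  have "cmod (push T T' r \<mu> B) \<le> \<epsilon>"
    if B: "B \<in> sets (borel_of T')" "B \<subseteq> (topspace T' - r ` D) - r ` C" for B
  proof -
    have m: "?v B \<in> sets (borel_of T)" by (rule borel_vimage[OF r B(1)])
    have "\<mu> (?v B \<inter> ?v A \<union> (?v B - ?v A)) = \<mu> (?v B \<inter> ?v A) + \<mu> (?v B - ?v A)"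
      using m vA(1) by (intro bounded_measures_Un[OF \<mu>]) auto
    moreover have "?v B \<inter> ?v A \<union> (?v B - ?v A) = ?v B" by blast
    moreover have "cmod (\<mu> (?v B \<inter> ?v A)) < \<epsilon> / 2"
      using m vA(1) B(2) CU(4) by (intro CU(5)) auto
    moreover have "cmod (\<mu> (?v B - ?v A)) < \<epsilon> / 2"
      using m vA(1) B(2) DV(4) by (intro DV(5)) auto
    ultimately show ?thesis
      using norm_triangle_ineq[of "\<mu> (?v B \<inter> ?v A)" "\<mu> (?v B - ?v A)"] B(1) by (simp add: push_def)
  qed
  moreover have "r ` C \<subseteq> A" "A \<subseteq> topspace T' - r ` D"
    using CU(3) DV(3) borel_of_subset[OF A(1)] by auto
  ultimately show "\<exists>C U. compactin T' C \<and> openin T' U \<and> C \<subseteq> A \<and> A \<subseteq> U \<and>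
      (\<forall>B\<in>sets (borel_of T'). B \<subseteq> U - C \<longrightarrow> cmod (push T T' r \<mu> B) \<le> \<epsilon>)"
    using C' U' by blast
qed (simp add: push_def)

lemma push_positive:
  assumes "compact_space T" "Hausdorff_space T'" "continuous_map T T' r" "\<mu> \<in> positive_measures T"
  shows "push T T' r \<mu> \<in> positive_measures T'"
  using push_bounded[of T T' r \<mu>] assms positive_measures_nonneg[OF assms(4)]
  by (auto simp: positive_measures_def push_def)

lemma cintegral_push:
  assumes "compact_space T" "Hausdorff_space T'" and r: "continuous_map T T' r"
    and \<mu>: "\<mu> \<in> positive_measures T" and f: "f \<in> borel_measurable (borel_of T')"
  shows "cintegral T' (push T T' r \<mu>) f = cintegral T \<mu> (\<lambda>x. f (r x))"
proof -
  have p: "push T T' r \<mu> \<in> positive_measures T'" by (rule push_positive) fact+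
  have m: "r \<in> measurable (borel_measure T \<mu>) (borel_of T')" using continuous_map_borel[OF r] by simp
  have "borel_measure T' (push T T' r \<mu>) = distr (borel_measure T \<mu>) (borel_of T') r"
  proof (rule measure_eqI)
    fix A assume "A \<in> sets (borel_measure T' (push T T' r \<mu>))"
    then have A: "A \<in> sets (borel_of T')" by simp
    then show "emeasure (borel_measure T' (push T T' r \<mu>)) A =
        emeasure (distr (borel_measure T \<mu>) (borel_of T') r) A"
      using emeasure_borel_measure[OF p A] emeasure_borel_measure[OF \<mu> borel_vimage[OF r A]]
        emeasure_distr[OF m A] by (simp add: push_def)
  qed simp
  then show ?thesis
    unfolding cintegral_positive[OF p] cintegral_positive[OF \<mu>]
    using integral_distr[OF m f] by simp
qed

lemma measure_map_push:
  assumes T: "compact_space T" "compact_space T'" "Hausdorff_space T'" and r: "continuous_map T T' r"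
  shows "measure_map T T' (push T T' r)"
proof (rule measure_mapI[OF T(1,2), where E = "\<lambda>f x. f (r x)"])
  fix f :: "'b \<Rightarrow> complex" assume f: "continuous_map T' euclidean f"
  show "continuous_map T euclidean (\<lambda>x. f (r x))"
    using continuous_map_compose[OF r f] by (simp add: o_def)
  show "\<mu> \<in> positive_measures T \<Longrightarrow> cintegral T' (push T T' r \<mu>) f = cintegral T \<mu> (\<lambda>x. f (r x))" for \<mu>
    by (rule cintegral_push[OF T(1,3) r _ continuous_map_borel_measurable[OF f]])
qed (erule push_bounded[OF T(1,3) r], simp add: push_def fun_eq_iff, erule push_positive[OF T(1,3) r])

lemma push_dirac:
  assumes "continuous_map T T' r" "x \<in> topspace T"
  shows "push T T' r (dirac T x) = dirac T' (r x)"
  using borel_vimage[OF assms(1)] assms(2) by (auto simp: push_def dirac_def fun_eq_iff)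

text \<open>Convolution with an invariant measure takes this form in
  \<open>conv_left_invariant\<close>, and so does convolution of \<open>M(K)\<close> with a point of
  \<open>J - {e}\<close> in \<open>conv_ext_dirac\<close>.\<close>

lemma measure_map_mass:
  assumes T: "compact_space T" "compact_space T'" and \<eta>: "\<eta> \<in> positive_measures T'"
  shows "measure_map T T' (\<lambda>\<mu> A. \<mu> (topspace T) * \<eta> A)"
proof (rule measure_mapI[OF T, where E = "\<lambda>f x. cintegral T' \<eta> f"])
  fix f :: "'b \<Rightarrow> complex" and \<mu> assume f: "continuous_map T' euclidean f" and \<mu>: "\<mu> \<in> positive_measures T"
  have "cintegral T \<mu> (\<lambda>x. cintegral T' \<eta> f) = of_real (measure (borel_measure T \<mu>) (topspace T)) * cintegral T' \<eta> f"
    unfolding cintegral_positive[OF \<mu>] by (simp add: scaleR_conv_of_real)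
  then show "cintegral T' (\<lambda>A. \<mu> (topspace T) * \<eta> A) f = cintegral T \<mu> (\<lambda>x. cintegral T' \<eta> f)"
    using cintegral_scale[OF T(2) \<eta> positive_measures_nonneg[OF \<mu>] f]
    by (simp add: measure_borel_measure[OF \<mu>] flip: positive_measures_of_real[OF \<mu>])
qed (rule bounded_measures_scale[OF positive_measures_bounded[OF \<eta>]], simp add: algebra_simps,
    erule positive_measures_scale[OF \<eta> positive_measures_nonneg], simp)

section \<open>Haar measure of a compact hypergroup\<close>

locale compact_hypergroup = hypergroup +
  assumes compact: "compact_space (hg_top H)"
begin

abbreviation "T \<equiv> hg_top H"
abbreviation "conv \<equiv> hg_conv H"

lemma dirac_pos: "x \<in> topspace T \<Longrightarrow> dirac T x \<in> positive_measures T"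
  by (rule dirac_positive[OF Hausdorff])

lemma dirac_bounded: "x \<in> topspace T \<Longrightarrow> dirac T x \<in> bounded_measures T"
  using dirac_pos by auto

text \<open>Joint weak continuity is used with one argument held fixed. That argument is positive
  because continuity is given on the positive cone.\<close>

lemma conv_map:
  assumes "\<nu> \<in> positive_measures T"
  shows "measure_map T T (conv \<nu>)" and "measure_map T T (\<lambda>\<mu>. conv \<mu> \<nu>)"
proof -
  have id: "continuous_map (weak_topology T) (weak_topology T) (\<lambda>\<mu>. \<mu>)"
    and const: "continuous_map (weak_topology T) (weak_topology T) (\<lambda>\<mu>. \<nu>)"
    using assms by simp_all
  have "continuous_map (weak_topology T) (weak_topology T) (conv \<nu>)"
    using continuous_map_compose[OF continuous_map_pairedI[OF const id] conv_weakly_continuous]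
    by (simp add: o_def)
  then show "measure_map T T (conv \<nu>)"
    using assms conv_closed conv_linear_right unfolding measure_map_def by auto
  have "continuous_map (weak_topology T) (weak_topology T) (\<lambda>\<mu>. conv \<mu> \<nu>)"
    using continuous_map_compose[OF continuous_map_pairedI[OF id const] conv_weakly_continuous]
    by (simp add: o_def)
  then show "measure_map T T (\<lambda>\<mu>. conv \<mu> \<nu>)"
    using assms conv_closed conv_linear_left unfolding measure_map_def by auto
qed

lemma conv_positive:
  "\<lbrakk>\<mu> \<in> positive_measures T; \<nu> \<in> positive_measures T\<rbrakk> \<Longrightarrow> conv \<mu> \<nu> \<in> positive_measures T"
  using measure_map_positive conv_map(1) by blast

lemmas map_eqI = measure_map_eqI[OF compact Hausdorff compact Hausdorff]

lemma inv_continuous: "continuous_map T T (hg_inv H)"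
  using inv_homeomorphic homeomorphic_imp_continuous_map by blast

lemma measure_flip_eq_push: "measure_flip H = push T T (hg_inv H)"
  by (simp add: fun_eq_iff measure_flip_def push_def)

lemma flip_map: "measure_map T T (measure_flip H)"
  unfolding measure_flip_eq_push by (rule measure_map_push[OF compact compact Hausdorff inv_continuous])

lemma flip_dirac: "x \<in> topspace T \<Longrightarrow> measure_flip H (dirac T x) = dirac T (hg_inv H x)"
  unfolding measure_flip_eq_push by (rule push_dirac[OF inv_continuous])

lemma inv_in: "x \<in> topspace T \<Longrightarrow> hg_inv H x \<in> topspace T"
  using inv_continuous by (auto simp: continuous_map_def)

text \<open>The axiom \<open>inv_conv\<close> speaks of two point masses; both sides are measure
  maps in the second factor.\<close>

lemma flip_conv_dirac:
  assumes x: "x \<in> topspace T" and \<mu>: "\<mu> \<in> bounded_measures T"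
  shows "measure_flip H (conv (dirac T x) \<mu>) = conv (measure_flip H \<mu>) (dirac T (hg_inv H x))"
  by (rule map_eqI[OF measure_map_compose[OF conv_map(1)[OF dirac_pos[OF x]] flip_map]
        measure_map_compose[OF flip_map conv_map(2)[OF dirac_pos[OF inv_in[OF x]]]] _ \<mu>])
    (simp add: inv_conv[OF x] flip_dirac)

text \<open>Normalized Haar measure as an element of \<open>M(H)\<close>, where it can be
  convolved.\<close>

definition left_invariant :: "'a cmeasure \<Rightarrow> bool" where
  "left_invariant \<eta> \<longleftrightarrow> \<eta> \<in> probability_measures T \<and> (\<forall>x\<in>topspace T. conv (dirac T x) \<eta> = \<eta>)"

lemma left_invariant_positive: "left_invariant \<eta> \<Longrightarrow> \<eta> \<in> positive_measures T"
  by (simp add: left_invariant_def probability_measures_def)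

lemma left_invariant_mass: "left_invariant \<eta> \<Longrightarrow> \<eta> (topspace T) = 1"
  by (simp add: left_invariant_def probability_measures_def)

text \<open>Both sides are measure maps in \<open>\<mu>\<close>, and on point masses they agree by
  invariance.\<close>

lemma conv_left_invariant:
  assumes \<eta>: "left_invariant \<eta>" and \<mu>: "\<mu> \<in> bounded_measures T"
  shows "conv \<mu> \<eta> = (\<lambda>A. \<mu> (topspace T) * \<eta> A)"
  by (rule map_eqI[OF conv_map(2)[OF left_invariant_positive[OF \<eta>]]
        measure_map_mass[OF compact compact left_invariant_positive[OF \<eta>]] _ \<mu>])
    (use \<eta> in \<open>auto simp: left_invariant_def dirac_def\<close>)

lemma flip_mass: "measure_flip H \<mu> (topspace T) = \<mu> (topspace T)"
proof -
  have "hg_inv H -` topspace T \<inter> topspace T = topspace T" using inv_in by auto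
  then show ?thesis by (simp add: measure_flip_def)
qed

text \<open>The flip reverses convolutions and so turns left into right invariance.\<close>

lemma flip_right_invariant:
  assumes \<eta>: "left_invariant \<eta>" and \<mu>: "\<mu> \<in> bounded_measures T"
  shows "conv (measure_flip H \<eta>) \<mu> = (\<lambda>A. \<mu> (topspace T) * measure_flip H \<eta> A)"
proof (rule map_eqI[OF conv_map(1) measure_map_mass[OF compact compact] _ \<mu>])
  have \<eta>b: "\<eta> \<in> positive_measures T" by (rule left_invariant_positive[OF \<eta>])
  then show p: "measure_flip H \<eta> \<in> positive_measures T" "measure_flip H \<eta> \<in> positive_measures T"
    using measure_map_positive[OF flip_map] by auto
  fix x assume x: "x \<in> topspace T"
  have "conv (measure_flip H \<eta>) (dirac T x) = measure_flip H (conv (dirac T (hg_inv H x)) \<eta>)"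
    using flip_conv_dirac[OF inv_in[OF x]] \<eta>b inv_involutive[OF x] by auto
  also have "\<dots> = measure_flip H \<eta>" using \<eta> inv_in[OF x] by (simp add: left_invariant_def)
  finally show "conv (measure_flip H \<eta>) (dirac T x) = (\<lambda>A. dirac T x (topspace T) * measure_flip H \<eta> A)"
    using x by (simp add: dirac_def)
qed

text \<open>The flip of one invariant measure convolved with another equals both factors.\<close>

lemma flip_eq_left_invariant:
  assumes "left_invariant \<eta>" "left_invariant \<eta>'"
  shows "measure_flip H \<eta> = \<eta>'"
proof -
  have b: "\<eta> \<in> bounded_measures T" "\<eta>' \<in> bounded_measures T"
    using assms left_invariant_positive by auto
  have "conv (measure_flip H \<eta>) \<eta>' = \<eta>'"
    using conv_left_invariant[OF assms(2) measure_map_bounded[OF flip_map b(1)]]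
    by (simp add: flip_mass left_invariant_mass[OF assms(1)])
  moreover have "conv (measure_flip H \<eta>) \<eta>' = measure_flip H \<eta>"
    using flip_right_invariant[OF assms(1) b(2)] by (simp add: left_invariant_mass[OF assms(2)])
  ultimately show ?thesis by simp
qed

lemma flip_left_invariant: "left_invariant \<eta> \<Longrightarrow> measure_flip H \<eta> = \<eta>"
  by (rule flip_eq_left_invariant)

lemma left_invariant_unique: "\<lbrakk>left_invariant \<eta>; left_invariant \<eta>'\<rbrakk> \<Longrightarrow> \<eta> = \<eta>'"
  using flip_eq_left_invariant by metis

lemma left_invariant_conv:
  "\<lbrakk>left_invariant \<eta>; \<mu> \<in> bounded_measures T\<rbrakk> \<Longrightarrow> conv \<eta> \<mu> = (\<lambda>A. \<mu> (topspace T) * \<eta> A)"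
  using flip_right_invariant[of \<eta> \<mu>] by (simp add: flip_left_invariant)

text \<open>Radon measures come with outer regularity for all Borel sets but inner regularity for
  open sets only. For general \<open>A\<close> the inner compact set is the complement of an open
  set around the complement of \<open>A\<close>.\<close>

lemma radon_cmeasure_of:
  assumes "radon_measure T M"
  shows "finite_measure M" and "cmeasure_of M \<in> positive_measures T"
proof -
  have M: "space M = topspace T" "sets M = sets (borel_of T)"
    and outer: "\<And>A. A \<in> sets M \<Longrightarrow> emeasure M A = (INF U\<in>{U. openin T U \<and> A \<subseteq> U}. emeasure M U)"
    using assms unfolding radon_measure_def by blast+
  have "emeasure M (topspace T) < \<infinity>"
    using assms compact unfolding radon_measure_def compact_space_def by blast
  then show fin: "finite_measure M" by (intro finite_measureI) (simp add: M(1))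
  interpret finite_measure M by (rule fin)
  have out: "\<exists>U. openin T U \<and> A \<subseteq> U \<and> measure M (U - A) < \<epsilon>" if A: "A \<in> sets M" "\<epsilon> > 0" for A \<epsilon>
  proof -
    have "emeasure M A < emeasure M A + ennreal \<epsilon>"
      using A(2) by (simp add: emeasure_eq_measure ennreal_less_iff flip: ennreal_plus)
    then have "(INF U\<in>{U. openin T U \<and> A \<subseteq> U}. emeasure M U) < emeasure M A + ennreal \<epsilon>"
      by (subst outer[OF A(1), symmetric])
    then obtain U where U: "openin T U" "A \<subseteq> U" "emeasure M U < emeasure M A + ennreal \<epsilon>"
      by (auto simp: INF_less_iff)
    then have "measure M U < measure M A + \<epsilon>"
      using A(2) by (simp add: emeasure_eq_measure ennreal_less_iff flip: ennreal_plus)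
    moreover have "measure M (U - A) = measure M U - measure M A"
      using U A M by (intro finite_measure_Diff) auto
    ultimately show ?thesis using U by auto
  qed
  show "cmeasure_of M \<in> positive_measures T"
  proof (rule cmeasure_of_positive[OF fin M(2)])
    fix A and \<epsilon> :: real assume A: "A \<in> sets M" "\<epsilon> > 0"
    obtain U where U: "openin T U" "A \<subseteq> U" "measure M (U - A) < \<epsilon> / 2"
      using out[OF A(1), of "\<epsilon> / 2"] A(2) by auto
    have cA: "topspace T - A \<in> sets M" using A(1) M by auto
    obtain V where V: "openin T V" "topspace T - A \<subseteq> V" "measure M (V - (topspace T - A)) < \<epsilon> / 2"
      using out[OF cA, of "\<epsilon> / 2"] A(2) by auto
    let ?C = "topspace T - V"
    have C: "closedin T ?C" using V(1) by auto
    have m: "U - A \<in> sets M" "V - (topspace T - A) \<in> sets M" "?C \<in> sets M"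
      using U(1) V(1) A(1) C M by auto
    have "U - ?C \<subseteq> (U - A) \<union> (V - (topspace T - A))" using openin_subset[OF U(1)] by auto
    then have "measure M (U - ?C) \<le> measure M ((U - A) \<union> (V - (topspace T - A)))"
      using m by (intro finite_measure_mono) auto
    also have "\<dots> \<le> measure M (U - A) + measure M (V - (topspace T - A))"
      using m by (intro measure_Un_le) auto
    finally have "measure M (U - ?C) \<le> \<epsilon>" using U(3) V(3) by simp
    then show "\<exists>C U. compactin T C \<and> openin T U \<and> C \<in> sets M \<and> C \<subseteq> A \<and> A \<subseteq> U \<and> measure M (U - C) \<le> \<epsilon>"
      using U V m C closedin_compact_space[OF compact C] by (intro exI[of _ ?C] exI[of _ U]) auto
  qed
qed

text \<open>The converse passage; it lets the invariant measure constructed on the join qualify as a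
  Haar measure.\<close>

lemma radon_borel_measure:
  assumes \<mu>: "\<mu> \<in> positive_measures T"
  shows "radon_measure T (borel_measure T \<mu>)"
proof -
  let ?M = "borel_measure T \<mu>"
  interpret finite_measure ?M by (rule finite_measure_borel_measure[OF \<mu>])
  have approx: "\<exists>C U. compactin T C \<and> openin T U \<and> C \<subseteq> A \<and> A \<subseteq> U \<and>
      emeasure ?M U \<le> emeasure ?M C + ennreal \<epsilon>"
    if A: "A \<in> sets (borel_of T)" "\<epsilon> > 0" for A \<epsilon>
  proof -
    obtain C U where CU: "compactin T C" "openin T U" "C \<subseteq> A" "A \<subseteq> U"
      "\<And>B. \<lbrakk>B \<in> sets (borel_of T); B \<subseteq> U - C\<rbrakk> \<Longrightarrow> cmod (\<mu> B) < \<epsilon>"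
      using bounded_measures_regular[OF positive_measures_bounded[OF \<mu>] A] by blast
    have m: "U \<in> sets (borel_of T)" "C \<in> sets (borel_of T)"
      using CU(1,2) compactin_imp_closedin[OF Hausdorff] by auto
    then have "Re (\<mu> (U - C)) < \<epsilon>"
      using CU(5)[of "U - C"] complex_Re_le_cmod[of "\<mu> (U - C)"] by auto
    then have "measure ?M (U - C) < \<epsilon>" by (simp add: measure_borel_measure[OF \<mu>])
    moreover have "measure ?M (U - C) = measure ?M U - measure ?M C"
      using m CU(3,4) by (intro finite_measure_Diff) auto
    ultimately have "emeasure ?M U \<le> emeasure ?M C + ennreal \<epsilon>"
      using A(2) by (simp add: emeasure_eq_measure flip: ennreal_plus)
    then show ?thesis using CU by blast
  qed
  have "emeasure ?M A = (INF U\<in>{U. openin T U \<and> A \<subseteq> U}. emeasure ?M U)"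
    if A: "A \<in> sets (borel_of T)" for A
  proof (rule antisym)
    show "emeasure ?M A \<le> (INF U\<in>{U. openin T U \<and> A \<subseteq> U}. emeasure ?M U)"
    proof (rule INF_greatest)
      fix U assume "U \<in> {U. openin T U \<and> A \<subseteq> U}"
      then show "emeasure ?M A \<le> emeasure ?M U" by (intro emeasure_mono) (simp_all add: openin_borel)
    qed
    show "(INF U\<in>{U. openin T U \<and> A \<subseteq> U}. emeasure ?M U) \<le> emeasure ?M A"
    proof (rule ennreal_le_epsilon)
      fix e :: real assume "e > 0"
      then obtain C U where CU: "openin T U" "C \<subseteq> A" "A \<subseteq> U" "emeasure ?M U \<le> emeasure ?M C + ennreal e"
        using approx[OF A] by metis
      have "(INF U\<in>{U. openin T U \<and> A \<subseteq> U}. emeasure ?M U) \<le> emeasure ?M U"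
        using CU by (intro INF_lower) simp
      also have "\<dots> \<le> emeasure ?M A + ennreal e"
        using CU(4) add_right_mono[OF emeasure_mono[OF CU(2), of ?M], of "ennreal e"] A
        by (simp add: order_trans)
      finally show "(INF U\<in>{U. openin T U \<and> A \<subseteq> U}. emeasure ?M U) \<le> emeasure ?M A + ennreal e" .
    qed
  qed
  moreover have "emeasure ?M U = (SUP C\<in>{C. compactin T C \<and> C \<subseteq> U}. emeasure ?M C)"
    if U: "openin T U" for U
  proof (rule antisym)
    show "(SUP C\<in>{C. compactin T C \<and> C \<subseteq> U}. emeasure ?M C) \<le> emeasure ?M U"
    proof (rule SUP_least)
      fix C assume "C \<in> {C. compactin T C \<and> C \<subseteq> U}"
      then show "emeasure ?M C \<le> emeasure ?M U"
        using U by (intro emeasure_mono) (simp_all add: openin_borel)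
    qed
    show "emeasure ?M U \<le> (SUP C\<in>{C. compactin T C \<and> C \<subseteq> U}. emeasure ?M C)"
    proof (rule ennreal_le_epsilon)
      fix e :: real assume "e > 0"
      then obtain C V where CV: "compactin T C" "openin T V" "C \<subseteq> U" "U \<subseteq> V" "emeasure ?M V \<le> emeasure ?M C + ennreal e"
        using approx[OF openin_borel[OF U]] by metis
      have "emeasure ?M U \<le> emeasure ?M V" using CV(2,4) by (intro emeasure_mono) (simp_all add: openin_borel)
      also have "\<dots> \<le> emeasure ?M C + ennreal e" by fact
      also have "\<dots> \<le> (SUP C\<in>{C. compactin T C \<and> C \<subseteq> U}. emeasure ?M C) + ennreal e"
        using CV by (intro add_right_mono SUP_upper) simp
      finally show "emeasure ?M U \<le> (SUP C\<in>{C. compactin T C \<and> C \<subseteq> U}. emeasure ?M C) + ennreal e" .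
    qed
  qed
  ultimately show ?thesis
    unfolding radon_measure_def by (simp add: less_top[symmetric])
qed

lemma cintegral_conv_dirac:
  assumes "x \<in> topspace T" "\<mu> \<in> positive_measures T" "continuous_map T euclidean f"
  shows "cintegral T (conv (dirac T x) \<mu>) f = cintegral T \<mu> (\<lambda>y. cintegral T (conv (dirac T x) (dirac T y)) f)"
  by (rule cintegral_measure_map[OF compact Hausdorff compact conv_map(1)[OF dirac_pos[OF assms(1)]] assms(2,3)])

lemma compactly_supported_iff:
  "f \<in> compactly_supported_continuous T \<longleftrightarrow> continuous_map T euclidean f"
  using compact unfolding compactly_supported_continuous_def compact_space_def by auto

text \<open>By \<open>cintegral_conv_dirac\<close> the integral identity that defines Haar measure
  says that convolution with a point mass changes no integral, and integrals determine a positive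
  measure.\<close>

lemma haar_measure_cmeasure_of:
  assumes "haar_measure H M"
  shows "cmeasure_of M \<in> positive_measures T" "borel_measure T (cmeasure_of M) = M"
    "\<And>x. x \<in> topspace T \<Longrightarrow> conv (dirac T x) (cmeasure_of M) = cmeasure_of M"
proof -
  have rad: "radon_measure T M" and inv: "\<And>x f. \<lbrakk>x \<in> topspace T; continuous_map T euclidean f\<rbrakk> \<Longrightarrow>
    (\<integral>y. cintegral T (conv (dirac T x) (dirac T y)) f \<partial>M) = (\<integral>y. f y \<partial>M)"
    using assms by (auto simp: haar_measure_def compactly_supported_iff)
  show p: "cmeasure_of M \<in> positive_measures T" by (rule radon_cmeasure_of[OF rad])
  show eq: "borel_measure T (cmeasure_of M) = M"
    using rad radon_cmeasure_of[OF rad] by (intro borel_measure_cmeasure_of) (auto simp: radon_measure_def)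
  fix x assume x: "x \<in> topspace T"
  show "conv (dirac T x) (cmeasure_of M) = cmeasure_of M"
  proof (rule positive_measures_eqI[OF compact Hausdorff conv_positive[OF dirac_pos[OF x] p] p])
    fix f :: "'a \<Rightarrow> complex" assume f: "continuous_map T euclidean f"
    show "cintegral T (conv (dirac T x) (cmeasure_of M)) f = cintegral T (cmeasure_of M) f"
      unfolding cintegral_conv_dirac[OF x p f] cintegral_positive[OF p] eq by (rule inv[OF x f])
  qed
qed

lemma normalized_haar_left_invariant:
  assumes "normalized_haar_measure H M" shows "left_invariant (cmeasure_of M)"
proof -
  have "haar_measure H M" "measure M (topspace T) = 1"
    using assms by (auto simp: normalized_haar_measure_def measure_def)
  then show ?thesis
    using haar_measure_cmeasure_of[of M]
    by (simp add: left_invariant_def probability_measures_def) (simp add: cmeasure_of_def)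
qed

lemma left_invariant_normalized_haar:
  assumes "left_invariant \<eta>" shows "normalized_haar_measure H (borel_measure T \<eta>)"
proof -
  have p: "\<eta> \<in> positive_measures T" by (rule left_invariant_positive[OF assms])
  have one: "emeasure (borel_measure T \<eta>) (topspace T) = 1"
    using emeasure_borel_measure[OF p, of "topspace T"] left_invariant_mass[OF assms] by simp
  moreover have "(\<integral>y. cintegral T (conv (dirac T x) (dirac T y)) f \<partial>borel_measure T \<eta>) = (\<integral>y. f y \<partial>borel_measure T \<eta>)"
    if "x \<in> topspace T" "continuous_map T euclidean f" for x f
    using cintegral_conv_dirac[OF that(1) p that(2)] assms that(1)
    by (simp add: left_invariant_def flip: cintegral_positive[OF p])
  ultimately show ?thesis
    by (simp add: normalized_haar_measure_def haar_measure_def radon_borel_measure[OF p] compactly_supported_iff)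
qed

text \<open>\<open>\<eta>\<close> settles existence and \<open>left_invariant_unique\<close>
  uniqueness, so the definite description denotes.\<close>

lemma the_normalized_haar_eq:
  assumes "left_invariant \<eta>" shows "the_normalized_haar H = borel_measure T \<eta>"
  unfolding the_normalized_haar_def
proof (rule the_equality)
  fix M assume M: "normalized_haar_measure H M"
  have "cmeasure_of M = \<eta>"
    using left_invariant_unique[OF normalized_haar_left_invariant[OF M] assms] .
  then show "M = borel_measure T \<eta>"
    using haar_measure_cmeasure_of(2)[of M] M by (simp add: normalized_haar_measure_def)
qed (rule left_invariant_normalized_haar[OF assms])

end

section \<open>Orthonormal bases of Hilbert spaces\<close>

context hilbert_space
begin

abbreviation "X \<equiv> hs_set V"
abbreviation "vzero \<equiv> hs_zero V"
abbreviation "vadd \<equiv> hs_add V"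
abbreviation "smul \<equiv> hs_scale V"
abbreviation "ip \<equiv> hs_inner V"
abbreviation "sqn x \<equiv> Re (hs_inner V x x)"

lemma inner_add_right: "\<lbrakk>x \<in> X; y \<in> X; z \<in> X\<rbrakk> \<Longrightarrow> ip z (vadd x y) = ip z x + ip z y"
  using inner_commute[of "vadd x y" z] inner_commute[of x z] inner_commute[of y z]
  by (simp add: add_closed inner_add_left)

lemma inner_scale_right: "\<lbrakk>x \<in> X; z \<in> X\<rbrakk> \<Longrightarrow> ip z (smul a x) = cnj a * ip z x"
  using inner_commute[of "smul a x" z] inner_commute[of x z]
  by (simp add: scale_closed inner_scale_left)

lemmas inner_simps = inner_add_left inner_add_right inner_scale_left inner_scale_right add_closed scale_closed

lemma scale_zero: "x \<in> X \<Longrightarrow> smul 0 x = vzero"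
  using scale_add_left[of x 1 "- 1"] by (simp add: add_negative scale_one)

lemma inner_zero_left: "x \<in> X \<Longrightarrow> ip vzero x = 0"
  using inner_scale_left[of vzero x 0] by (simp add: scale_zero zero_closed)

lemma inner_self: "x \<in> X \<Longrightarrow> ip x x = of_real (sqn x)"
  using inner_commute[of x x] by (simp add: complex_eq_iff)

lemma sqn_zero_iff: "x \<in> X \<Longrightarrow> sqn x = 0 \<longleftrightarrow> x = vzero"
  using inner_definite[of x] inner_self[of x] inner_zero_left[OF zero_closed] by auto

lemma norm_square: "x \<in> X \<Longrightarrow> (hs_norm V x)\<^sup>2 = sqn x"
  by (simp add: hs_norm_def inner_nonneg)

lemma norm_nonneg: "x \<in> X \<Longrightarrow> 0 \<le> hs_norm V x"
  by (simp add: hs_norm_def inner_nonneg)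

text \<open>Removes the component along one unit vector. Nonnegativity of the result yields
  Cauchy-Schwarz and, after repetition, Bessel's inequality.\<close>

lemma sqn_residual:
  assumes "x \<in> X" "g \<in> X" "ip g g = 1"
  shows "sqn (vadd x (smul (- ip x g) g)) = sqn x - (cmod (ip x g))\<^sup>2"
proof -
  have "ip (vadd x (smul (- ip x g) g)) (vadd x (smul (- ip x g) g)) =
      ip x x - ip x g * cnj (ip x g)"
    using assms inner_commute[of x g] by (simp add: inner_simps algebra_simps)
  also have "ip x g * cnj (ip x g) = of_real ((cmod (ip x g))\<^sup>2)"
    using complex_norm_square[of "ip x g"] by simp
  finally show ?thesis by simp
qed

lemma Cauchy_Schwarz:
  assumes "x \<in> X" "y \<in> X"
  shows "cmod (ip x y) \<le> hs_norm V x * hs_norm V y"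
proof (cases "y = vzero")
  case True
  then have "ip x y = 0"
    using inner_commute[of y x] inner_zero_left[OF assms(1)] assms zero_closed by simp
  then show ?thesis using norm_nonneg assms by simp
next
  case False
  then have y: "sqn y > 0"
    using sqn_zero_iff[OF assms(2)] inner_nonneg[OF assms(2)] by linarith
  define n where "n = hs_norm V y"
  have n: "n > 0" "n\<^sup>2 = sqn y" using y by (simp_all add: n_def hs_norm_def)
  define g where "g = smul (of_real (1 / n)) y"
  have g: "g \<in> X" "ip g g = 1"
    using assms(2) n inner_self[OF assms(2)]
    by (simp_all add: g_def inner_simps power2_eq_square field_simps flip: n(2) of_real_mult)
  have "ip x g = ip x y / of_real n" using assms by (simp add: g_def inner_simps)
  then have e: "cmod (ip x g) = cmod (ip x y) / n" using n by (simp add: norm_divide)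
  have "0 \<le> sqn x - (cmod (ip x g))\<^sup>2"
    using sqn_residual[OF assms(1) g] inner_nonneg[of "vadd x (smul (- ip x g) g)"] assms(1) g(1)
    by (simp add: inner_simps)
  then have "(cmod (ip x g))\<^sup>2 \<le> (hs_norm V x)\<^sup>2" using norm_square[OF assms(1)] by simp
  then have "cmod (ip x g) \<le> hs_norm V x" using norm_nonneg[OF assms(1)] by (rule power2_le_imp_le)
  then show ?thesis using e n by (simp add: field_simps n_def)
qed

lemma norm_triangle:
  assumes "x \<in> X" "y \<in> X"
  shows "hs_norm V (vadd x y) \<le> hs_norm V x + hs_norm V y"
proof (rule power2_le_imp_le)
  have "ip (vadd x y) (vadd x y) = ip x x + ip y y + (ip x y + cnj (ip x y))"
    using assms inner_commute[of x y] by (simp add: inner_simps)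
  then have "(hs_norm V (vadd x y))\<^sup>2 = (hs_norm V x)\<^sup>2 + (hs_norm V y)\<^sup>2 + 2 * Re (ip x y)"
    using assms by (simp add: norm_square add_closed)
  also have "Re (ip x y) \<le> hs_norm V x * hs_norm V y"
    using Cauchy_Schwarz[OF assms] complex_Re_le_cmod order_trans by blast
  finally show "(hs_norm V (vadd x y))\<^sup>2 \<le> (hs_norm V x + hs_norm V y)\<^sup>2"
    by (simp add: power2_sum)
qed (simp add: norm_nonneg assms)

abbreviation "vsub x y \<equiv> vadd x (smul (- 1) y)"

lemma add_neg_left: "y \<in> X \<Longrightarrow> vadd (smul (- 1) y) y = vzero"
  using add_commute[of "smul (- 1) y" y] by (simp add: add_negative scale_closed)

lemma zero_add: "y \<in> X \<Longrightarrow> vadd vzero y = y"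
  using add_commute[of vzero y] by (simp add: add_zero zero_closed)

lemma sub_eq_zero: "\<lbrakk>x \<in> X; y \<in> X; vsub x y = vzero\<rbrakk> \<Longrightarrow> x = y"
  by (metis add_assoc add_neg_left add_zero scale_closed zero_add)

lemma sub_sub: "\<lbrakk>x \<in> X; y \<in> X; z \<in> X\<rbrakk> \<Longrightarrow> vadd (vsub x y) (vsub y z) = vsub x z"
  by (metis add_assoc add_closed add_neg_left scale_closed zero_add)

lemma metric: "Metric_space X (hs_dist V)"
proof
  show "0 \<le> hs_dist V x y" for x y
    by (simp add: hs_dist_def norm_nonneg add_closed scale_closed)
  show "hs_dist V x y = hs_dist V y x" for x y
  proof (cases "x \<in> X \<and> y \<in> X")
    case True
    then have "ip (vsub x y) (vsub x y) = ip (vsub y x) (vsub y x)"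
      by (simp add: inner_simps)
    then show ?thesis by (simp add: hs_dist_def hs_norm_def)
  qed (auto simp: hs_dist_def)
  fix x y assume xy: "x \<in> X" "y \<in> X"
  have "hs_dist V x y = 0 \<longleftrightarrow> vsub x y = vzero"
    using xy sqn_zero_iff[of "vsub x y"] by (simp add: hs_dist_def hs_norm_def add_closed scale_closed)
  then show "hs_dist V x y = 0 \<longleftrightarrow> x = y"
    using sub_eq_zero[OF xy] add_negative[OF xy(1)] by auto
  fix z assume z: "z \<in> X"
  show "hs_dist V x z \<le> hs_dist V x y + hs_dist V y z"
    using norm_triangle[of "vsub x y" "vsub y z"] sub_sub[OF xy z] xy z
    by (simp add: hs_dist_def add_closed scale_closed)
qed

text \<open>The equalizer of two continuous maps into a Hausdorff space is closed. Irreducibility is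
  applied to subspaces of this kind, with \<open>P\<close> the operator of a central idempotent or a
  projection onto a line.\<close>

lemma fixed_points_closed:
  assumes P: "hs_bounded_operator V P"
  shows "hs_closed_subspace V {x \<in> X. P x = x}"
proof -
  interpret Metric_space X "hs_dist V" by (rule metric)
  obtain c where lin: "hs_linear V V P" and c: "\<And>x. x \<in> X \<Longrightarrow> hs_norm V (P x) \<le> c * hs_norm V x"
    using P unfolding hs_bounded_operator_def by blast
  have PX: "P x \<in> X" if "x \<in> X" for x using lin that by (auto simp: hs_linear_def)
  have Padd: "P (vadd x y) = vadd (P x) (P y)" and Pscale: "P (smul a x) = smul a (P x)"
    if "x \<in> X" "y \<in> X" for x y a using lin that by (auto simp: hs_linear_def)
  have P0: "P vzero = vzero" using Pscale[OF zero_closed zero_closed, of 0] by (simp add: scale_zero zero_closed PX)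
  have lip: "hs_dist V (P x) (P y) \<le> c * hs_dist V x y" if "x \<in> X" "y \<in> X" for x y
    using c[of "vsub x y"] that by (simp add: hs_dist_def PX add_closed scale_closed Padd Pscale)
  have "continuous_map mtopology mtopology P"
    unfolding metric_continuous_map[OF metric]
  proof (intro conjI ballI allI impI)
    show "P ` X \<subseteq> X" using PX by auto
    fix a and \<epsilon> :: real assume a: "a \<in> X" "\<epsilon> > 0"
    show "\<exists>\<delta>>0. \<forall>x. x \<in> X \<and> hs_dist V a x < \<delta> \<longrightarrow> hs_dist V (P a) (P x) < \<epsilon>"
    \<comment> \<open>The constant \<open>c\<close> of a bounded operator may be 0 or, on the zero
      space, negative.\<close>
    proof (intro exI[of _ "\<epsilon> / (\<bar>c\<bar> + 1)"] conjI allI impI)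
      show "\<epsilon> / (\<bar>c\<bar> + 1) > 0" using a(2) by (simp add: add_nonneg_pos)
      fix x assume x: "x \<in> X \<and> hs_dist V a x < \<epsilon> / (\<bar>c\<bar> + 1)"
      have "hs_dist V (P a) (P x) \<le> c * hs_dist V a x" using lip a x by blast
      also have "\<dots> \<le> (\<bar>c\<bar> + 1) * hs_dist V a x" by (intro mult_right_mono) auto
      also have "\<dots> < \<epsilon>" using x by (simp add: field_simps)
      finally show "hs_dist V (P a) (P x) < \<epsilon>" .
    qed
  qed
  then have "closedin mtopology {x \<in> topspace mtopology. P x = x}"
    by (intro closedin_continuous_maps_eq[OF Hausdorff_space_mtopology]) auto
  then show ?thesis
    unfolding hs_closed_subspace_def
    by (auto simp: zero_closed P0 add_closed scale_closed Padd Pscale)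
qed

section \<open>Orthonormal systems and dimension\<close>

definition orthonormal :: "'h set \<Rightarrow> bool" where
  "orthonormal F \<longleftrightarrow> F \<subseteq> X \<and> (\<forall>u\<in>F. \<forall>v\<in>F. ip u v = (if u = v then 1 else 0))"

text \<open>\<open>y\<close> is \<open>x\<close> minus its projection onto the span of
  \<open>F\<close>. The last clause carries the induction: \<open>y\<close> has the same inner
  product with the next vector as \<open>x\<close> has.\<close>

lemma residual:
  assumes "finite F" "orthonormal F" "x \<in> X"
  shows "\<exists>y\<in>X. (\<forall>f\<in>F. ip y f = 0) \<and> sqn y = sqn x - (\<Sum>f\<in>F. (cmod (ip x f))\<^sup>2) \<and>
    (\<forall>z\<in>X. (\<forall>f\<in>F. ip z f = 0) \<longrightarrow> ip y z = ip x z)"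
  using assms(1,2)
proof (induction F)
  case empty
  then show ?case using assms(3) by auto
next
  case (insert g F)
  then have F: "orthonormal F" and g: "g \<in> X" "ip g g = 1" "\<And>f. f \<in> F \<Longrightarrow> ip g f = 0"
    and FX: "F \<subseteq> X"
    unfolding orthonormal_def by auto
  obtain y where y: "y \<in> X" "\<forall>f\<in>F. ip y f = 0" "sqn y = sqn x - (\<Sum>f\<in>F. (cmod (ip x f))\<^sup>2)"
    "\<And>z. \<lbrakk>z \<in> X; \<forall>f\<in>F. ip z f = 0\<rbrakk> \<Longrightarrow> ip y z = ip x z"
    using insert.IH[OF F] by blast
  have yg: "ip y g = ip x g" using y(4)[OF g(1)] g(3) by blast
  let ?y = "vadd y (smul (- ip y g) g)"
  have "?y \<in> X" using y g by (simp add: inner_simps)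
  moreover have "ip ?y f = 0" if "f \<in> insert g F" for f
    using that y g FX by (auto simp: inner_simps)
  moreover have "sqn ?y = sqn x - (\<Sum>f\<in>insert g F. (cmod (ip x f))\<^sup>2)"
    using sqn_residual[OF y(1) g(1,2)] y(3) yg insert.hyps by simp
  moreover have "ip ?y z = ip x z" if "z \<in> X" "\<forall>f\<in>insert g F. ip z f = 0" for z
    using that y(1) y(4)[of z] g inner_commute[of z g] by (simp add: inner_simps)
  ultimately show ?case by blast
qed

lemma orthonormal_basis_iff:
  "orthonormal_basis V B \<longleftrightarrow> orthonormal B \<and> (\<forall>x\<in>X. (\<forall>u\<in>B. ip x u = 0) \<longrightarrow> x = vzero)"
  unfolding orthonormal_basis_def orthonormal_def by auto

text \<open>Bessel's inequality for one system and Parseval's identity for the other compare the cardinalities.\<close>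

lemma card_orthonormal_le:
  assumes B: "orthonormal_basis V B" "finite B" and F: "orthonormal F" "finite F"
  shows "card F \<le> card B"
proof -
  have oB: "orthonormal B" using B orthonormal_basis_iff by blast
  have X: "b \<in> X" "sqn b = 1" if "b \<in> B \<or> b \<in> F" for b
    using that oB F(1) unfolding orthonormal_def by auto
  have parseval: "sqn x = (\<Sum>b\<in>B. (cmod (ip x b))\<^sup>2)" if x: "x \<in> X" for x
  proof -
    obtain y where "y \<in> X" "\<forall>f\<in>B. ip y f = 0" "sqn y = sqn x - (\<Sum>f\<in>B. (cmod (ip x f))\<^sup>2)"
      using residual[OF B(2) oB x] by blast
    moreover from this have "y = vzero" using B(1) orthonormal_basis_iff by blast
    ultimately show ?thesis using sqn_zero_iff[of y] by simp
  qed
  have bessel: "(\<Sum>f\<in>F. (cmod (ip x f))\<^sup>2) \<le> sqn x" if x: "x \<in> X" for x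
  proof -
    obtain y where "y \<in> X" "sqn y = sqn x - (\<Sum>f\<in>F. (cmod (ip x f))\<^sup>2)"
      using residual[OF F(2,1) x] by blast
    then show ?thesis using inner_nonneg[of y] by simp
  qed
  have "real (card F) = (\<Sum>f\<in>F. sqn f)" using X by simp
  also have "\<dots> = (\<Sum>f\<in>F. \<Sum>b\<in>B. (cmod (ip f b))\<^sup>2)"
    using X by (intro sum.cong parseval) auto
  also have "\<dots> = (\<Sum>b\<in>B. \<Sum>f\<in>F. (cmod (ip f b))\<^sup>2)" by (rule sum.swap)
  also have "\<dots> = (\<Sum>b\<in>B. \<Sum>f\<in>F. (cmod (ip b f))\<^sup>2)"
  proof (intro sum.cong refl)
    fix b f assume "b \<in> B" "f \<in> F"
    then show "(cmod (ip f b))\<^sup>2 = (cmod (ip b f))\<^sup>2" using inner_commute[of f b] X by simp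
  qed
  also have "\<dots> \<le> (\<Sum>b\<in>B. sqn b)" using X by (intro sum_mono bessel) auto
  also have "\<dots> = real (card B)" using X by simp
  finally show ?thesis by simp
qed

lemma orthonormal_basis_finite:
  assumes "orthonormal_basis V B" "finite B" "orthonormal_basis V B'"
  shows "finite B'"
proof (rule ccontr)
  assume "infinite B'"
  then obtain F where F: "F \<subseteq> B'" "card F = Suc (card B)" "finite F"
    using infinite_arbitrarily_large by blast
  then have "orthonormal F"
    using assms(3) unfolding orthonormal_basis_iff orthonormal_def by blast
  then show False using card_orthonormal_le[OF assms(1,2)] F by fastforce
qed

text \<open>\<open>hs_dim\<close> takes the cardinality of an arbitrary basis, so all bases must
  agree; an infinite basis has \<open>card\<close> 0.\<close>

lemma hs_dim_eq:
  assumes "orthonormal_basis V B" shows "hs_dim V = card B"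
proof -
  define B' where "B' = (SOME B. orthonormal_basis V B)"
  have B': "orthonormal_basis V B'" unfolding B'_def using assms by (rule someI)
  have "card B' = card B"
  proof (cases "finite B")
    case True
    then have "finite B'" using orthonormal_basis_finite[OF assms True B'] by blast
    then show ?thesis
      using True B' assms card_orthonormal_le orthonormal_basis_iff by (metis order_antisym)
  next
    case False
    then have "infinite B'" using orthonormal_basis_finite[OF B' _ assms] by blast
    then show ?thesis using False by simp
  qed
  then show ?thesis by (simp add: hs_dim_def B'_def)
qed

lemma normalize:
  assumes "x \<in> X" "x \<noteq> vzero"
  shows "smul (of_real (1 / hs_norm V x)) x \<in> X"
    "ip (smul (of_real (1 / hs_norm V x)) x) (smul (of_real (1 / hs_norm V x)) x) = 1"
proof -
  have "sqn x > 0" using sqn_zero_iff[OF assms(1)] inner_nonneg[OF assms(1)] assms(2) by linarith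
  then have n: "hs_norm V x > 0" by (simp add: hs_norm_def)
  show "smul (of_real (1 / hs_norm V x)) x \<in> X" using assms by (simp add: scale_closed)
  have "ip x x = of_real (hs_norm V x * hs_norm V x)"
    using inner_self[OF assms(1)] norm_square[OF assms(1)] by (simp add: power2_eq_square)
  then show "ip (smul (of_real (1 / hs_norm V x)) x) (smul (of_real (1 / hs_norm V x)) x) = 1"
    using assms n by (simp add: inner_simps)
qed

text \<open>Finite dimension of irreducible representations is not proved here, so Zorn's lemma is
  used: a nonzero vector orthogonal to a maximal system could be normalized and added.\<close>

lemma orthonormal_basis_exists: "\<exists>B. orthonormal_basis V B"
proof -
  have "\<Union>C \<in> {F. orthonormal F}" if C: "subset.chain {F. orthonormal F} C" for C
  proof -
    have "ip u v = (if u = v then 1 else 0)" if "u \<in> A" "A \<in> C" "v \<in> B" "B \<in> C" for u v A B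
    proof -
      have "A \<subseteq> B \<or> B \<subseteq> A" "orthonormal A" "orthonormal B"
        using C that unfolding subset_chain_def by auto
      then show ?thesis using that unfolding orthonormal_def by (meson subsetD)
    qed
    moreover have "\<Union>C \<subseteq> X" using C unfolding subset_chain_def orthonormal_def by blast
    ultimately show ?thesis unfolding orthonormal_def by blast
  qed
  then obtain B where B: "orthonormal B" "\<And>F. \<lbrakk>orthonormal F; B \<subseteq> F\<rbrakk> \<Longrightarrow> F = B"
    using subset_Zorn'[of "{F. orthonormal F}"] by auto
  have "x = vzero" if x: "x \<in> X" "\<forall>u\<in>B. ip x u = 0" for x
  proof (rule ccontr)
    assume "x \<noteq> vzero"
    define g where "g = smul (of_real (1 / hs_norm V x)) x"
    have g: "g \<in> X" "ip g g = 1" unfolding g_def using normalize[OF x(1) \<open>x \<noteq> vzero\<close>] .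
    have BX: "B \<subseteq> X" using B(1) unfolding orthonormal_def by blast
    have gu: "ip g u = 0" "ip u g = 0" if "u \<in> B" for u
      using x that BX inner_commute[of g u] g(1) by (auto simp: g_def inner_simps)
    then have "orthonormal (insert g B)"
      using B(1) g unfolding orthonormal_def by auto
    then have "g \<in> B" using B(2) by blast
    then show False using gu(1) g(2) by simp
  qed
  then show ?thesis using B(1) orthonormal_basis_iff by blast
qed

end

section \<open>Unitary maps between Hilbert spaces\<close>

lemma hs_unitary_onb:
  assumes "hilbert_space V" "hilbert_space W" and U: "hs_unitary V W U" and B: "orthonormal_basis V B"
  shows "orthonormal_basis W (U ` B)"
proof -
  interpret V: hilbert_space V by fact
  interpret W: hilbert_space W by fact
  have bij: "bij_betw U (hs_set V) (hs_set W)" and ip: "\<And>x y. \<lbrakk>x \<in> hs_set V; y \<in> hs_set V\<rbrakk> \<Longrightarrow> hs_inner W (U x) (U y) = hs_inner V x y"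
    and smul: "\<And>x a. x \<in> hs_set V \<Longrightarrow> U (hs_scale V a x) = hs_scale W a (U x)"
    using U unfolding hs_unitary_def hs_linear_def by auto
  have BV: "B \<subseteq> hs_set V" and ort: "\<And>u v. \<lbrakk>u \<in> B; v \<in> B\<rbrakk> \<Longrightarrow> hs_inner V u v = (if u = v then 1 else 0)"
    and tot: "\<And>x. \<lbrakk>x \<in> hs_set V; \<And>u. u \<in> B \<Longrightarrow> hs_inner V x u = 0\<rbrakk> \<Longrightarrow> x = hs_zero V"
    using B unfolding orthonormal_basis_def by auto
  have vzero: "U (hs_zero V) = hs_zero W"
    using smul[OF V.zero_closed, of 0] bij V.zero_closed
    by (simp add: V.scale_zero W.scale_zero bij_betwE)
  have inj: "inj_on U (hs_set V)" using bij by (simp add: bij_betw_def)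
  have "hs_inner W (U u) (U v) = (if U u = U v then 1 else 0)" if "u \<in> B" "v \<in> B" for u v
    using ip[of u v] ort[OF that] that BV inj by (auto simp: inj_on_def subset_iff)
  moreover have "y = hs_zero W" if y: "y \<in> hs_set W" "\<forall>u\<in>B. hs_inner W y (U u) = 0" for y
  proof -
    obtain x where x: "x \<in> hs_set V" "y = U x" using bij y(1) by (auto simp: bij_betw_def)
    have "hs_inner V x u = 0" if "u \<in> B" for u
      using y(2) ip[OF x(1), of u] BV that x(2) by auto
    then have "x = hs_zero V" using x(1) by (intro tot)
    then show ?thesis using x vzero by simp
  qed
  moreover have "U ` B \<subseteq> hs_set W" using BV bij by (auto simp: bij_betw_def)
  ultimately show ?thesis unfolding orthonormal_basis_def by auto
qed

lemma hs_dim_unitary: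
  assumes "hilbert_space V" "hilbert_space W" "hs_unitary V W U"
  shows "hs_dim W = hs_dim V"
proof -
  obtain B where B: "orthonormal_basis V B" using hilbert_space.orthonormal_basis_exists[OF assms(1)] by blast
  have "inj_on U B"
    using assms(3) B unfolding hs_unitary_def bij_betw_def orthonormal_basis_def by (meson inj_on_subset)
  then show ?thesis
    using hilbert_space.hs_dim_eq[OF assms(1) B] hilbert_space.hs_dim_eq[OF assms(2) hs_unitary_onb[OF assms B]]
    by (simp add: card_image)
qed

lemma hs_unitary_id: "hs_unitary V V (\<lambda>x. x)"
  by (auto simp: hs_unitary_def hs_linear_def bij_betw_def)

lemma hs_unitary_compose:
  assumes "hs_unitary V W U" "hs_unitary W Z U'"
  shows "hs_unitary V Z (\<lambda>x. U' (U x))"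
proof -
  have "\<And>x. x \<in> hs_set V \<Longrightarrow> U x \<in> hs_set W" using assms(1) by (auto simp: hs_unitary_def hs_linear_def)
  then show ?thesis
    using assms bij_betw_trans[of U "hs_set V" "hs_set W" U' "hs_set Z"]
    by (auto simp: hs_unitary_def hs_linear_def o_def)
qed

lemma hs_unitary_inverse:
  assumes "hilbert_space V" and U: "hs_unitary V W U"
  shows "hs_unitary W V (inv_into (hs_set V) U)"
proof -
  interpret hilbert_space V by fact
  have bij: "bij_betw U (hs_set V) (hs_set W)" using U by (simp add: hs_unitary_def)
  let ?I = "inv_into (hs_set V) U"
  have I: "?I y \<in> hs_set V" "U (?I y) = y" if "y \<in> hs_set W" for y
    using bij that by (auto simp: bij_betw_def inv_into_into f_inv_into_f)
  have IU: "?I (U x) = x" if "x \<in> hs_set V" for x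
    using bij that by (simp add: bij_betw_inv_into_left)
  have "?I (hs_add W x y) = hs_add V (?I x) (?I y)" if "x \<in> hs_set W" "y \<in> hs_set W" for x y
    using IU[of "hs_add V (?I x) (?I y)"] I that U by (simp add: hs_unitary_def hs_linear_def add_closed)
  moreover have "?I (hs_scale W a x) = hs_scale V a (?I x)" if "x \<in> hs_set W" for x a
    using IU[of "hs_scale V a (?I x)"] I that U by (simp add: hs_unitary_def hs_linear_def scale_closed)
  moreover have "hs_inner V (?I x) (?I y) = hs_inner W x y" if "x \<in> hs_set W" "y \<in> hs_set W" for x y
  proof -
    have "hs_inner W (U (?I x)) (U (?I y)) = hs_inner V (?I x) (?I y)"
      using U I(1) that unfolding hs_unitary_def by blast
    then show ?thesis using I(2) that by simp
  qed
  ultimately show ?thesis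
    using bij_betw_inv_into[OF bij] I(1) by (auto simp: hs_unitary_def hs_linear_def)
qed

section \<open>Representations\<close>

lemma rep_closed:
  assumes "hypergroup_representation H \<pi>" "\<mu> \<in> hg_measures H" "\<xi> \<in> hs_set (rep_space \<pi>)"
  shows "rep_op \<pi> \<mu> \<xi> \<in> hs_set (rep_space \<pi>)"
  using hypergroup_representation.rep_bounded[OF assms(1,2)] assms(3)
  by (auto simp: hs_bounded_operator_def hs_linear_def)

lemma rep_scale_measure:
  assumes \<pi>: "hypergroup_representation H \<pi>" and \<mu>: "\<mu> \<in> hg_measures H" and \<xi>: "\<xi> \<in> hs_set (rep_space \<pi>)"
  shows "rep_op \<pi> (\<lambda>A. a * \<mu> A) \<xi> = hs_scale (rep_space \<pi>) a (rep_op \<pi> \<mu> \<xi>)"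
proof -
  interpret hilbert_space "rep_space \<pi>" by (rule hypergroup_representation.rep_hilbert[OF \<pi>])
  show ?thesis
    using hypergroup_representation.rep_linear[OF \<pi> \<mu> \<mu> \<xi>, of a 0] rep_closed[OF \<pi> \<mu> \<xi>]
    by (simp add: scale_zero add_zero scale_closed)
qed

section \<open>Equivalence of representations and duals\<close>

lemma equivalent_refl: "equivalent_representations H \<pi> \<pi>"
  unfolding equivalent_representations_def using hs_unitary_id by blast

lemma equivalent_sym:
  assumes \<pi>: "hypergroup_representation H \<pi>" and eq: "equivalent_representations H \<pi> \<sigma>"
  shows "equivalent_representations H \<sigma> \<pi>"
proof -
  let ?V = "hs_set (rep_space \<pi>)" and ?W = "hs_set (rep_space \<sigma>)"
  obtain U where U: "hs_unitary (rep_space \<pi>) (rep_space \<sigma>) U"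
    "\<And>\<mu> \<xi>. \<lbrakk>\<mu> \<in> hg_measures H; \<xi> \<in> ?V\<rbrakk> \<Longrightarrow> U (rep_op \<pi> \<mu> \<xi>) = rep_op \<sigma> \<mu> (U \<xi>)"
    using eq unfolding equivalent_representations_def by blast
  have bij: "bij_betw U ?V ?W" using U(1) by (simp add: hs_unitary_def)
  let ?I = "inv_into ?V U"
  have "?I (rep_op \<sigma> \<mu> \<eta>) = rep_op \<pi> \<mu> (?I \<eta>)" if "\<mu> \<in> hg_measures H" "\<eta> \<in> ?W" for \<mu> \<eta>
  proof -
    have I: "?I \<eta> \<in> ?V" "U (?I \<eta>) = \<eta>"
      using bij that by (auto simp: bij_betw_def inv_into_into f_inv_into_f)
    then show ?thesis
      using bij_betw_inv_into_left[OF bij rep_closed[OF \<pi> that(1) I(1)]] U(2)[OF that(1) I(1)] by simp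
  qed
  then show ?thesis
    using hs_unitary_inverse[OF hypergroup_representation.rep_hilbert[OF \<pi>] U(1)]
    unfolding equivalent_representations_def by blast
qed

lemma equivalent_trans:
  assumes "equivalent_representations H \<pi> \<sigma>" "equivalent_representations H \<sigma> \<rho>"
  shows "equivalent_representations H \<pi> \<rho>"
proof -
  obtain U U' where U: "hs_unitary (rep_space \<pi>) (rep_space \<sigma>) U"
    "\<And>\<mu> \<xi>. \<lbrakk>\<mu> \<in> hg_measures H; \<xi> \<in> hs_set (rep_space \<pi>)\<rbrakk> \<Longrightarrow> U (rep_op \<pi> \<mu> \<xi>) = rep_op \<sigma> \<mu> (U \<xi>)"
    and U': "hs_unitary (rep_space \<sigma>) (rep_space \<rho>) U'"
    "\<And>\<mu> \<xi>. \<lbrakk>\<mu> \<in> hg_measures H; \<xi> \<in> hs_set (rep_space \<sigma>)\<rbrakk> \<Longrightarrow> U' (rep_op \<sigma> \<mu> \<xi>) = rep_op \<rho> \<mu> (U' \<xi>)"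
    using assms unfolding equivalent_representations_def by blast
  have "U \<xi> \<in> hs_set (rep_space \<sigma>)" if "\<xi> \<in> hs_set (rep_space \<pi>)" for \<xi>
    using U(1) that by (auto simp: hs_unitary_def hs_linear_def)
  then show ?thesis
    using hs_unitary_compose[OF U(1) U'(1)] U(2) U'(2)
    unfolding equivalent_representations_def by (intro exI[of _ "\<lambda>x. U' (U x)"]) simp
qed

lemma irreducible_rep: "irreducible_representation H \<pi> \<Longrightarrow> hypergroup_representation H \<pi>"
  by (simp add: irreducible_representation_def)

lemma dual_irreducible: "\<lbrakk>hypergroup_dual H R; \<pi> \<in> R\<rbrakk> \<Longrightarrow> irreducible_representation H \<pi>"
  by (simp add: hypergroup_dual_def inequivalent_irreducibles_def)

lemma dual_eqI:
  "\<lbrakk>hypergroup_dual H R; \<pi> \<in> R; \<sigma> \<in> R; equivalent_representations H \<pi> \<sigma>\<rbrakk> \<Longrightarrow> \<pi> = \<sigma>"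
  unfolding hypergroup_dual_def inequivalent_irreducibles_def by blast

text \<open>Otherwise \<open>\<sigma>\<close> could be added to \<open>R\<close>, against
  maximality.\<close>

lemma dual_member:
  assumes R: "hypergroup_dual H R" and \<sigma>: "irreducible_representation H \<sigma>"
  shows "\<exists>\<pi>\<in>R. equivalent_representations H \<sigma> \<pi>"
proof (rule ccontr)
  assume no: "\<not> ?thesis"
  have "inequivalent_irreducibles H (insert \<sigma> R)"
    unfolding inequivalent_irreducibles_def
  proof (intro conjI ballI impI)
    show "irreducible_representation H \<pi>" if "\<pi> \<in> insert \<sigma> R" for \<pi>
      using that \<sigma> dual_irreducible[OF R] by blast
    fix \<pi> \<rho> assume "\<pi> \<in> insert \<sigma> R" "\<rho> \<in> insert \<sigma> R" "\<pi> \<noteq> \<rho>"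
    then show "\<not> equivalent_representations H \<pi> \<rho>"
      using no dual_eqI[OF R] equivalent_sym[OF irreducible_rep[OF dual_irreducible[OF R]]] by blast
  qed
  then have "\<sigma> \<in> R" using R unfolding hypergroup_dual_def by blast
  then show False using no equivalent_refl by blast
qed

text \<open>The Hilbert space is kept, so lifted representations stay within the carrier type
  \<open>'h\<close>.\<close>

definition pull :: "('b cmeasure \<Rightarrow> 'a cmeasure) \<Rightarrow> ('a, 'h) hg_rep \<Rightarrow> ('b, 'h) hg_rep" where
  "pull \<phi> \<pi> = \<lparr>rep_space = rep_space \<pi>, rep_op = (\<lambda>\<mu>. rep_op \<pi> (\<phi> \<mu>))\<rparr>"

lemma pull_simps [simp]: "rep_space (pull \<phi> \<pi>) = rep_space \<pi>" "rep_op (pull \<phi> \<pi>) \<mu> = rep_op \<pi> (\<phi> \<mu>)"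
  by (simp_all add: pull_def)

text \<open>Multiplicativity and the unit are required only after \<open>\<pi>\<close> is applied:
  \<open>res\<close> is not multiplicative by itself, and \<open>emb\<close> sends the unit of
  \<open>J\<close> to the Haar measure of \<open>K\<close> instead of the unit of
  \<open>H\<close>.\<close>

lemma pull_representation:
  assumes \<pi>: "hypergroup_representation X \<pi>" and \<phi>: "measure_map (hg_top Y) (hg_top X) \<phi>"
    and mult: "\<And>\<mu> \<nu> \<xi>. \<lbrakk>\<mu> \<in> hg_measures Y; \<nu> \<in> hg_measures Y; \<xi> \<in> hs_set (rep_space \<pi>)\<rbrakk> \<Longrightarrow>
      rep_op \<pi> (\<phi> (hg_conv Y \<mu> \<nu>)) \<xi> = rep_op \<pi> (\<phi> \<mu>) (rep_op \<pi> (\<phi> \<nu>) \<xi>)"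
    and adj: "\<And>\<mu>. \<mu> \<in> hg_measures Y \<Longrightarrow> \<phi> (measure_adjoint Y \<mu>) = measure_adjoint X (\<phi> \<mu>)"
    and unit: "\<And>\<xi>. \<xi> \<in> hs_set (rep_space \<pi>) \<Longrightarrow> rep_op \<pi> (\<phi> (hg_dirac Y (hg_unit Y))) \<xi> = \<xi>"
  shows "hypergroup_representation Y (pull \<phi> \<pi>)"
proof -
  interpret hypergroup_representation X \<pi> by fact
  note b = measure_map_bounded[OF \<phi>]
  have "continuous_map (weak_topology (hg_top Y)) euclidean (\<lambda>\<mu>. hs_inner (rep_space \<pi>) (rep_op \<pi> (\<phi> \<mu>) \<xi>) \<eta>)"
    if "\<xi> \<in> hs_set (rep_space \<pi>)" "\<eta> \<in> hs_set (rep_space \<pi>)" for \<xi> \<eta>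
    using continuous_map_compose[OF _ rep_weakly_continuous[OF that]] \<phi>
    unfolding measure_map_def o_def by blast
  then show ?thesis
    by (intro hypergroup_representation.intro)
      (simp_all add: rep_hilbert rep_bounded rep_linear rep_adjoint b mult adj unit measure_map_lincomb[OF \<phi>])
qed

text \<open>Each operator of \<open>\<pi>\<close> occurs among those of the pulled back
  representation, so an invariant subspace of the latter is invariant under
  \<open>\<pi>\<close>.\<close>

lemma pull_irreducible:
  assumes \<pi>: "irreducible_representation X \<pi>" and rep: "hypergroup_representation Y (pull \<phi> \<pi>)"
    and surj: "\<And>\<mu>. \<mu> \<in> hg_measures X \<Longrightarrow>
      \<exists>\<mu>'\<in>hg_measures Y. \<forall>\<xi>\<in>hs_set (rep_space \<pi>). rep_op \<pi> (\<phi> \<mu>') \<xi> = rep_op \<pi> \<mu> \<xi>"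
  shows "irreducible_representation Y (pull \<phi> \<pi>)"
proof -
  have "S = {hs_zero (rep_space \<pi>)} \<or> S = hs_set (rep_space \<pi>)"
    if S: "hs_closed_subspace (rep_space \<pi>) S" "\<forall>\<mu>\<in>hg_measures Y. rep_op \<pi> (\<phi> \<mu>) ` S \<subseteq> S" for S
  proof -
    interpret hilbert_space "rep_space \<pi>"
      by (rule hypergroup_representation.rep_hilbert[OF irreducible_rep[OF \<pi>]])
    interpret Metric_space "hs_set (rep_space \<pi>)" "hs_dist (rep_space \<pi>)" by (rule metric)
    have SX: "S \<subseteq> hs_set (rep_space \<pi>)"
      using S(1) closedin_subset[of mtopology S] by (auto simp: hs_closed_subspace_def)
    have "rep_op \<pi> \<mu> ` S \<subseteq> S" if "\<mu> \<in> hg_measures X" for \<mu>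
      using surj[OF that] S(2) SX by fastforce
    then show ?thesis using \<pi> S(1) unfolding irreducible_representation_def by blast
  qed
  then show ?thesis
    using rep \<pi> unfolding irreducible_representation_def by simp
qed

lemma pull_equivalent:
  assumes "equivalent_representations X \<pi> \<sigma>" "\<And>\<mu>. \<mu> \<in> hg_measures Y \<Longrightarrow> \<phi> \<mu> \<in> hg_measures X"
  shows "equivalent_representations Y (pull \<phi> \<pi>) (pull \<phi> \<sigma>)"
  using assms unfolding equivalent_representations_def pull_simps by blast

lemma equivalent_cong:
  assumes "equivalent_representations X \<pi> \<sigma>" "rep_space \<pi>' = rep_space \<pi>"
    "\<And>\<mu> \<xi>. \<lbrakk>\<mu> \<in> hg_measures X; \<xi> \<in> hs_set (rep_space \<pi>)\<rbrakk> \<Longrightarrow> rep_op \<pi>' \<mu> \<xi> = rep_op \<pi> \<mu> \<xi>"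
  shows "equivalent_representations X \<pi>' \<sigma>"
  using assms unfolding equivalent_representations_def by auto

lemma equivalent_dim:
  assumes "hypergroup_representation H \<pi>" "hypergroup_representation H \<sigma>" "equivalent_representations H \<pi> \<sigma>"
  shows "rep_dim \<sigma> = rep_dim \<pi>"
  using assms hs_dim_unitary hypergroup_representation.rep_hilbert
  unfolding equivalent_representations_def by metis

text \<open>Allows triviality to be decided on any member of an equivalence class; the dual contains
  only one of them.\<close>

lemma trivial_equivalent:
  assumes \<sigma>: "hypergroup_representation H \<sigma>" and eq: "equivalent_representations H \<pi> \<sigma>"
    and triv: "trivial_representation H \<pi>"
  shows "trivial_representation H \<sigma>"
proof -
  have \<pi>: "hypergroup_representation H \<pi>" and one: "rep_dim \<pi> = 1"
    using triv by (simp_all add: trivial_representation_def)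
  obtain U where U: "hs_unitary (rep_space \<pi>) (rep_space \<sigma>) U"
    "\<And>\<mu> \<xi>. \<lbrakk>\<mu> \<in> hg_measures H; \<xi> \<in> hs_set (rep_space \<pi>)\<rbrakk> \<Longrightarrow> U (rep_op \<pi> \<mu> \<xi>) = rep_op \<sigma> \<mu> (U \<xi>)"
    using eq unfolding equivalent_representations_def by blast
  have "rep_op \<sigma> \<mu> \<eta> = hs_scale (rep_space \<sigma>) (\<mu> (hg_set H)) \<eta>"
    if \<mu>: "\<mu> \<in> hg_measures H" and \<eta>: "\<eta> \<in> hs_set (rep_space \<sigma>)" for \<mu> \<eta>
  proof -
    have "\<eta> \<in> U ` hs_set (rep_space \<pi>)" using U(1) \<eta> by (simp add: hs_unitary_def bij_betw_def)
    then obtain \<xi> where \<xi>: "\<xi> \<in> hs_set (rep_space \<pi>)" "\<eta> = U \<xi>" by blast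
    have "rep_op \<sigma> \<mu> \<eta> = U (hs_scale (rep_space \<pi>) (\<mu> (hg_set H)) \<xi>)"
      using U(2)[OF \<mu> \<xi>(1)] \<xi> triv \<mu> by (simp add: trivial_representation_def)
    then show ?thesis using U(1) \<xi> by (simp add: hs_unitary_def hs_linear_def)
  qed
  then show ?thesis
    using \<sigma> equivalent_dim[OF \<pi> \<sigma> eq] one by (simp add: trivial_representation_def)
qed

subsection \<open>Central idempotents and the trivial representation\<close>

text \<open>The fixed vectors of the operator of \<open>e\<close> form a closed subspace. It is
  invariant because \<open>e\<close> is central and contains the range because \<open>e\<close> is
  idempotent; irreducibility makes it zero or everything.\<close>

lemma central_idempotent_dichotomy:
  assumes \<pi>: "irreducible_representation H \<pi>" and e: "e \<in> hg_measures H" "hg_conv H e e = e"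
    and central: "\<And>\<mu>. \<mu> \<in> hg_measures H \<Longrightarrow> hg_conv H e \<mu> = hg_conv H \<mu> e"
  shows "(\<forall>\<xi>\<in>hs_set (rep_space \<pi>). rep_op \<pi> e \<xi> = \<xi>) \<or>
    (\<forall>\<xi>\<in>hs_set (rep_space \<pi>). rep_op \<pi> e \<xi> = hs_zero (rep_space \<pi>))"
proof -
  interpret hypergroup_representation H \<pi> using \<pi> by (rule irreducible_rep)
  interpret hilbert_space "rep_space \<pi>" by (rule rep_hilbert)
  let ?S = "{\<xi> \<in> X. rep_op \<pi> e \<xi> = \<xi>}"
  note closed = rep_closed[OF irreducible_rep[OF \<pi>]]
  have "rep_op \<pi> e (rep_op \<pi> \<mu> \<xi>) = rep_op \<pi> \<mu> \<xi>" if "\<mu> \<in> hg_measures H" "\<xi> \<in> ?S" for \<mu> \<xi>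
    using rep_mult[OF e(1) that(1), of \<xi>] rep_mult[OF that(1) e(1), of \<xi>] that central by simp
  then have "\<forall>\<mu>\<in>hg_measures H. rep_op \<pi> \<mu> ` ?S \<subseteq> ?S" using closed by auto
  moreover have "hs_closed_subspace (rep_space \<pi>) ?S" by (rule fixed_points_closed[OF rep_bounded[OF e(1)]])
  ultimately have "?S = {vzero} \<or> ?S = X" using \<pi> unfolding irreducible_representation_def by blast
  moreover have "rep_op \<pi> e \<xi> \<in> ?S" if "\<xi> \<in> X" for \<xi>
    using rep_mult[OF e(1) e(1) that] e closed[OF e(1) that] by simp
  ultimately show ?thesis by blast
qed

context compact_hypergroup
begin

text \<open>\<open>\<mu>\<close> may be replaced by its product with \<open>\<eta>\<close>, which is
  a multiple of \<open>\<eta>\<close>.\<close>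

lemma rep_left_invariant_identity:
  assumes \<pi>: "hypergroup_representation H \<pi>" and \<eta>: "left_invariant \<eta>"
    and id: "\<And>\<xi>. \<xi> \<in> hs_set (rep_space \<pi>) \<Longrightarrow> rep_op \<pi> \<eta> \<xi> = \<xi>"
    and \<mu>: "\<mu> \<in> bounded_measures T" and \<xi>: "\<xi> \<in> hs_set (rep_space \<pi>)"
  shows "rep_op \<pi> \<mu> \<xi> = hs_scale (rep_space \<pi>) (\<mu> (topspace T)) \<xi>"
proof -
  interpret hypergroup_representation H \<pi> by fact
  have \<eta>b: "\<eta> \<in> bounded_measures T" using left_invariant_positive[OF \<eta>] by auto
  have "rep_op \<pi> \<mu> \<xi> = rep_op \<pi> (conv \<mu> \<eta>) \<xi>" using rep_mult[OF \<mu> \<eta>b \<xi>] id[OF \<xi>] by simp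
  also have "\<dots> = hs_scale (rep_space \<pi>) (\<mu> (topspace T)) \<xi>"
    using conv_left_invariant[OF \<eta> \<mu>] rep_scale_measure[OF \<pi> \<eta>b \<xi>] id[OF \<xi>] by simp
  finally show ?thesis .
qed

text \<open>If \<open>\<eta>\<close> acts as the identity, every measure acts as a scalar. Then
  every closed subspace is invariant, so an irreducible space is a line.\<close>

lemma trivial_representation_iff:
  assumes \<pi>: "irreducible_representation H \<pi>" and \<eta>: "left_invariant \<eta>"
  shows "trivial_representation H \<pi> \<longleftrightarrow> (\<forall>\<xi>\<in>hs_set (rep_space \<pi>). rep_op \<pi> \<eta> \<xi> = \<xi>)"
proof
  interpret hilbert_space "rep_space \<pi>"
    by (rule hypergroup_representation.rep_hilbert[OF irreducible_rep[OF \<pi>]])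
  have \<eta>b: "\<eta> \<in> bounded_measures T" using left_invariant_positive[OF \<eta>] by auto
  {
    assume "trivial_representation H \<pi>"
    then show "\<forall>\<xi>\<in>X. rep_op \<pi> \<eta> \<xi> = \<xi>"
      using \<eta>b left_invariant_mass[OF \<eta>] scale_one unfolding trivial_representation_def by simp
  }
  assume "\<forall>\<xi>\<in>X. rep_op \<pi> \<eta> \<xi> = \<xi>"
  then have scalar: "rep_op \<pi> \<mu> \<xi> = smul (\<mu> (topspace T)) \<xi>" if "\<mu> \<in> bounded_measures T" "\<xi> \<in> X" for \<mu> \<xi>
    using rep_left_invariant_identity[OF irreducible_rep[OF \<pi>] \<eta>] that by blast
  obtain x where "x \<in> X" "x \<noteq> vzero" using \<pi> zero_closed unfolding irreducible_representation_def by blast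
  then obtain u where u: "u \<in> X" "ip u u = 1" using normalize by blast
  \<comment> \<open>Orthogonal projection onto the line of \<open>u\<close>; as its fixed space the
    line is closed by \<open>fixed_points_closed\<close>.\<close>
  define Q where "Q y = smul (ip y u) u" for y
  have Qb: "hs_bounded_operator (rep_space \<pi>) Q"
    unfolding hs_bounded_operator_def
  proof
    show "hs_linear (rep_space \<pi>) (rep_space \<pi>) Q"
      using u by (auto simp: hs_linear_def Q_def inner_simps scale_add_left scale_scale)
    have "hs_norm (rep_space \<pi>) (Q y) \<le> 1 * hs_norm (rep_space \<pi>) y" if "y \<in> X" for y
    proof -
      have nu: "hs_norm (rep_space \<pi>) u = 1" using u by (simp add: hs_norm_def)
      have "ip (Q y) (Q y) = of_real ((cmod (ip y u))\<^sup>2)"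
        using u complex_norm_square[of "ip y u"] by (simp add: Q_def inner_simps mult.commute)
      then have "hs_norm (rep_space \<pi>) (Q y) = cmod (ip y u)" by (simp add: hs_norm_def)
      also have "\<dots> \<le> hs_norm (rep_space \<pi>) y" using Cauchy_Schwarz[OF that u(1)] nu by simp
      finally show ?thesis by simp
    qed
    then show "\<exists>c. \<forall>x\<in>X. hs_norm (rep_space \<pi>) (Q x) \<le> c * hs_norm (rep_space \<pi>) x" by blast
  qed
  let ?S = "{y \<in> X. Q y = y}"
  have "\<forall>\<mu>\<in>hg_measures H. rep_op \<pi> \<mu> ` ?S \<subseteq> ?S"
  proof (intro ballI image_subsetI)
    fix \<mu> y assume "\<mu> \<in> hg_measures H" and y: "y \<in> ?S"
    then have "rep_op \<pi> \<mu> y = smul (\<mu> (topspace T)) y" using scalar by simp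
    moreover have "Q (smul a y) = smul a (Q y)" "smul a y \<in> X" for a
      using Qb y by (auto simp: hs_bounded_operator_def hs_linear_def scale_closed)
    ultimately show "rep_op \<pi> \<mu> y \<in> ?S" using y by simp
  qed
  then have "?S = {vzero} \<or> ?S = X"
    using \<pi> fixed_points_closed[OF Qb] unfolding irreducible_representation_def by blast
  moreover have "u \<in> ?S" "u \<noteq> vzero"
    using u inner_zero_left[OF u(1)] by (auto simp: Q_def scale_one)
  ultimately have S: "?S = X" by blast
  have "orthonormal_basis (rep_space \<pi>) {u}"
    unfolding orthonormal_basis_def
  proof (intro conjI ballI impI)
    fix y assume "y \<in> X" "\<forall>u\<in>{u}. ip y u = 0"
    moreover from this have "Q y = y" using S by blast
    ultimately show "y = vzero" using scale_zero[OF u(1)] by (simp add: Q_def)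
  qed (use u in auto)
  then have "rep_dim \<pi> = 1" using hs_dim_eq by fastforce
  then show "trivial_representation H \<pi>"
    using irreducible_rep[OF \<pi>] scalar unfolding trivial_representation_def by blast
qed

text \<open>\<open>\<eta>\<close> is a central idempotent, so it acts as 1 or 0, and 1 is the
  trivial case.\<close>

lemma nontrivial_representation_iff:
  assumes \<pi>: "irreducible_representation H \<pi>" and \<eta>: "left_invariant \<eta>"
  shows "\<not> trivial_representation H \<pi> \<longleftrightarrow>
    (\<forall>\<xi>\<in>hs_set (rep_space \<pi>). rep_op \<pi> \<eta> \<xi> = hs_zero (rep_space \<pi>))"
proof -
  interpret hilbert_space "rep_space \<pi>"
    by (rule hypergroup_representation.rep_hilbert[OF irreducible_rep[OF \<pi>]])
  have \<eta>b: "\<eta> \<in> bounded_measures T" using left_invariant_positive[OF \<eta>] by auto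
  have "(\<forall>\<xi>\<in>X. rep_op \<pi> \<eta> \<xi> = \<xi>) \<or> (\<forall>\<xi>\<in>X. rep_op \<pi> \<eta> \<xi> = vzero)"
    using conv_left_invariant[OF \<eta>] left_invariant_conv[OF \<eta>] left_invariant_mass[OF \<eta>] \<eta>b
    by (intro central_idempotent_dichotomy[OF \<pi>]) auto
  moreover obtain x where "x \<in> X" "x \<noteq> vzero"
    using \<pi> zero_closed unfolding irreducible_representation_def by blast
  ultimately show ?thesis
    unfolding trivial_representation_iff[OF assms] by metis
qed

end

subsection \<open>Hyperdimensions\<close>

text \<open>A unitary intertwiner carries orthonormal bases to orthonormal bases and matches the
  coefficient functions.\<close>

lemma has_hyperdim_equivalent:
  assumes \<sigma>: "hypergroup_representation H \<sigma>" and \<pi>: "hypergroup_representation H \<pi>"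
    and eq: "equivalent_representations H \<sigma> \<pi>"
    and H: "space (the_normalized_haar H) = hg_set H"
      "\<And>x. x \<in> hg_set H \<Longrightarrow> hg_dirac H x \<in> hg_measures H"
    and k: "has_hyperdim H \<pi> k"
  shows "has_hyperdim H \<sigma> k"
  unfolding has_hyperdim_def
proof (intro conjI allI impI ballI)
  let ?V = "rep_space \<sigma>"
  obtain U where U: "hs_unitary (rep_space \<sigma>) (rep_space \<pi>) U"
    "\<And>\<mu> \<xi>. \<lbrakk>\<mu> \<in> hg_measures H; \<xi> \<in> hs_set ?V\<rbrakk> \<Longrightarrow> U (rep_op \<sigma> \<mu> \<xi>) = rep_op \<pi> \<mu> (U \<xi>)"
    using eq unfolding equivalent_representations_def by blast
  show "k > 0" using k by (simp add: has_hyperdim_def)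
  fix B i j k' l assume B: "orthonormal_basis ?V B" and ij: "i \<in> B" "j \<in> B" "k' \<in> B" "l \<in> B"
  have BV: "B \<subseteq> hs_set ?V" using B by (simp add: orthonormal_basis_def)
  have coeff: "rep_coeff H \<sigma> u v x = rep_coeff H \<pi> (U u) (U v) x" if "u \<in> B" "v \<in> B" "x \<in> hg_set H" for u v x
  proof -
    have "rep_op \<sigma> (hg_dirac H x) v \<in> hs_set ?V"
      using rep_closed[OF \<sigma> H(2)[OF that(3)]] that BV by blast
    then show ?thesis
      using U(1) U(2)[OF H(2)[OF that(3)], of v] that BV
      unfolding rep_coeff_def hs_unitary_def by (metis subsetD)
  qed
  have "(\<integral>x. rep_coeff H \<sigma> i j x * cnj (rep_coeff H \<sigma> k' l x) \<partial>the_normalized_haar H) =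
      (\<integral>x. rep_coeff H \<pi> (U i) (U j) x * cnj (rep_coeff H \<pi> (U k') (U l) x) \<partial>the_normalized_haar H)"
    using H(1) by (intro Bochner_Integration.integral_cong) (simp_all add: coeff ij)
  also have "\<dots> = (if U i = U k' \<and> U j = U l then complex_of_real (1 / k) else 0)"
    using k hs_unitary_onb[OF hypergroup_representation.rep_hilbert[OF \<sigma>]
        hypergroup_representation.rep_hilbert[OF \<pi>] U(1) B] ij
    unfolding has_hyperdim_def by blast
  also have "(U i = U k' \<and> U j = U l) = (i = k' \<and> j = l)"
    using U(1) ij BV unfolding hs_unitary_def bij_betw_def inj_on_def by blast
  finally show "(\<integral>x. rep_coeff H \<sigma> i j x * cnj (rep_coeff H \<sigma> k' l x) \<partial>the_normalized_haar H) =
      (if i = k' \<and> j = l then complex_of_real (1 / k) else 0)" .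
qed

lemma hyperdim_equivalent:
  assumes "hypergroup_representation H \<sigma>" "hypergroup_representation H \<pi>"
    "equivalent_representations H \<sigma> \<pi>" "space (the_normalized_haar H) = hg_set H"
    "\<And>x. x \<in> hg_set H \<Longrightarrow> hg_dirac H x \<in> hg_measures H"
  shows "hyperdim H \<sigma> = hyperdim H \<pi>"
proof -
  have "has_hyperdim H \<sigma> = has_hyperdim H \<pi>"
    using has_hyperdim_equivalent[OF assms(1,2,3,4,5)]
      has_hyperdim_equivalent[OF assms(2,1) equivalent_sym[OF assms(1,3)] assms(4,5)] by blast
  then show ?thesis by (simp add: hyperdim_def)
qed

text \<open>A single diagonal integral yields \<open>1 / k\<close>, and a nonzero space has a basis
  vector to form it.\<close>

lemma has_hyperdim_unique:
  assumes \<pi>: "irreducible_representation H \<pi>" and k: "has_hyperdim H \<pi> k" "has_hyperdim H \<pi> k'"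
  shows "k = k'"
proof -
  interpret hilbert_space "rep_space \<pi>"
    by (rule hypergroup_representation.rep_hilbert[OF irreducible_rep[OF \<pi>]])
  obtain B where B: "orthonormal_basis (rep_space \<pi>) B" using orthonormal_basis_exists by blast
  have "B \<noteq> {}"
    using B \<pi> zero_closed unfolding orthonormal_basis_def irreducible_representation_def by blast
  then obtain b where "b \<in> B" by blast
  then have "complex_of_real (1 / k) = complex_of_real (1 / k')"
    using k B unfolding has_hyperdim_def by metis
  then show ?thesis by (simp add: divide_simps split: if_splits)
qed

text \<open>If neither side has a hyperdimension, both take the default 0, which respects the factor
  \<open>c\<close>.\<close>

lemma hyperdim_scale:
  assumes \<pi>: "irreducible_representation H \<pi>" and \<sigma>: "irreducible_representation K \<sigma>" and c: "c > 0"
    and iff: "\<And>k. has_hyperdim H \<pi> (k * c) \<longleftrightarrow> has_hyperdim K \<sigma> k"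
  shows "hyperdim H \<pi> = hyperdim K \<sigma> * c"
proof (cases "\<exists>k. has_hyperdim K \<sigma> k")
  case True
  then obtain k where k: "has_hyperdim K \<sigma> k" by blast
  then have k': "has_hyperdim H \<pi> (k * c)" using iff by blast
  have "(THE k. has_hyperdim K \<sigma> k) = k" "(THE k. has_hyperdim H \<pi> k) = k * c"
    using k k' has_hyperdim_unique[OF \<pi>] has_hyperdim_unique[OF \<sigma>] by blast+
  then show ?thesis using k k' unfolding hyperdim_def by auto
next
  case False
  then have "\<not> has_hyperdim H \<pi> k" for k using iff[of "k / c"] c by auto
  then show ?thesis using False by (simp add: hyperdim_def)
qed

section \<open>The join with a finite hypergroup\<close>

lemma dirac_inject:
  assumes "Hausdorff_space T" "x \<in> topspace T" "dirac T x = dirac T y"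
  shows "y = x"
proof -
  have "{x} \<in> sets (borel_of T)"
    using assms by (intro closedin_borel) (simp add: Hausdorff_imp_t1_space closedin_t1_singleton)
  then have "dirac T x {x} = 1" by (simp add: dirac_def)
  then have "dirac T y {x} = 1" using assms(3) by simp
  then show ?thesis by (auto simp: dirac_def split: if_splits)
qed

lemma extend_measure_eq_push: "extend_measure H S = push (hg_top S) (hg_top H) (\<lambda>x. x)"
  by (simp add: fun_eq_iff extend_measure_def push_def)

text \<open>The adjoint is conjugate-linear, hence no measure map. It is split into the flip, for
  which point masses suffice, and complex conjugation of values, which is checked directly for each
  map.\<close>

lemma measure_adjoint_commute:
  assumes X: "compact_hypergroup X" and Y: "compact_hypergroup Y"
    and \<phi>: "measure_map (hg_top Y) (hg_top X) \<phi>"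
    and cnj: "\<And>\<mu>. \<mu> \<in> hg_measures Y \<Longrightarrow> \<phi> (\<lambda>A. cnj (\<mu> A)) = (\<lambda>A. cnj (\<phi> \<mu> A))"
    and flip: "\<And>x. x \<in> hg_set Y \<Longrightarrow> \<phi> (hg_dirac Y (hg_inv Y x)) = measure_flip X (\<phi> (hg_dirac Y x))"
    and \<mu>: "\<mu> \<in> hg_measures Y"
  shows "\<phi> (measure_adjoint Y \<mu>) = measure_adjoint X (\<phi> \<mu>)"
proof -
  interpret X: compact_hypergroup X by fact
  interpret Y: compact_hypergroup Y by fact
  have "\<phi> (measure_flip Y \<mu>) = measure_flip X (\<phi> \<mu>)"
    by (rule measure_map_eqI[OF Y.compact Y.Hausdorff X.compact X.Hausdorff
          measure_map_compose[OF Y.flip_map \<phi>] measure_map_compose[OF \<phi> X.flip_map] _ \<mu>])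
      (simp add: Y.flip_dirac flip)
  then show ?thesis
    using cnj[OF measure_map_bounded[OF Y.flip_map \<mu>]] by (simp add: measure_adjoint_def)
qed

context compact_hypergroup
begin

text \<open>The point mass at the inverse of the unit is flipped in two ways: directly, which gives
  the unit, and as its own product with the unit, which by \<open>inv_conv\<close> reproduces
  it.\<close>

lemma inv_unit: "hg_inv H (hg_unit H) = hg_unit H"
proof -
  let ?e = "hg_unit H"
  have i: "hg_inv H ?e \<in> topspace T" by (rule inv_in[OF unit_closed])
  have "dirac T ?e = measure_flip H (dirac T (hg_inv H ?e))"
    using flip_dirac[OF i] inv_involutive[OF unit_closed] by simp
  also have "\<dots> = measure_flip H (conv (dirac T ?e) (dirac T (hg_inv H ?e)))" by (simp add: unit_left[OF i])
  also have "\<dots> = dirac T (hg_inv H ?e)"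
    using inv_conv[OF unit_closed i] inv_involutive[OF unit_closed] by (simp add: unit_left[OF i])
  finally show ?thesis by (intro dirac_inject[OF Hausdorff unit_closed])
qed

lemma rep_coeff_continuous:
  assumes "hypergroup_representation H \<pi>" "u \<in> hs_set (rep_space \<pi>)" "v \<in> hs_set (rep_space \<pi>)"
  shows "continuous_map T euclidean (rep_coeff H \<pi> u v)"
  using continuous_map_compose[OF continuous_map_dirac[OF compact Hausdorff]
      hypergroup_representation.rep_weakly_continuous[OF assms(1,3,2)]]
  by (simp add: o_def rep_coeff_def[abs_def])

text \<open>A point off the support has a neighbourhood of zero variation, hence no mass. In
  \<open>J\<close> it follows that a product of points that are not inverse to each other is
  unaffected by replacing the unit with the Haar measure of \<open>K\<close>.\<close>

lemma conv_unit_dirac_zero: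
  assumes "x \<in> topspace T" "y \<in> topspace T" "y \<noteq> hg_inv H x"
  shows "conv (dirac T x) (dirac T y) {hg_unit H} = 0"
proof -
  let ?\<mu> = "conv (dirac T x) (dirac T y)"
  have \<mu>: "?\<mu> \<in> bounded_measures T" using assms by (intro conv_closed dirac_bounded)
  have "hg_unit H \<notin> msupport T ?\<mu>" using unit_in_support_iff[OF assms(1,2)] assms(3) by simp
  then obtain U where U: "openin T U" "hg_unit H \<in> U" "\<not> total_variation T ?\<mu> U > 0"
    using unit_closed unfolding msupport_def by auto
  have "{hg_unit H} \<in> sets (borel_of T)"
    using unit_closed Hausdorff by (intro closedin_borel) (simp add: Hausdorff_imp_t1_space closedin_t1_singleton)
  from cmod_le_total_variation[OF \<mu> this, of U] U(2)
  have "cmod (?\<mu> {hg_unit H}) \<le> total_variation T ?\<mu> U" by simp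
  then have "cmod (?\<mu> {hg_unit H}) \<le> 0" using U(3) by linarith
  then show ?thesis by simp
qed

end

locale finite_join =
  fixes K J H :: "'a hypergroup" and lamK :: "'a measure"
  assumes join: "hypergroup_join K J lamK H" and finite_J: "finite (hg_set J)"
begin

lemmas join' = join[unfolded hypergroup_join_def Let_def]

abbreviation "e \<equiv> hg_unit K"
abbreviation "TK \<equiv> hg_top K"
abbreviation "TJ \<equiv> hg_top J"
abbreviation "TH \<equiv> hg_top H"
abbreviation "J' \<equiv> topspace TJ - {e}"

lemma hypergroups: "hypergroup K" "hypergroup J" "hypergroup H" "compact_space TK"
  using join' by blast+

lemma topology:
  "TJ = discrete_topology (topspace TJ)" "hg_unit J = e" "topspace TK \<inter> topspace TJ = {e}"
  "topspace TH = topspace TK \<union> topspace TJ" "closedin TH (topspace TK)"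
  "subtopology TH (topspace TK) = TK" "hg_unit H = e"
  using join' by blast+

lemma inverse:
  "s \<in> topspace TK \<Longrightarrow> hg_inv H s = hg_inv K s" "s \<in> topspace TJ \<Longrightarrow> hg_inv H s = hg_inv J s"
  using join' by blast+

lemma e_in: "e \<in> topspace TK" "e \<in> topspace TJ" "e \<in> topspace TH"
  using topology by auto

lemma topspace_H: "topspace TH = topspace TK \<union> J'" "topspace TK \<inter> J' = {}"
  using topology by auto

lemma Hausdorff_H: "Hausdorff_space TH" by (rule hypergroup.Hausdorff[OF hypergroups(3)])

lemma closed_finite: "S \<subseteq> J' \<Longrightarrow> closedin TH S"
  using Hausdorff_H topspace_H(1) finite_J
  by (intro closedin_Hausdorff_finite) (auto intro: finite_subset[of S "topspace TJ"])

lemma open_J': "S \<subseteq> J' \<Longrightarrow> openin TH S"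
proof -
  assume S: "S \<subseteq> J'"
  have "openin TH J'"
    using topology(5) topspace_H unfolding closedin_def by (metis Diff_cancel Diff_triv Int_commute Un_Diff Un_empty_left)
  then have "openin TH (J' - (J' - S))" by (rule openin_diff[OF _ closed_finite]) blast
  moreover have "J' - (J' - S) = S" using S by auto
  ultimately show ?thesis by simp
qed

text \<open>The finitely many points of \<open>J'\<close> form a closed set. So \<open>K\<close> is
  open as well as closed, and the retractions onto the factors are continuous.\<close>

lemma open_K: "openin TH (topspace TK)"
proof -
  have "openin TH (topspace TH - J')" using closed_finite[of J'] by auto
  moreover have "topspace TH - J' = topspace TK" using topspace_H by auto
  ultimately show ?thesis by simp
qed

lemma compact_H: "compact_space TH"
proof -
  have "compactin TH (topspace TK)"
    using hypergroups(4) compactin_subtopology[of TH "topspace TK" "topspace TK"]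
    unfolding topology(6) compact_space_def by simp
  moreover have "compactin TH (topspace TJ)"
    using finite_J topology(4) by (intro finite_imp_compactin) auto
  ultimately show ?thesis
    unfolding compact_space_def topology(4) by (rule compactin_Un)
qed

lemma compact_J: "compact_space TJ"
  using finite_J unfolding compact_space_def by (intro finite_imp_compactin) auto

end

sublocale finite_join \<subseteq> K: compact_hypergroup K
  by (intro compact_hypergroup.intro compact_hypergroup_axioms.intro hypergroups)

sublocale finite_join \<subseteq> J: compact_hypergroup J
  by (intro compact_hypergroup.intro compact_hypergroup_axioms.intro hypergroups compact_J)

sublocale finite_join \<subseteq> H: compact_hypergroup H
  by (intro compact_hypergroup.intro compact_hypergroup_axioms.intro hypergroups compact_H)

context finite_join
begin

text \<open>Retractions of \<open>H\<close> onto its factors. Collapsing \<open>K\<close>, as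
  \<open>rJ\<close> does, is the quotient by the subhypergroup \<open>K\<close>; \<open>rK\<close>
  serves to show that restrictions of measures to \<open>K\<close> are regular.\<close>

definition rK :: "'a \<Rightarrow> 'a" where "rK x = (if x \<in> topspace TK then x else e)"
definition rJ :: "'a \<Rightarrow> 'a" where "rJ x = (if x \<in> topspace TK then e else x)"

lemma continuous_incl: "continuous_map TK TH (\<lambda>x. x)"
proof -
  have "continuous_map (subtopology TH (topspace TK)) TH (\<lambda>x. x)"
    by (rule continuous_map_from_subtopology) simp
  then show ?thesis by (simp only: topology(6))
qed

lemma continuous_rK: "continuous_map TH TK rK"
  unfolding continuous_map_def
proof (intro conjI allI impI)
  show "rK \<in> topspace TH \<rightarrow> topspace TK" using e_in by (auto simp: rK_def)
  fix U assume U: "openin TK U"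
  then have "openin TH U" using open_K topology(6) by (metis openin_open_subtopology)
  moreover have "{x \<in> topspace TH. rK x \<in> U} = U \<union> (if e \<in> U then J' else {})"
    using openin_subset[OF U] topspace_H by (auto simp: rK_def)
  ultimately show "openin TH {x \<in> topspace TH. rK x \<in> U}"
    using open_J'[of J'] by auto
qed

lemma continuous_rJ: "continuous_map TH TJ rJ"
  unfolding continuous_map_def
proof (intro conjI allI impI)
  show "rJ \<in> topspace TH \<rightarrow> topspace TJ" using e_in topspace_H by (auto simp: rJ_def)
  fix U assume U: "openin TJ U"
  have "{x \<in> topspace TH. rJ x \<in> U} = (if e \<in> U then topspace TK else {}) \<union> (U \<inter> J')"
    using openin_subset[OF U] topspace_H by (auto simp: rJ_def)
  then show "openin TH {x \<in> topspace TH. rJ x \<in> U}"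
    using open_J'[of "U \<inter> J'"] open_K by auto
qed

lemma rJ_simps [simp]: "x \<in> topspace TK \<Longrightarrow> rJ x = e" "x \<in> J' \<Longrightarrow> rJ x = x"
  using topspace_H(2) by (auto simp: rJ_def)

section \<open>Transfer of measures among \<open>K\<close>, \<open>H\<close> and
  \<open>J\<close>\<close>

definition ext :: "'a cmeasure \<Rightarrow> 'a cmeasure" where "ext = push TK TH (\<lambda>x. x)"
definition quot :: "'a cmeasure \<Rightarrow> 'a cmeasure" where "quot = push TH TJ rJ"
text \<open>Discards the mass on \<open>J'\<close>, unlike the image measure under
  \<open>rK\<close>, which moves it to the unit.\<close>

definition res :: "'a cmeasure \<Rightarrow> 'a cmeasure" where
  "res \<mu> = (\<lambda>A. if A \<in> sets (borel_of TK) then \<mu> A else 0)"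

lemma ext_map: "measure_map TK TH ext"
  unfolding ext_def by (rule measure_map_push[OF K.compact compact_H Hausdorff_H continuous_incl])

lemma quot_map: "measure_map TH TJ quot"
  unfolding quot_def by (rule measure_map_push[OF compact_H compact_J J.Hausdorff continuous_rJ])

lemma ext_dirac: "x \<in> topspace TK \<Longrightarrow> ext (dirac TK x) = dirac TH x"
  unfolding ext_def by (rule push_dirac[OF continuous_incl])

lemma quot_dirac: "x \<in> topspace TH \<Longrightarrow> quot (dirac TH x) = dirac TJ (rJ x)"
  unfolding quot_def by (rule push_dirac[OF continuous_rJ])

lemma borel_J: "A \<in> sets (borel_of TJ) \<longleftrightarrow> A \<subseteq> topspace TJ"
proof
  assume "A \<subseteq> topspace TJ"
  then have "openin TJ A" using topology(1) by (metis openin_discrete_topology)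
  then show "A \<in> sets (borel_of TJ)" by auto
qed (rule borel_of_subset)

text \<open>The preimage of \<open>A\<close> under \<open>rK\<close> meets the open set
  \<open>K\<close> exactly in \<open>A\<close>.\<close>

lemma borel_K_H: "A \<in> sets (borel_of TK) \<Longrightarrow> A \<in> sets (borel_of TH)"
proof -
  assume A: "A \<in> sets (borel_of TK)"
  have "(rK -` A \<inter> topspace TH) \<inter> topspace TK \<in> sets (borel_of TH)"
    using borel_vimage[OF continuous_rK A] open_K by auto
  moreover have "(rK -` A \<inter> topspace TH) \<inter> topspace TK = A"
    using borel_of_subset[OF A] topspace_H by (auto simp: rK_def)
  ultimately show ?thesis by simp
qed

lemma borel_H_K: "A \<in> sets (borel_of TH) \<Longrightarrow> A \<inter> topspace TK \<in> sets (borel_of TK)"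
  using borel_vimage[OF continuous_incl, of A] by simp

lemma ext_apply: "A \<in> sets (borel_of TH) \<Longrightarrow> ext a A = a (A \<inter> topspace TK)"
  by (simp add: ext_def push_def)

lemma borel_J': "S \<subseteq> J' \<Longrightarrow> S \<in> sets (borel_of TH)"
  using open_J' by blast

lemma sum_J':
  assumes "\<mu> \<in> bounded_measures TH" "S \<subseteq> J'"
  shows "\<mu> S = (\<Sum>t\<in>S. \<mu> {t})"
proof -
  have "finite S" using assms(2) finite_J finite_subset by blast
  moreover have "{t} \<in> sets (borel_of TH)" if "t \<in> S" for t
    using that assms(2) by (intro borel_J') auto
  ultimately have "\<mu> (\<Union>t\<in>S. {t}) = (\<Sum>t\<in>S. \<mu> {t})"
    by (intro bounded_measures_UNION[OF assms(1)]) (auto simp: disjoint_family_on_def)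
  then show ?thesis by simp
qed

text \<open>\<open>K\<close> is Borel and its complement \<open>J'\<close> is finite, so that the
  part on \<open>J'\<close> is a sum of atoms.\<close>

lemma decompose_H:
  assumes \<mu>: "\<mu> \<in> bounded_measures TH"
  shows "\<mu> = (\<lambda>A. ext (res \<mu>) A + (\<Sum>t\<in>J'. \<mu> {t} * dirac TH t A))"
proof
  fix A
  show "\<mu> A = ext (res \<mu>) A + (\<Sum>t\<in>J'. \<mu> {t} * dirac TH t A)"
  proof (cases "A \<in> sets (borel_of TH)")
    case True
    have "\<mu> (A \<inter> topspace TK \<union> A \<inter> J') = \<mu> (A \<inter> topspace TK) + \<mu> (A \<inter> J')"
      using True open_K topspace_H(2) borel_J'[of "A \<inter> J'"] by (intro bounded_measures_Un[OF \<mu>]) auto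
    moreover have "A \<inter> topspace TK \<union> A \<inter> J' = A" using borel_of_subset[OF True] topspace_H by auto
    moreover have "\<mu> (A \<inter> J') = (\<Sum>t\<in>A \<inter> J'. \<mu> {t})" by (rule sum_J'[OF \<mu>]) auto
    moreover have "(\<Sum>t\<in>A \<inter> J'. \<mu> {t}) = (\<Sum>t\<in>J'. \<mu> {t} * dirac TH t A)"
      using finite_J True by (intro sum.mono_neutral_cong_left) (auto simp: dirac_def)
    ultimately show ?thesis by (simp add: ext_apply[OF True] res_def borel_H_K[OF True])
  qed (simp add: bounded_measures_null[OF \<mu>] ext_def push_def dirac_def)
qed

text \<open>Subtracting the mass that \<open>rK\<close> moved to the unit reduces the regularity of
  restrictions to \<open>push_bounded\<close>.\<close>

lemma res_eq_push:
  assumes \<mu>: "\<mu> \<in> bounded_measures TH"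
  shows "res \<mu> = (\<lambda>A. 1 * push TH TK rK \<mu> A + (- \<mu> J') * dirac TK e A)"
proof
  fix A
  show "res \<mu> A = 1 * push TH TK rK \<mu> A + (- \<mu> J') * dirac TK e A"
  proof (cases "A \<in> sets (borel_of TK)")
    case True
    have v: "rK -` A \<inter> topspace TH = A \<union> (if e \<in> A then J' else {})"
      using borel_of_subset[OF True] topspace_H by (auto simp: rK_def split: if_splits)
    have "\<mu> (A \<union> J') = \<mu> A + \<mu> J'"
      using borel_of_subset[OF True] topspace_H(2)
      by (intro bounded_measures_Un[OF \<mu> borel_K_H[OF True] borel_J']) auto
    then show ?thesis using True by (simp add: res_def push_def v dirac_def)
  qed (simp add: res_def push_def dirac_def)
qed

lemma res_bounded: "\<mu> \<in> bounded_measures TH \<Longrightarrow> res \<mu> \<in> bounded_measures TK"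
  unfolding res_eq_push
  by (intro bounded_measures_lincomb push_bounded[OF compact_H K.Hausdorff continuous_rK] K.dirac_bounded e_in)

lemma res_ext: "a \<in> bounded_measures TK \<Longrightarrow> res (ext a) = a"
  using borel_of_subset[of _ TK] borel_K_H bounded_measures_null[of a TK]
  by (auto simp: res_def ext_apply fun_eq_iff Int_absorb2)

lemma res_dirac: "x \<in> topspace TK \<Longrightarrow> res (dirac TH x) = dirac TK x" "x \<in> J' \<Longrightarrow> res (dirac TH x) = (\<lambda>A. 0)"
  using borel_K_H borel_of_subset[of _ TK] topspace_H(2) by (auto simp: res_def dirac_def fun_eq_iff)

lemma cintegral_decompose:
  assumes \<mu>: "\<mu> \<in> positive_measures TH" and f: "continuous_map TH euclidean f"
  shows "cintegral TH \<mu> f = cintegral TK (res \<mu>) f + (\<Sum>t\<in>J'. \<mu> {t} * f t)"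
proof -
  have \<mu>b: "\<mu> \<in> bounded_measures TH" using \<mu> by auto
  have r: "res \<mu> \<in> positive_measures TK"
    using res_bounded[OF \<mu>b] positive_measures_nonneg[OF \<mu>] by (simp add: positive_measures_def res_def)
  have er: "ext (res \<mu>) \<in> positive_measures TH" by (rule measure_map_positive[OF ext_map r])
  have d: "dirac TH t \<in> positive_measures TH" if "t \<in> J'" for t
    using that topspace_H(1) by (intro H.dirac_pos) auto
  have "cintegral TH \<mu> f = cintegral TH (\<lambda>A. 1 * ext (res \<mu>) A + 1 * (\<Sum>t\<in>J'. \<mu> {t} * dirac TH t A)) f"
    using decompose_H[OF \<mu>b] by simp
  also have "\<dots> = 1 * cintegral TH (ext (res \<mu>)) f + 1 * cintegral TH (\<lambda>A. \<Sum>t\<in>J'. \<mu> {t} * dirac TH t A) f"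
    by (intro cintegral_lincomb[OF compact_H er _ _ _ f] positive_measures_sum d positive_measures_nonneg[OF \<mu>]) auto
  also have "cintegral TH (\<lambda>A. \<Sum>t\<in>J'. \<mu> {t} * dirac TH t A) f = (\<Sum>t\<in>J'. \<mu> {t} * f t)"
    using cintegral_sum[OF compact_H d positive_measures_nonneg[OF \<mu>] f, of J'] topspace_H(1)
      cintegral_dirac[OF compact_H Hausdorff_H _ f] by simp
  also have "cintegral TH (ext (res \<mu>)) f = cintegral TK (res \<mu>) f"
    unfolding ext_def by (rule cintegral_push[OF K.compact Hausdorff_H continuous_incl r continuous_map_borel_measurable[OF f]])
  finally show ?thesis by simp
qed

text \<open>The transpose extends a function on \<open>K\<close> by 0 to \<open>J'\<close>, which is
  continuous because \<open>K\<close> is open and closed.\<close>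

lemma res_map: "measure_map TH TK res"
proof (rule measure_mapI[OF compact_H K.compact, where E = "\<lambda>f x. if x \<in> topspace TK then f x else 0"])
  show pos: "res \<mu> \<in> positive_measures TK" if "\<mu> \<in> positive_measures TH" for \<mu>
    using res_bounded[of \<mu>] positive_measures_nonneg[OF that] that by (auto simp: positive_measures_def res_def)
  fix f :: "'a \<Rightarrow> complex" assume f: "continuous_map TK euclidean f"
  let ?f = "\<lambda>x. if x \<in> topspace TK then f x else 0"
  show cf: "continuous_map TH euclidean ?f"
    unfolding continuous_map_def
  proof (intro conjI allI impI)
    fix U :: "complex set" assume "openin euclidean U"
    then have "openin TK {x \<in> topspace TK. f x \<in> U}" using f by (auto simp: continuous_map_def)
    then have "openin TH {x \<in> topspace TK. f x \<in> U}" using open_K topology(6) by (metis openin_open_subtopology)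
    moreover have "{x \<in> topspace TH. ?f x \<in> U} = {x \<in> topspace TK. f x \<in> U} \<union> (if 0 \<in> U then J' else {})"
      using topspace_H by auto
    ultimately show "openin TH {x \<in> topspace TH. ?f x \<in> U}" using open_J'[of J'] by auto
  qed simp
  fix \<mu> assume \<mu>: "\<mu> \<in> positive_measures TH"
  have "(\<Sum>t\<in>J'. \<mu> {t} * ?f t) = 0" using topspace_H(2) by (intro sum.neutral) auto
  then show "cintegral TK (res \<mu>) f = cintegral TH \<mu> ?f"
    unfolding cintegral_decompose[OF \<mu> cf] using cintegral_cong[OF pos[OF \<mu>], of f ?f] by simp
qed (simp_all add: res_bounded, auto simp: res_def)

subsection \<open>The embedding of the measure algebra of the discrete factor\<close>

definition lam :: "'a cmeasure" where "lam = cmeasure_of lamK"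
definition Lam :: "'a cmeasure" where "Lam = ext lam"

lemma lam: "K.left_invariant lam"
  unfolding lam_def using join' K.normalized_haar_left_invariant by blast

lemma lam_bounded: "lam \<in> bounded_measures TK"
  using K.left_invariant_positive[OF lam] by auto

lemma lam_pos: "lam \<in> positive_measures TK"
  by (rule K.left_invariant_positive[OF lam])

lemma Lam_pos: "Lam \<in> positive_measures TH"
  unfolding Lam_def by (rule measure_map_positive[OF ext_map lam_pos])

lemma Lam_bounded: "Lam \<in> bounded_measures TH"
  using Lam_pos by auto

text \<open>In the join, the identity of \<open>J\<close> is replaced by the Haar measure of \<open>K\<close>.\<close>

definition jdirac :: "'a \<Rightarrow> 'a cmeasure" where
  "jdirac t = (if t = e then Lam else dirac TH t)"

text \<open>Linear extension of \<open>jdirac\<close>: a measure on the finite discrete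
  \<open>J\<close> is the sum of its atoms.\<close>

definition emb :: "'a cmeasure \<Rightarrow> 'a cmeasure" where
  "emb \<nu> = (\<lambda>A. \<Sum>t\<in>topspace TJ. \<nu> {t} * jdirac t A)"

lemma jdirac_pos: "t \<in> topspace TJ \<Longrightarrow> jdirac t \<in> positive_measures TH"
  using Lam_pos topspace_H by (auto simp: jdirac_def intro: H.dirac_pos)

lemma jdirac_bounded: "t \<in> topspace TJ \<Longrightarrow> jdirac t \<in> bounded_measures TH"
  using jdirac_pos by auto

lemma sum_J:
  assumes "\<nu> \<in> bounded_measures TJ" "S \<subseteq> topspace TJ"
  shows "\<nu> S = (\<Sum>t\<in>S. \<nu> {t})"
proof -
  have "finite S" using assms(2) finite_J finite_subset by blast
  then have "\<nu> (\<Union>t\<in>S. {t}) = (\<Sum>t\<in>S. \<nu> {t})"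
    using assms(2) borel_J by (intro bounded_measures_UNION[OF assms(1)]) (auto simp: disjoint_family_on_def)
  then show ?thesis by simp
qed

lemma decompose_J:
  assumes \<nu>: "\<nu> \<in> bounded_measures TJ"
  shows "\<nu> = (\<lambda>A. \<Sum>t\<in>topspace TJ. \<nu> {t} * dirac TJ t A)"
proof
  fix A
  show "\<nu> A = (\<Sum>t\<in>topspace TJ. \<nu> {t} * dirac TJ t A)"
  proof (cases "A \<in> sets (borel_of TJ)")
    case True
    then have A: "A \<subseteq> topspace TJ" using borel_J by blast
    have "(\<Sum>t\<in>A. \<nu> {t}) = (\<Sum>t\<in>topspace TJ. \<nu> {t} * dirac TJ t A)"
      using finite_J True A by (intro sum.mono_neutral_cong_left) (auto simp: dirac_def)
    then show ?thesis using sum_J[OF \<nu> A] by simp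
  qed (simp add: bounded_measures_null[OF \<nu>] dirac_def)
qed

lemma continuous_J: "f ` topspace TJ \<subseteq> topspace T' \<Longrightarrow> continuous_map TJ T' f"
  using topology(1) by (metis continuous_map_from_discrete_topology image_subset_iff_funcset)

lemma cintegral_J:
  assumes "\<nu> \<in> positive_measures TJ"
  shows "cintegral TJ \<nu> f = (\<Sum>t\<in>topspace TJ. \<nu> {t} * f t)"
proof -
  have f: "continuous_map TJ euclidean f" by (rule continuous_J) simp
  have "cintegral TJ \<nu> f = cintegral TJ (\<lambda>A. \<Sum>t\<in>topspace TJ. \<nu> {t} * dirac TJ t A) f"
    by (rule arg_cong[OF decompose_J[OF positive_measures_bounded[OF assms]], of "\<lambda>\<mu>. cintegral TJ \<mu> f"])
  also have "\<dots> = (\<Sum>t\<in>topspace TJ. \<nu> {t} * f t)"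
    using cintegral_sum[OF compact_J J.dirac_pos positive_measures_nonneg[OF assms] f, of "topspace TJ"]
      cintegral_dirac[OF compact_J J.Hausdorff _ f] by simp
  finally show ?thesis .
qed

text \<open>The Haar measure of \<open>H\<close> has the form \<open>emb \<eta>\<close>, so this is
  the integration formula on the join.\<close>

lemma cintegral_emb:
  assumes \<nu>: "\<nu> \<in> positive_measures TJ" and f: "continuous_map TH euclidean f"
  shows "cintegral TH (emb \<nu>) f = (\<Sum>t\<in>topspace TJ. \<nu> {t} * (if t = e then cintegral TK lam f else f t))"
proof -
  have "cintegral TH (emb \<nu>) f = (\<Sum>t\<in>topspace TJ. \<nu> {t} * cintegral TH (jdirac t) f)"
    unfolding emb_def by (intro cintegral_sum[OF compact_H _ _ f] jdirac_pos positive_measures_nonneg[OF \<nu>])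
  moreover have "cintegral TH Lam f = cintegral TK lam f"
    unfolding Lam_def ext_def
    by (rule cintegral_push[OF K.compact Hausdorff_H continuous_incl lam_pos continuous_map_borel_measurable[OF f]])
  moreover have "cintegral TH (dirac TH t) f = f t" if "t \<in> topspace TJ" for t
    using that topology(4) by (intro cintegral_dirac[OF compact_H Hausdorff_H _ f]) auto
  ultimately show ?thesis by (auto simp: jdirac_def intro!: sum.cong)
qed

lemma emb_map: "measure_map TJ TH emb"
proof (rule measure_mapI[OF compact_J compact_H, where E = "\<lambda>f t. if t = e then cintegral TK lam f else f t"])
  show "emb \<nu> \<in> bounded_measures TH" if "\<nu> \<in> bounded_measures TJ" for \<nu>
    unfolding emb_def by (intro bounded_measures_sum jdirac_bounded)
  show "emb \<nu> \<in> positive_measures TH" if "\<nu> \<in> positive_measures TJ" for \<nu>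
    unfolding emb_def by (intro positive_measures_sum jdirac_pos positive_measures_nonneg[OF that])
  show "emb (\<lambda>A. a * \<mu> A + b * \<nu> A) = (\<lambda>A. a * emb \<mu> A + b * emb \<nu> A)" for a b \<mu> \<nu>
    by (simp add: emb_def fun_eq_iff sum_distrib_left sum.distrib[symmetric] algebra_simps)
  fix f :: "'a \<Rightarrow> complex" assume f: "continuous_map TH euclidean f"
  show "continuous_map TJ euclidean (\<lambda>t. if t = e then cintegral TK lam f else f t)"
    by (rule continuous_J) simp
  show "cintegral TH (emb \<nu>) f = cintegral TJ \<nu> (\<lambda>t. if t = e then cintegral TK lam f else f t)"
    if "\<nu> \<in> positive_measures TJ" for \<nu>
    unfolding cintegral_emb[OF that f] cintegral_J[OF that] ..
qed

lemma emb_dirac: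
  assumes "t \<in> topspace TJ" shows "emb (dirac TJ t) = jdirac t"
proof
  fix A
  have "emb (dirac TJ t) A = (\<Sum>s\<in>topspace TJ. if s = t then jdirac s A else 0)"
    unfolding emb_def using assms by (intro sum.cong) (auto simp: dirac_def borel_J)
  then show "emb (dirac TJ t) A = jdirac t A" using finite_J assms by simp
qed

lemma quot_apply:
  assumes "\<mu> \<in> bounded_measures TH"
  shows "quot \<mu> {e} = \<mu> (topspace TK)" "t \<in> J' \<Longrightarrow> quot \<mu> {t} = \<mu> {t}"
proof -
  have "rJ -` {e} \<inter> topspace TH = topspace TK" using topspace_H by (auto simp: rJ_def)
  then show "quot \<mu> {e} = \<mu> (topspace TK)" using e_in by (simp add: quot_def push_def borel_J)
  assume t: "t \<in> J'"
  then have "rJ -` {t} \<inter> topspace TH = {t}" using t topspace_H by (auto simp: rJ_def split: if_splits)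
  then show "quot \<mu> {t} = \<mu> {t}" using t by (simp add: quot_def push_def borel_J)
qed

lemma quot_ext:
  assumes "a \<in> positive_measures TK" shows "quot (ext a) = (\<lambda>A. a (topspace TK) * dirac TJ e A)"
proof
  fix A
  have "rJ -` A \<inter> topspace TH \<inter> topspace TK = (if e \<in> A then topspace TK else {})"
    using topspace_H by (auto simp: rJ_def)
  then show "quot (ext a) A = a (topspace TK) * dirac TJ e A"
    using borel_vimage[OF continuous_rJ, of A] assms
    by (auto simp: quot_def push_def ext_apply dirac_def bounded_measures_empty)
qed

lemma quot_jdirac: "t \<in> topspace TJ \<Longrightarrow> quot (jdirac t) = dirac TJ t"
  using quot_ext[OF lam_pos] K.left_invariant_mass[OF lam] quot_dirac[of t] topspace_H
  by (auto simp: jdirac_def Lam_def)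

lemma quot_emb:
  assumes "\<nu> \<in> bounded_measures TJ" shows "quot (emb \<nu>) = \<nu>"
proof -
  have id: "measure_map TJ TJ (\<lambda>\<mu>. \<mu>)" by (simp add: measure_map_def)
  show ?thesis
    by (rule J.map_eqI[OF measure_map_compose[OF emb_map quot_map] id _ assms])
      (simp add: emb_dirac quot_jdirac)
qed

lemma emb_split: "emb \<nu> A = \<nu> {e} * Lam A + (\<Sum>t\<in>J'. \<nu> {t} * dirac TH t A)"
proof -
  have "emb \<nu> A = \<nu> {e} * jdirac e A + (\<Sum>t\<in>J'. \<nu> {t} * jdirac t A)"
    unfolding emb_def by (rule sum.remove[OF finite_J e_in(2)])
  also have "(\<Sum>t\<in>J'. \<nu> {t} * jdirac t A) = (\<Sum>t\<in>J'. \<nu> {t} * dirac TH t A)"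
    by (intro sum.cong refl) (simp add: jdirac_def)
  finally show ?thesis by (simp add: jdirac_def)
qed

lemma emb_quot:
  assumes "\<mu> \<in> bounded_measures TH"
  shows "emb (quot \<mu>) A = \<mu> (topspace TK) * Lam A + (\<Sum>t\<in>J'. \<mu> {t} * dirac TH t A)"
  by (simp add: emb_split quot_apply[OF assms])

end

text \<open>One argument at a time: first a point mass on the left, then any left factor against a
  positive right factor, because \<open>conv_map\<close> wants the fixed factor positive. Jordan
  parts of the right factor finish the proof.\<close>

lemma multiplicative_measure_map:
  assumes X: "compact_hypergroup X" and Y: "compact_hypergroup Y"
    and \<phi>: "measure_map (hg_top Y) (hg_top X) \<phi>"
    and dirac: "\<And>x y. \<lbrakk>x \<in> hg_set Y; y \<in> hg_set Y\<rbrakk> \<Longrightarrow>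
      hg_conv X (\<phi> (hg_dirac Y x)) (\<phi> (hg_dirac Y y)) = \<phi> (hg_conv Y (hg_dirac Y x) (hg_dirac Y y))"
    and \<mu>: "\<mu> \<in> hg_measures Y" and \<nu>: "\<nu> \<in> hg_measures Y"
  shows "hg_conv X (\<phi> \<mu>) (\<phi> \<nu>) = \<phi> (hg_conv Y \<mu> \<nu>)"
proof -
  interpret X: compact_hypergroup X by fact
  interpret Y: compact_hypergroup Y by fact
  note eqI = measure_map_eqI[OF Y.compact Y.Hausdorff X.compact X.Hausdorff]
  note pos = measure_map_positive[OF \<phi>] and b = measure_map_bounded[OF \<phi>]
  have 1: "hg_conv X (\<phi> (hg_dirac Y x)) (\<phi> \<nu>) = \<phi> (hg_conv Y (hg_dirac Y x) \<nu>)"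
    if x: "x \<in> hg_set Y" and \<nu>: "\<nu> \<in> hg_measures Y" for x \<nu>
    by (rule eqI[OF measure_map_compose[OF \<phi> X.conv_map(1)[OF pos[OF Y.dirac_pos[OF x]]]]
          measure_map_compose[OF Y.conv_map(1)[OF Y.dirac_pos[OF x]] \<phi>] dirac[OF x] \<nu>])
  have 2: "hg_conv X (\<phi> \<mu>) (\<phi> \<nu>) = \<phi> (hg_conv Y \<mu> \<nu>)" if \<nu>: "\<nu> \<in> positive_measures (hg_top Y)" for \<nu>
    by (rule eqI[OF measure_map_compose[OF \<phi> X.conv_map(2)[OF pos[OF \<nu>]]]
          measure_map_compose[OF Y.conv_map(2)[OF \<nu>] \<phi>] 1 \<mu>]) (use \<nu> in auto)
  show ?thesis
    using \<nu>
  proof (induction rule: bounded_measures_induct)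
    case (positive \<nu>)
    then show ?case by (rule 2)
  next
    case (lincomb \<nu> \<rho> a c)
    then show ?case
      using Y.conv_closed[OF \<mu>]
      by (simp add: measure_map_lincomb[OF \<phi>] X.conv_linear_right b \<mu> Y.conv_linear_right)
  qed
qed

context finite_join
begin

section \<open>Convolution of the join in terms of \<open>ext\<close>, \<open>emb\<close> and
  \<open>quot\<close>\<close>

lemmas locales = K.compact_hypergroup_axioms J.compact_hypergroup_axioms H.compact_hypergroup_axioms

lemma conv_ext:
  assumes "a \<in> bounded_measures TK" "b \<in> bounded_measures TK"
  shows "hg_conv H (ext a) (ext b) = ext (hg_conv K a b)"
proof (rule multiplicative_measure_map[OF locales(3,1) ext_map _ assms])
  fix x y assume xy: "x \<in> topspace TK" "y \<in> topspace TK"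
  have "hg_conv H (dirac TH x) (dirac TH y) = extend_measure H K (hg_conv K (dirac TK x) (dirac TK y))"
    using join' xy by blast
  then show "hg_conv H (ext (dirac TK x)) (ext (dirac TK y)) = ext (hg_conv K (dirac TK x) (dirac TK y))"
    by (simp add: ext_dirac xy extend_measure_eq_push ext_def[symmetric])
qed

lemma Lam_Lam: "hg_conv H Lam Lam = Lam"
  using conv_ext[OF lam_bounded lam_bounded] K.conv_left_invariant[OF lam lam_bounded] K.left_invariant_mass[OF lam]
  by (simp add: Lam_def)

text \<open>In the join each point of \<open>K\<close> fixes \<open>t\<close>, so a measure on
  \<open>K\<close> acts on \<open>t\<close> by its total mass.\<close>

lemma conv_ext_dirac:
  assumes t: "t \<in> J'" and a: "a \<in> bounded_measures TK"
  shows "hg_conv H (ext a) (dirac TH t) = (\<lambda>A. a (topspace TK) * dirac TH t A)"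
    and "hg_conv H (dirac TH t) (ext a) = (\<lambda>A. a (topspace TK) * dirac TH t A)"
proof -
  have p: "dirac TH t \<in> positive_measures TH" using t topspace_H by (intro H.dirac_pos) auto
  note eqI = measure_map_eqI[OF K.compact K.Hausdorff compact_H Hausdorff_H]
  have D: "hg_conv H (dirac TH s) (dirac TH t) = dirac TH t \<and> hg_conv H (dirac TH t) (dirac TH s) = dirac TH t"
    if "s \<in> topspace TK" for s
    using join' that t topology(2) by metis
  show "hg_conv H (ext a) (dirac TH t) = (\<lambda>A. a (topspace TK) * dirac TH t A)"
    by (rule eqI[OF measure_map_compose[OF ext_map H.conv_map(2)[OF p]]
          measure_map_mass[OF K.compact compact_H p] _ a]) (simp add: ext_dirac D, simp add: dirac_def)
  show "hg_conv H (dirac TH t) (ext a) = (\<lambda>A. a (topspace TK) * dirac TH t A)"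
    by (rule eqI[OF measure_map_compose[OF ext_map H.conv_map(1)[OF p]]
          measure_map_mass[OF K.compact compact_H p] _ a]) (simp add: ext_dirac D, simp add: dirac_def)
qed

lemma jdirac_J': "t \<in> J' \<Longrightarrow> jdirac t = dirac TH t"
  by (simp add: jdirac_def)

text \<open>Without an atom at the unit, replacing the unit by \<open>Lam\<close> has no
  effect.\<close>

lemma emb_eq_extend:
  assumes \<nu>: "\<nu> \<in> bounded_measures TJ" "\<nu> {e} = 0"
  shows "emb \<nu> = extend_measure H J \<nu>"
proof
  fix A
  show "emb \<nu> A = extend_measure H J \<nu> A"
  proof (cases "A \<in> sets (borel_of TH)")
    case True
    have "\<nu> (A \<inter> topspace TJ) = (\<Sum>t\<in>A \<inter> topspace TJ. \<nu> {t})" by (rule sum_J[OF \<nu>(1)]) auto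
    also have "\<dots> = (\<Sum>t\<in>topspace TJ. \<nu> {t} * jdirac t A)"
      using finite_J True \<nu>(2) by (intro sum.mono_neutral_cong_left) (auto simp: jdirac_def dirac_def)
    finally show ?thesis using True by (simp add: emb_def extend_measure_def)
  next
    case False
    then show ?thesis
      using bounded_measures_null[OF jdirac_bounded False] by (simp add: emb_def extend_measure_def)
  qed
qed

text \<open>The cases mirror the clauses of the join. \<open>emb\<close> is made for the last one:
  the atom \<alpha>_e at the unit turns into \<alpha>_e times the Haar measure of
  \<open>K\<close>.\<close>

lemma conv_jdirac:
  assumes s: "s \<in> topspace TJ" and t: "t \<in> topspace TJ"
  shows "hg_conv H (jdirac s) (jdirac t) = emb (hg_conv J (dirac TJ s) (dirac TJ t))"
proof -
  have unit: "hg_conv J (dirac TJ e) (dirac TJ t) = dirac TJ t" "hg_conv J (dirac TJ s) (dirac TJ e) = dirac TJ s"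
    using J.unit_left[OF t] J.unit_right[OF s] topology(2) by simp_all
  have mass: "lam (topspace TK) = 1" by (rule K.left_invariant_mass[OF lam])
  consider "s = e" "t = e" | "s = e" "t \<in> J'" | "s \<in> J'" "t = e"
    | "s \<in> J'" "t \<in> J'" "t \<noteq> hg_inv J s" | "s \<in> J'" "t \<in> J'" "t = hg_inv J s"
    using s t by blast
  then show ?thesis
  proof cases
    case 1
    then show ?thesis using Lam_Lam emb_dirac[OF t] unit(1) by (simp add: jdirac_def)
  next
    case 2
    then show ?thesis
      using conv_ext_dirac(1)[OF 2(2) lam_bounded] emb_dirac[OF t] unit(1) mass by (simp add: jdirac_def Lam_def)
  next
    case 3
    then show ?thesis
      using conv_ext_dirac(2)[OF 3(1) lam_bounded] emb_dirac[OF s] unit(2) mass by (simp add: jdirac_def Lam_def)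
  next
    case 4
    let ?\<nu> = "hg_conv J (dirac TJ s) (dirac TJ t)"
    \<comment> \<open>The join compares \<open>s\<close> with the inverse of \<open>t\<close>, the
      support lemma \<open>t\<close> with the inverse of \<open>s\<close>.\<close>
    have "s \<noteq> hg_inv J t" using 4(3) J.inv_involutive[OF t] by auto
    then have "hg_conv H (dirac TH s) (dirac TH t) = extend_measure H J ?\<nu>" using join' s t by blast
    moreover have "?\<nu> \<in> bounded_measures TJ" using s t by (intro J.conv_closed J.dirac_bounded)
    moreover have "?\<nu> {e} = 0" using J.conv_unit_dirac_zero[OF s t 4(3)] topology(2) by simp
    ultimately show ?thesis using 4 by (simp add: jdirac_J' emb_eq_extend)
  next
    case 5
    let ?\<alpha> = "\<lambda>t. hg_conv J (dirac TJ s) (dirac TJ (hg_inv J s)) {t}"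
    have "s \<in> topspace TJ - {hg_unit J}" using 5(1) topology(2) by simp
    then have "hg_conv H (dirac TH s) (dirac TH (hg_inv J s)) =
        (\<lambda>A. ?\<alpha> (hg_unit J) * extend_measure H K (\<lambda>B. of_real (measure lamK B)) A +
          (\<Sum>t\<in>{t \<in> topspace TJ - {hg_unit J}. ?\<alpha> t \<noteq> 0}. ?\<alpha> t * dirac TH t A))"
      using join' by blast
    also have "(\<lambda>B. complex_of_real (measure lamK B)) = lam" by (simp add: lam_def cmeasure_of_def)
    also have "extend_measure H K lam = Lam" by (simp add: Lam_def ext_def extend_measure_eq_push)
    also have "(\<lambda>A. ?\<alpha> (hg_unit J) * Lam A + (\<Sum>t\<in>{t \<in> topspace TJ - {hg_unit J}. ?\<alpha> t \<noteq> 0}. ?\<alpha> t * dirac TH t A)) =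
        emb (hg_conv J (dirac TJ s) (dirac TJ (hg_inv J s)))"
    proof
      fix A
      \<comment> \<open>The join sums over nonzero coefficients only, \<open>emb_split\<close> over
        all of \<open>J'\<close>.\<close>
      have "(\<Sum>t\<in>{t \<in> J'. ?\<alpha> t \<noteq> 0}. ?\<alpha> t * dirac TH t A) = (\<Sum>t\<in>J'. ?\<alpha> t * dirac TH t A)"
        using finite_J by (intro sum.mono_neutral_left) auto
      then show "?\<alpha> (hg_unit J) * Lam A + (\<Sum>t\<in>{t \<in> topspace TJ - {hg_unit J}. ?\<alpha> t \<noteq> 0}. ?\<alpha> t * dirac TH t A) =
          emb (hg_conv J (dirac TJ s) (dirac TJ (hg_inv J s))) A"
        unfolding emb_split topology(2) by simp
    qed
    finally show ?thesis using 5 by (simp add: jdirac_J')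
  qed
qed

lemma conv_emb:
  assumes "\<mu> \<in> bounded_measures TJ" "\<nu> \<in> bounded_measures TJ"
  shows "hg_conv H (emb \<mu>) (emb \<nu>) = emb (hg_conv J \<mu> \<nu>)"
  by (rule multiplicative_measure_map[OF locales(3,2) emb_map _ assms]) (simp add: emb_dirac conv_jdirac)

lemma Lam_eq_emb: "Lam = emb (dirac TJ e)"
  using emb_dirac[OF e_in(2)] by (simp add: jdirac_def)

text \<open>A point of \<open>K\<close> is absorbed by \<open>Lam\<close> and a point of
  \<open>J'\<close> absorbs \<open>Lam\<close>, so that only the image in \<open>J\<close>
  remains.\<close>

lemma conv_Lam:
  assumes \<mu>: "\<mu> \<in> bounded_measures TH"
  shows "hg_conv H Lam \<mu> = emb (quot \<mu>)" and "hg_conv H \<mu> Lam = emb (quot \<mu>)"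
proof -
  note comp = measure_map_compose[OF quot_map emb_map]
  have D: "hg_conv H Lam (dirac TH x) = emb (quot (dirac TH x)) \<and> hg_conv H (dirac TH x) Lam = emb (quot (dirac TH x))"
    if x: "x \<in> topspace TH" for x
  proof (cases "x \<in> topspace TK")
    case True
    have "hg_conv H (ext lam) (ext (dirac TK x)) = Lam" "hg_conv H (ext (dirac TK x)) (ext lam) = Lam"
      using K.dirac_bounded[OF True] lam_bounded K.left_invariant_conv[OF lam, of "dirac TK x"]
        K.conv_left_invariant[OF lam, of "dirac TK x"] True
      by (simp_all add: conv_ext Lam_def, simp_all add: dirac_def)
    then show ?thesis
      using True x by (simp add: ext_dirac quot_dirac emb_dirac e_in jdirac_def Lam_def)
  next
    case False
    then have x': "x \<in> J'" using x topspace_H by auto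
    then show ?thesis
      using conv_ext_dirac[OF x' lam_bounded] K.left_invariant_mass[OF lam] x
      by (simp add: quot_dirac emb_dirac jdirac_def Lam_def)
  qed
  show "hg_conv H Lam \<mu> = emb (quot \<mu>)"
    by (rule H.map_eqI[OF H.conv_map(1)[OF Lam_pos] comp _ \<mu>]) (use D in blast)
  show "hg_conv H \<mu> Lam = emb (quot \<mu>)"
    by (rule H.map_eqI[OF H.conv_map(2)[OF Lam_pos] comp _ \<mu>]) (use D in blast)
qed

lemma Lam_central: "\<mu> \<in> bounded_measures TH \<Longrightarrow> hg_conv H Lam \<mu> = hg_conv H \<mu> Lam"
  by (simp add: conv_Lam)

lemma Lam_conv_Lam:
  assumes "\<mu> \<in> bounded_measures TH" "\<nu> \<in> bounded_measures TH"
  shows "hg_conv H (hg_conv H Lam \<mu>) (hg_conv H Lam \<nu>) = hg_conv H Lam (hg_conv H \<mu> \<nu>)"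
proof -
  note c = H.conv_closed Lam_bounded assms
  have "hg_conv H (hg_conv H Lam \<mu>) (hg_conv H Lam \<nu>) = hg_conv H Lam (hg_conv H (hg_conv H \<mu> Lam) \<nu>)"
    by (simp add: H.conv_assoc c)
  also have "\<dots> = hg_conv H Lam (hg_conv H (hg_conv H Lam \<mu>) \<nu>)"
    by (simp add: Lam_central[OF assms(1)])
  also have "\<dots> = hg_conv H (hg_conv H Lam Lam) (hg_conv H \<mu> \<nu>)"
    by (simp add: H.conv_assoc c)
  finally show ?thesis by (simp add: Lam_Lam)
qed

text \<open>Multiplication by the central idempotent \<open>Lam\<close> is multiplicative and equals
  \<open>emb\<close> after \<open>quot\<close>; since \<open>emb\<close> is multiplicative and
  injective, \<open>quot\<close> inherits this.\<close>

lemma quot_conv: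
  assumes "\<mu> \<in> bounded_measures TH" "\<nu> \<in> bounded_measures TH"
  shows "quot (hg_conv H \<mu> \<nu>) = hg_conv J (quot \<mu>) (quot \<nu>)"
proof -
  note q = measure_map_bounded[OF quot_map]
  have "emb (quot (hg_conv H \<mu> \<nu>)) = emb (hg_conv J (quot \<mu>) (quot \<nu>))"
    using Lam_conv_Lam[OF assms] assms H.conv_closed[OF assms] by (simp add: conv_Lam conv_emb q)
  then show ?thesis
    using quot_emb q assms H.conv_closed[OF assms] J.conv_closed by metis
qed

text \<open>Multiplication by the central idempotent \<open>1 - Lam\<close> maps \<open>M(H)\<close> into \<open>M(K)\<close>.\<close>

definition proj :: "'a cmeasure \<Rightarrow> 'a cmeasure" where
  "proj \<mu> = (\<lambda>A. 1 * res \<mu> A + (- \<mu> (topspace TK)) * lam A)"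

lemma proj_bounded: "\<mu> \<in> bounded_measures TH \<Longrightarrow> proj \<mu> \<in> bounded_measures TK"
  unfolding proj_def by (intro bounded_measures_lincomb res_bounded lam_bounded)

text \<open>On \<open>J'\<close> the measure \<open>\<mu>\<close> and its product with
  \<open>Lam\<close> coincide, so the difference lives on \<open>K\<close>.\<close>

lemma ext_proj:
  assumes \<mu>: "\<mu> \<in> bounded_measures TH"
  shows "ext (proj \<mu>) = (\<lambda>A. 1 * \<mu> A + (- 1) * hg_conv H Lam \<mu> A)"
proof
  fix A
  have "\<mu> A = ext (res \<mu>) A + (\<Sum>t\<in>J'. \<mu> {t} * dirac TH t A)"
    by (rule fun_cong[OF decompose_H[OF \<mu>]])
  moreover have "ext (proj \<mu>) A = ext (res \<mu>) A - \<mu> (topspace TK) * Lam A"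
    unfolding proj_def Lam_def measure_map_lincomb[OF ext_map res_bounded[OF \<mu>] lam_bounded] by simp
  ultimately show "ext (proj \<mu>) A = 1 * \<mu> A + (- 1) * hg_conv H Lam \<mu> A"
    by (simp add: conv_Lam(1)[OF \<mu>] emb_quot[OF \<mu>])
qed

text \<open>For the difference \<open>?p\<close> of \<open>\<mu>\<close> and its product with
  \<open>Lam\<close>, centrality and idempotence give \<open>?p\<close> times \<open>Lam\<close>
  equal to 0. So \<open>\<nu>\<close> may replace its own difference as right factor, and
  \<open>?p\<close> times \<open>\<nu>\<close> is the difference for the product. Finally
  \<open>res\<close> cancels \<open>ext\<close>.\<close>

lemma proj_conv:
  assumes \<mu>: "\<mu> \<in> bounded_measures TH" and \<nu>: "\<nu> \<in> bounded_measures TH"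
  shows "proj (hg_conv H \<mu> \<nu>) = hg_conv K (proj \<mu>) (proj \<nu>)"
proof -
  note c = H.conv_closed Lam_bounded \<mu> \<nu>
  let ?p = "ext (proj \<mu>)"
  have pb: "?p \<in> bounded_measures TH" by (rule measure_map_bounded[OF ext_map proj_bounded[OF \<mu>]])
  have p\<nu>: "hg_conv H ?p \<nu> = ext (proj (hg_conv H \<mu> \<nu>))"
    unfolding ext_proj[OF \<mu>] ext_proj[OF H.conv_closed[OF \<mu> \<nu>]]
    by (subst H.conv_linear_left) (simp_all add: c H.conv_assoc)
  have "hg_conv H ?p Lam = (\<lambda>A. 1 * hg_conv H \<mu> Lam A + (- 1) * hg_conv H (hg_conv H Lam \<mu>) Lam A)"
    unfolding ext_proj[OF \<mu>] by (rule H.conv_linear_left) (simp_all add: c)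
  also have "hg_conv H (hg_conv H Lam \<mu>) Lam = hg_conv H \<mu> Lam"
    using Lam_central[OF \<mu>] by (simp add: H.conv_assoc c Lam_Lam)
  finally have pL: "hg_conv H ?p Lam = (\<lambda>A. 0)" by simp
  have z: "hg_conv H (\<lambda>A. 0) \<nu> = (\<lambda>A. 0)"
    using H.conv_linear_left[OF \<mu> \<mu> \<nu>, of 0 0] by simp
  have "ext (hg_conv K (proj \<mu>) (proj \<nu>)) = hg_conv H ?p (ext (proj \<nu>))"
    by (simp add: conv_ext proj_bounded \<mu> \<nu>)
  also have "\<dots> = (\<lambda>A. 1 * hg_conv H ?p \<nu> A + (- 1) * hg_conv H ?p (hg_conv H Lam \<nu>) A)"
    unfolding ext_proj[OF \<nu>] by (rule H.conv_linear_right) (simp_all add: c pb)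
  also have "hg_conv H ?p (hg_conv H Lam \<nu>) = hg_conv H (hg_conv H ?p Lam) \<nu>"
    by (simp add: H.conv_assoc c pb)
  also have "\<dots> = (\<lambda>A. 0)" by (simp add: pL z)
  finally have "ext (hg_conv K (proj \<mu>) (proj \<nu>)) = ext (proj (hg_conv H \<mu> \<nu>))" by (simp add: p\<nu>)
  then show ?thesis
    using res_ext K.conv_closed proj_bounded \<mu> \<nu> H.conv_closed by metis
qed

text \<open>\<open>emb \<eta>\<close> absorbs \<open>Lam\<close>, so a point of \<open>H\<close>
  acts on it only through its image in \<open>J\<close>, where \<open>\<eta>\<close> is
  invariant.\<close>

lemma emb_left_invariant:
  assumes \<eta>: "J.left_invariant \<eta>"
  shows "H.left_invariant (emb \<eta>)"
proof -
  have p: "\<eta> \<in> positive_measures TJ" and b: "\<eta> \<in> bounded_measures TJ"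
    using J.left_invariant_positive[OF \<eta>] by auto
  have eb: "emb \<eta> \<in> bounded_measures TH" by (rule measure_map_bounded[OF emb_map b])
  have "topspace TH \<inter> topspace TK = topspace TK" using topspace_H by blast
  then have "Lam (topspace TH) = 1"
    using K.left_invariant_mass[OF lam] ext_apply[OF topspace_borel, of lam] by (simp add: Lam_def)
  moreover have "dirac TH t (topspace TH) = 1" if "t \<in> topspace TJ" for t
    using that topology(4) topspace_borel[of TH] by (auto simp: dirac_def simp del: topspace_borel)
  ultimately have "jdirac t (topspace TH) = 1" if "t \<in> topspace TJ" for t
    using that by (simp add: jdirac_def)
  then have "emb \<eta> (topspace TH) = (\<Sum>t\<in>topspace TJ. \<eta> {t})" unfolding emb_def by simp
  also have "\<dots> = 1" using sum_J[OF b subset_refl] J.left_invariant_mass[OF \<eta>] by simp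
  finally have mass: "emb \<eta> (topspace TH) = 1" .
  have "hg_conv H (dirac TH x) (emb \<eta>) = emb \<eta>" if x: "x \<in> topspace TH" for x
  proof -
    have db: "dirac TH x \<in> bounded_measures TH" by (rule H.dirac_bounded[OF x])
    have L: "emb \<eta> = hg_conv H Lam (emb \<eta>)" using conv_Lam(1)[OF eb] quot_emb[OF b] by simp
    have "hg_conv H (dirac TH x) (emb \<eta>) = hg_conv H (hg_conv H (dirac TH x) Lam) (emb \<eta>)"
      by (subst L) (simp add: H.conv_assoc db Lam_bounded eb)
    also have "\<dots> = emb (hg_conv J (quot (dirac TH x)) \<eta>)"
      by (simp add: conv_Lam(2)[OF db] conv_emb measure_map_bounded[OF quot_map] db b)
    also have "hg_conv J (quot (dirac TH x)) \<eta> = \<eta>"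
      using \<eta> x continuous_rJ by (auto simp: quot_dirac J.left_invariant_def continuous_map_def)
    finally show ?thesis .
  qed
  then show ?thesis
    using mass measure_map_positive[OF emb_map p] by (simp add: H.left_invariant_def probability_measures_def)
qed

end

lemma continuous_map_mult_cnj:
  assumes "continuous_map T euclidean (f :: 'a \<Rightarrow> complex)" "continuous_map T euclidean g"
  shows "continuous_map T euclidean (\<lambda>x. f x * cnj (g x))"
proof -
  have "continuous_map euclidean euclidean (\<lambda>p :: complex \<times> complex. fst p * cnj (snd p))"
    unfolding continuous_map_iff_continuous2 by (intro continuous_intros)
  moreover have "continuous_map T euclidean (\<lambda>x. (f x, g x))"
    using continuous_map_pairedI[OF assms] by simp
  ultimately have "continuous_map T euclidean ((\<lambda>p. fst p * cnj (snd p)) \<circ> (\<lambda>x. (f x, g x)))"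
    by (rule continuous_map_compose[rotated])
  then show ?thesis by (simp add: o_def)
qed

subsection \<open>Representations of the join\<close>

context finite_join
begin

text \<open>For \<open>emb\<close> the point is that the measures \<open>jdirac t\<close> are
  real-valued.\<close>

lemma cnj_commute:
  "ext (\<lambda>A. cnj (\<mu> A)) = (\<lambda>A. cnj (ext \<mu> A))" "quot (\<lambda>A. cnj (\<mu> A)) = (\<lambda>A. cnj (quot \<mu> A))"
  "res (\<lambda>A. cnj (\<mu> A)) = (\<lambda>A. cnj (res \<mu> A))" "emb (\<lambda>A. cnj (\<mu> A)) = (\<lambda>A. cnj (emb \<mu> A))"
proof -
  have "cnj (jdirac t A) = jdirac t A" if "t \<in> topspace TJ" for t A
    using positive_measures_of_real[OF jdirac_pos[OF that], of A] by (metis complex_cnj_complex_of_real)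
  then show "emb (\<lambda>A. cnj (\<mu> A)) = (\<lambda>A. cnj (emb \<mu> A))"
    by (simp add: emb_def fun_eq_iff)
qed (auto simp: ext_def quot_def push_def res_def)

lemma inv_J': "t \<in> J' \<Longrightarrow> hg_inv J t \<in> J'"
proof -
  assume t: "t \<in> J'"
  have "hg_inv J t \<noteq> e"
  proof
    assume "hg_inv J t = e"
    then have "t = hg_inv J e" using J.inv_involutive[of t] t by simp
    then show False using J.inv_unit topology(2) t by simp
  qed
  then show ?thesis using J.inv_in[of t] t by blast
qed

lemma ext_adjoint: "\<mu> \<in> bounded_measures TK \<Longrightarrow> ext (measure_adjoint K \<mu>) = measure_adjoint H (ext \<mu>)"
proof (rule measure_adjoint_commute[OF locales(3,1) ext_map cnj_commute(1)])
  fix x assume "x \<in> topspace TK"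
  then show "ext (dirac TK (hg_inv K x)) = measure_flip H (ext (dirac TK x))"
    using K.inv_in[of x] topspace_H by (simp add: ext_dirac H.flip_dirac inverse)
qed

lemma res_adjoint: "\<mu> \<in> bounded_measures TH \<Longrightarrow> res (measure_adjoint H \<mu>) = measure_adjoint K (res \<mu>)"
proof (rule measure_adjoint_commute[OF locales(1,3) res_map cnj_commute(3)])
  fix x assume x: "x \<in> topspace TH"
  show "res (dirac TH (hg_inv H x)) = measure_flip K (res (dirac TH x))"
  proof (cases "x \<in> topspace TK")
    case True
    then show ?thesis using K.inv_in[OF True] by (simp add: res_dirac K.flip_dirac inverse)
  next
    case False
    then have x': "x \<in> J'" using x topspace_H by auto
    then show ?thesis
      using inv_J'[OF x'] by (simp add: res_dirac(2) inverse measure_flip_def fun_eq_iff)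
  qed
qed

lemma quot_adjoint: "\<mu> \<in> bounded_measures TH \<Longrightarrow> quot (measure_adjoint H \<mu>) = measure_adjoint J (quot \<mu>)"
proof (rule measure_adjoint_commute[OF locales(2,3) quot_map cnj_commute(2)])
  fix x assume x: "x \<in> topspace TH"
  show "quot (dirac TH (hg_inv H x)) = measure_flip J (quot (dirac TH x))"
  proof (cases "x \<in> topspace TK")
    case True
    then show ?thesis
      using K.inv_in[OF True] x H.inv_in[OF x] J.inv_unit e_in topology(2)
      by (simp add: quot_dirac J.flip_dirac inverse)
  next
    case False
    then have x': "x \<in> J'" using x topspace_H by auto
    then show ?thesis
      using inv_J'[OF x'] x H.inv_in[OF x] by (simp add: quot_dirac J.flip_dirac inverse)
  qed
qed

text \<open>Settles the unit in \<open>emb_adjoint\<close>, where \<open>jdirac\<close> is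
  \<open>Lam\<close>.\<close>

lemma flip_Lam: "measure_flip H Lam = Lam"
proof -
  have "measure_flip H (ext lam) = ext (measure_flip K lam)"
    by (rule measure_map_eqI[OF K.compact K.Hausdorff compact_H Hausdorff_H
          measure_map_compose[OF ext_map H.flip_map] measure_map_compose[OF K.flip_map ext_map] _ lam_bounded])
      (use K.inv_in topspace_H in \<open>simp add: ext_dirac H.flip_dirac K.flip_dirac inverse\<close>)
  then show ?thesis by (simp add: K.flip_left_invariant[OF lam] Lam_def)
qed

lemma emb_adjoint: "\<mu> \<in> bounded_measures TJ \<Longrightarrow> emb (measure_adjoint J \<mu>) = measure_adjoint H (emb \<mu>)"
proof (rule measure_adjoint_commute[OF locales(3,2) emb_map cnj_commute(4)])
  fix x assume x: "x \<in> topspace TJ"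
  show "emb (dirac TJ (hg_inv J x)) = measure_flip H (emb (dirac TJ x))"
  proof (cases "x = e")
    case True
    then show ?thesis
      using x J.inv_unit topology(2) flip_Lam by (simp add: emb_dirac jdirac_def)
  next
    case False
    then have x': "x \<in> J'" using x by auto
    moreover have "x \<in> topspace TH" using x topology(4) by auto
    ultimately show ?thesis
      using inv_J'[OF x'] by (simp add: emb_dirac jdirac_J' H.flip_dirac inverse)
  qed
qed

lemma res_Lam: "res Lam = lam"
  unfolding Lam_def by (rule res_ext[OF lam_bounded])

text \<open>\<open>proj\<close> is the multiplicative map, \<open>res\<close> the one with simple
  values on points. They differ by a multiple of \<open>lam\<close>, which \<open>\<pi>\<close>
  kills.\<close>

lemma rep_res_eq_proj:
  assumes \<pi>: "hypergroup_representation K \<pi>" and lam0: "\<And>\<xi>. \<xi> \<in> hs_set (rep_space \<pi>) \<Longrightarrow> rep_op \<pi> lam \<xi> = hs_zero (rep_space \<pi>)"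
    and \<mu>: "\<mu> \<in> bounded_measures TH" and \<xi>: "\<xi> \<in> hs_set (rep_space \<pi>)"
  shows "rep_op \<pi> (proj \<mu>) \<xi> = rep_op \<pi> (res \<mu>) \<xi>"
proof -
  interpret V: hilbert_space "rep_space \<pi>" by (rule hypergroup_representation.rep_hilbert[OF \<pi>])
  have "hs_scale (rep_space \<pi>) a (hs_zero (rep_space \<pi>)) = hs_zero (rep_space \<pi>)" for a
    using V.scale_scale[OF V.zero_closed, of a 0] by (simp add: V.scale_zero V.zero_closed)
  then show ?thesis
    using hypergroup_representation.rep_linear[OF \<pi> res_bounded[OF \<mu>] lam_bounded \<xi>, of 1 "- \<mu> (topspace TK)"]
      rep_closed[OF \<pi> res_bounded[OF \<mu>] \<xi>] lam0[OF \<xi>]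
    by (simp add: proj_def V.scale_one V.add_zero)
qed

lemma pull_res_irreducible:
  assumes \<pi>: "irreducible_representation K \<pi>" and nt: "\<not> trivial_representation K \<pi>"
  shows "irreducible_representation H (pull res \<pi>)"
proof (rule pull_irreducible[OF \<pi>])
  have rep: "hypergroup_representation K \<pi>" by (rule irreducible_rep[OF \<pi>])
  have lam0: "\<And>\<xi>. \<xi> \<in> hs_set (rep_space \<pi>) \<Longrightarrow> rep_op \<pi> lam \<xi> = hs_zero (rep_space \<pi>)"
    using K.nontrivial_representation_iff[OF \<pi> lam] nt by blast
  have p: "rep_op \<pi> (proj \<mu>) \<xi> = rep_op \<pi> (res \<mu>) \<xi>"
    if "\<mu> \<in> bounded_measures TH" "\<xi> \<in> hs_set (rep_space \<pi>)" for \<mu> \<xi>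
    by (rule rep_res_eq_proj[OF rep _ that]) (rule lam0)
  show "hypergroup_representation H (pull res \<pi>)"
  proof (rule pull_representation[OF rep res_map _ res_adjoint])
    fix \<mu> \<nu> \<xi> assume \<mu>: "\<mu> \<in> bounded_measures TH" and \<nu>: "\<nu> \<in> bounded_measures TH" and \<xi>: "\<xi> \<in> hs_set (rep_space \<pi>)"
    show "rep_op \<pi> (res (hg_conv H \<mu> \<nu>)) \<xi> = rep_op \<pi> (res \<mu>) (rep_op \<pi> (res \<nu>) \<xi>)"
      using p[OF H.conv_closed[OF \<mu> \<nu>] \<xi>] p[OF \<mu> rep_closed[OF rep res_bounded[OF \<nu>] \<xi>]] p[OF \<nu> \<xi>]
        hypergroup_representation.rep_mult[OF rep proj_bounded[OF \<mu>] proj_bounded[OF \<nu>] \<xi>]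
      by (simp add: proj_conv[OF \<mu> \<nu>])
  next
    fix \<xi> assume "\<xi> \<in> hs_set (rep_space \<pi>)"
    then show "rep_op \<pi> (res (hg_dirac H (hg_unit H))) \<xi> = \<xi>"
      using hypergroup_representation.rep_unit[OF rep] by (simp add: topology(7) res_dirac e_in)
  qed
  show "\<exists>\<mu>'\<in>hg_measures H. \<forall>\<xi>\<in>hs_set (rep_space \<pi>). rep_op \<pi> (res \<mu>') \<xi> = rep_op \<pi> \<mu> \<xi>"
    if "\<mu> \<in> hg_measures K" for \<mu>
    using that by (intro bexI[of _ "ext \<mu>"]) (simp_all add: res_ext measure_map_bounded[OF ext_map])
qed

lemma pull_quot_irreducible:
  assumes \<pi>: "irreducible_representation J \<pi>"
  shows "irreducible_representation H (pull quot \<pi>)"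
proof (rule pull_irreducible[OF \<pi>])
  have rep: "hypergroup_representation J \<pi>" by (rule irreducible_rep[OF \<pi>])
  note q = measure_map_bounded[OF quot_map]
  show "hypergroup_representation H (pull quot \<pi>)"
  proof (rule pull_representation[OF rep quot_map _ quot_adjoint])
    show "rep_op \<pi> (quot (hg_conv H \<mu> \<nu>)) \<xi> = rep_op \<pi> (quot \<mu>) (rep_op \<pi> (quot \<nu>) \<xi>)"
      if "\<mu> \<in> bounded_measures TH" "\<nu> \<in> bounded_measures TH" "\<xi> \<in> hs_set (rep_space \<pi>)" for \<mu> \<nu> \<xi>
      using that by (simp add: quot_conv hypergroup_representation.rep_mult[OF rep] q)
    show "rep_op \<pi> (quot (hg_dirac H (hg_unit H))) \<xi> = \<xi>" if "\<xi> \<in> hs_set (rep_space \<pi>)" for \<xi>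
      using hypergroup_representation.rep_unit[OF rep that] by (simp add: topology(2,7) quot_dirac e_in)
  qed
  show "\<exists>\<mu>'\<in>hg_measures H. \<forall>\<xi>\<in>hs_set (rep_space \<pi>). rep_op \<pi> (quot \<mu>') \<xi> = rep_op \<pi> \<mu> \<xi>"
    if "\<mu> \<in> hg_measures J" for \<mu>
    using that by (intro bexI[of _ "emb \<mu>"]) (simp_all add: quot_emb measure_map_bounded[OF emb_map])
qed

lemma rep_Lam_dichotomy:
  assumes "irreducible_representation H \<sigma>"
  shows "(\<forall>\<xi>\<in>hs_set (rep_space \<sigma>). rep_op \<sigma> Lam \<xi> = \<xi>) \<or>
    (\<forall>\<xi>\<in>hs_set (rep_space \<sigma>). rep_op \<sigma> Lam \<xi> = hs_zero (rep_space \<sigma>))"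
  by (rule central_idempotent_dichotomy[OF assms Lam_bounded Lam_Lam Lam_central])

text \<open>When \<open>Lam\<close> acts as 0, \<open>\<sigma>\<close> does not distinguish
  \<open>\<mu>\<close> from \<open>ext (proj \<mu>)\<close>, nor this from
  \<open>ext (res \<mu>)\<close>, because the differences are a product with \<open>Lam\<close> and
  a multiple of \<open>Lam\<close>.\<close>

lemma rep_ext_res:
  assumes \<sigma>: "hypergroup_representation H \<sigma>"
    and Lam0: "\<And>\<xi>. \<xi> \<in> hs_set (rep_space \<sigma>) \<Longrightarrow> rep_op \<sigma> Lam \<xi> = hs_zero (rep_space \<sigma>)"
    and \<mu>: "\<mu> \<in> bounded_measures TH" and \<xi>: "\<xi> \<in> hs_set (rep_space \<sigma>)"
  shows "rep_op \<sigma> (ext (res \<mu>)) \<xi> = rep_op \<sigma> \<mu> \<xi>"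
proof -
  interpret V: hilbert_space "rep_space \<sigma>" by (rule hypergroup_representation.rep_hilbert[OF \<sigma>])
  interpret hypergroup_representation H \<sigma> by fact
  note closed = rep_closed[OF \<sigma>] and eb = measure_map_bounded[OF ext_map res_bounded[OF \<mu>]]
  have z: "hs_scale (rep_space \<sigma>) a (hs_zero (rep_space \<sigma>)) = hs_zero (rep_space \<sigma>)" for a
    using V.scale_scale[OF V.zero_closed, of a 0] by (simp add: V.scale_zero V.zero_closed)
  have L: "rep_op \<sigma> (hg_conv H Lam \<mu>) \<xi> = hs_zero (rep_space \<sigma>)"
    using rep_mult[OF Lam_bounded \<mu> \<xi>] Lam0 closed[OF \<mu> \<xi>] by simp
  have "rep_op \<sigma> (ext (proj \<mu>)) \<xi> = rep_op \<sigma> \<mu> \<xi>"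
    unfolding ext_proj[OF \<mu>]
    by (subst rep_linear[OF \<mu> H.conv_closed[OF Lam_bounded \<mu>] \<xi>]) (simp add: L z V.scale_one V.add_zero closed \<mu> \<xi>)
  moreover have "ext (proj \<mu>) = (\<lambda>A. 1 * ext (res \<mu>) A + (- \<mu> (topspace TK)) * Lam A)"
    unfolding proj_def Lam_def by (rule measure_map_lincomb[OF ext_map res_bounded[OF \<mu>] lam_bounded])
  moreover have "rep_op \<sigma> (\<lambda>A. 1 * ext (res \<mu>) A + (- \<mu> (topspace TK)) * Lam A) \<xi> = rep_op \<sigma> (ext (res \<mu>)) \<xi>"
    by (subst rep_linear[OF eb Lam_bounded \<xi>]) (simp add: Lam0 \<xi> z V.scale_one V.add_zero closed eb)
  ultimately show ?thesis by simp
qed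

text \<open>By \<open>rep_ext_res\<close> measures on \<open>K\<close> already produce all operators
  of \<open>\<sigma>\<close>. The trivial representation is excluded since \<open>lam\<close> acts
  through \<open>Lam\<close>, that is, as 0.\<close>

lemma pull_ext_irreducible:
  assumes \<sigma>: "irreducible_representation H \<sigma>"
    and Lam0: "\<And>\<xi>. \<xi> \<in> hs_set (rep_space \<sigma>) \<Longrightarrow> rep_op \<sigma> Lam \<xi> = hs_zero (rep_space \<sigma>)"
  shows "irreducible_representation K (pull ext \<sigma>)" "\<not> trivial_representation K (pull ext \<sigma>)"
proof -
  have rep: "hypergroup_representation H \<sigma>" by (rule irreducible_rep[OF \<sigma>])
  show irr: "irreducible_representation K (pull ext \<sigma>)"
  proof (rule pull_irreducible[OF \<sigma>])
    show "hypergroup_representation K (pull ext \<sigma>)"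
    proof (rule pull_representation[OF rep ext_map _ ext_adjoint])
      show "rep_op \<sigma> (ext (hg_conv K \<mu> \<nu>)) \<xi> = rep_op \<sigma> (ext \<mu>) (rep_op \<sigma> (ext \<nu>) \<xi>)"
        if "\<mu> \<in> bounded_measures TK" "\<nu> \<in> bounded_measures TK" "\<xi> \<in> hs_set (rep_space \<sigma>)" for \<mu> \<nu> \<xi>
        using that hypergroup_representation.rep_mult[OF rep, of "ext \<mu>" "ext \<nu>" \<xi>]
        by (simp add: conv_ext measure_map_bounded[OF ext_map])
      show "rep_op \<sigma> (ext (hg_dirac K (hg_unit K))) \<xi> = \<xi>" if "\<xi> \<in> hs_set (rep_space \<sigma>)" for \<xi>
        using hypergroup_representation.rep_unit[OF rep that] by (simp add: ext_dirac e_in topology(7))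
    qed
    show "\<exists>\<mu>'\<in>hg_measures K. \<forall>\<xi>\<in>hs_set (rep_space \<sigma>). rep_op \<sigma> (ext \<mu>') \<xi> = rep_op \<sigma> \<mu> \<xi>"
      if "\<mu> \<in> hg_measures H" for \<mu>
      using rep_ext_res[OF rep Lam0 that] res_bounded[OF that] by blast
  qed
  show "\<not> trivial_representation K (pull ext \<sigma>)"
    using K.nontrivial_representation_iff[OF irr lam] Lam0 by (simp add: Lam_def)
qed

text \<open>\<open>emb\<close> does not preserve the unit, but its value \<open>Lam\<close> there
  acts as the identity. For the same reason \<open>\<mu>\<close> and its product with
  \<open>Lam\<close>, which is \<open>emb (quot \<mu>)\<close>, act alike.\<close>

lemma pull_emb_irreducible:
  assumes \<sigma>: "irreducible_representation H \<sigma>"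
    and Lam1: "\<And>\<xi>. \<xi> \<in> hs_set (rep_space \<sigma>) \<Longrightarrow> rep_op \<sigma> Lam \<xi> = \<xi>"
  shows "irreducible_representation J (pull emb \<sigma>)"
    and "\<And>\<mu> \<xi>. \<lbrakk>\<mu> \<in> bounded_measures TH; \<xi> \<in> hs_set (rep_space \<sigma>)\<rbrakk> \<Longrightarrow> rep_op \<sigma> (emb (quot \<mu>)) \<xi> = rep_op \<sigma> \<mu> \<xi>"
proof -
  have rep: "hypergroup_representation H \<sigma>" by (rule irreducible_rep[OF \<sigma>])
  show eq: "rep_op \<sigma> (emb (quot \<mu>)) \<xi> = rep_op \<sigma> \<mu> \<xi>"
    if "\<mu> \<in> bounded_measures TH" "\<xi> \<in> hs_set (rep_space \<sigma>)" for \<mu> \<xi>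
    using hypergroup_representation.rep_mult[OF rep that(1) Lam_bounded that(2)] Lam1[OF that(2)]
    by (simp add: conv_Lam(2)[OF that(1)])
  show "irreducible_representation J (pull emb \<sigma>)"
  proof (rule pull_irreducible[OF \<sigma>])
    show "hypergroup_representation J (pull emb \<sigma>)"
    proof (rule pull_representation[OF rep emb_map _ emb_adjoint])
      show "rep_op \<sigma> (emb (hg_conv J \<mu> \<nu>)) \<xi> = rep_op \<sigma> (emb \<mu>) (rep_op \<sigma> (emb \<nu>) \<xi>)"
        if "\<mu> \<in> bounded_measures TJ" "\<nu> \<in> bounded_measures TJ" "\<xi> \<in> hs_set (rep_space \<sigma>)" for \<mu> \<nu> \<xi>
        using that hypergroup_representation.rep_mult[OF rep, of "emb \<mu>" "emb \<nu>" \<xi>]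
        by (simp add: conv_emb measure_map_bounded[OF emb_map])
      show "rep_op \<sigma> (emb (hg_dirac J (hg_unit J))) \<xi> = \<xi>" if "\<xi> \<in> hs_set (rep_space \<sigma>)" for \<xi>
        using Lam1[OF that] by (simp add: topology(2) Lam_eq_emb)
    qed
    show "\<exists>\<mu>'\<in>hg_measures J. \<forall>\<xi>\<in>hs_set (rep_space \<sigma>). rep_op \<sigma> (emb \<mu>') \<xi> = rep_op \<sigma> \<mu> \<xi>"
      if "\<mu> \<in> hg_measures H" for \<mu>
      using eq[OF that] measure_map_bounded[OF quot_map that] by blast
  qed
qed

text \<open>\<open>ext\<close> is a right inverse of \<open>res\<close>, so pulling back along it
  undoes the lift.\<close>

lemma pull_res_equivalent:
  assumes "equivalent_representations H (pull res \<pi>) (pull res \<sigma>)"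
  shows "equivalent_representations K \<pi> \<sigma>"
  using pull_equivalent[OF assms, of K ext] measure_map_bounded[OF ext_map]
  unfolding equivalent_representations_def by (simp add: res_ext)

lemma pull_quot_equivalent:
  assumes "equivalent_representations H (pull quot \<pi>) (pull quot \<sigma>)"
  shows "equivalent_representations J \<pi> \<sigma>"
  using pull_equivalent[OF assms, of J emb] measure_map_bounded[OF emb_map]
  unfolding equivalent_representations_def by (simp add: quot_emb)

text \<open>\<open>Lam\<close> acts as 0 in the one and as the identity in the other.\<close>

lemma pull_res_quot_inequivalent:
  assumes \<pi>: "irreducible_representation K \<pi>" and nt: "\<not> trivial_representation K \<pi>"
    and \<sigma>: "irreducible_representation J \<sigma>"
  shows "\<not> equivalent_representations H (pull res \<pi>) (pull quot \<sigma>)"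
proof
  interpret V: hilbert_space "rep_space \<pi>"
    by (rule hypergroup_representation.rep_hilbert[OF irreducible_rep[OF \<pi>]])
  assume "equivalent_representations H (pull res \<pi>) (pull quot \<sigma>)"
  then obtain U where U: "hs_unitary (rep_space \<pi>) (rep_space \<sigma>) U"
    "\<And>\<mu> \<xi>. \<lbrakk>\<mu> \<in> bounded_measures TH; \<xi> \<in> hs_set (rep_space \<pi>)\<rbrakk> \<Longrightarrow> U (rep_op \<pi> (res \<mu>) \<xi>) = rep_op \<sigma> (quot \<mu>) (U \<xi>)"
    unfolding equivalent_representations_def by auto
  have bij: "bij_betw U (hs_set (rep_space \<pi>)) (hs_set (rep_space \<sigma>))" using U(1) by (simp add: hs_unitary_def)
  obtain \<xi> where \<xi>: "\<xi> \<in> hs_set (rep_space \<pi>)" "\<xi> \<noteq> hs_zero (rep_space \<pi>)"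
    using \<pi> V.zero_closed unfolding irreducible_representation_def by blast
  have "U \<xi> \<in> hs_set (rep_space \<sigma>)" using bij \<xi>(1) by (auto simp: bij_betw_def)
  moreover have "quot Lam = dirac TJ (hg_unit J)"
    using quot_jdirac[OF e_in(2)] topology(2) by (simp add: jdirac_def)
  ultimately have "rep_op \<sigma> (quot Lam) (U \<xi>) = U \<xi>"
    using hypergroup_representation.rep_unit[OF irreducible_rep[OF \<sigma>]] by simp
  moreover have "rep_op \<pi> (res Lam) \<xi> = hs_zero (rep_space \<pi>)"
    using K.nontrivial_representation_iff[OF \<pi> lam] nt \<xi>(1) by (simp add: res_Lam)
  ultimately have "U \<xi> = U (hs_zero (rep_space \<pi>))" using U(2)[OF Lam_bounded \<xi>(1)] by simp
  then show False using bij \<xi> V.zero_closed by (auto simp: bij_betw_def inj_on_def)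
qed

subsection \<open>Hyperdimensions of the lifted representations\<close>

lemma the_normalized_haar_K: "the_normalized_haar K = borel_measure TK lam"
  by (rule K.the_normalized_haar_eq[OF lam])

text \<open>The coefficients on \<open>H\<close> are those on \<open>J\<close> composed with
  \<open>rJ\<close>, and \<open>rJ\<close> maps the Haar measure of \<open>H\<close> to that of
  \<open>J\<close>. A change of variables makes all orthogonality integrals equal.\<close>

lemma hyperdim_pull_quot:
  assumes \<eta>: "J.left_invariant \<eta>" and \<pi>: "irreducible_representation J \<pi>"
  shows "hyperdim H (pull quot \<pi>) = hyperdim J \<pi>"
proof -
  have p: "\<eta> \<in> positive_measures TJ" and b: "\<eta> \<in> bounded_measures TJ"
    using J.left_invariant_positive[OF \<eta>] by auto
  have ep: "emb \<eta> \<in> positive_measures TH" by (rule measure_map_positive[OF emb_map p])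
  have "(\<integral>x. rep_coeff H (pull quot \<pi>) i j x * cnj (rep_coeff H (pull quot \<pi>) k' l x) \<partial>the_normalized_haar H) =
      (\<integral>x. rep_coeff J \<pi> i j x * cnj (rep_coeff J \<pi> k' l x) \<partial>the_normalized_haar J)" for i j k' l
  proof -
    let ?g = "\<lambda>x. rep_coeff J \<pi> i j x * cnj (rep_coeff J \<pi> k' l x)"
    have "(\<integral>x. rep_coeff H (pull quot \<pi>) i j x * cnj (rep_coeff H (pull quot \<pi>) k' l x) \<partial>the_normalized_haar H) =
        (\<integral>x. ?g (rJ x) \<partial>borel_measure TH (emb \<eta>))"
      unfolding H.the_normalized_haar_eq[OF emb_left_invariant[OF \<eta>]]
      by (rule Bochner_Integration.integral_cong) (simp_all add: rep_coeff_def quot_dirac)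
    also have "\<dots> = cintegral TH (emb \<eta>) (\<lambda>x. ?g (rJ x))" by (simp add: cintegral_positive[OF ep])
    also have "\<dots> = cintegral TJ (quot (emb \<eta>)) ?g"
      unfolding quot_def
      by (rule cintegral_push[OF compact_H J.Hausdorff continuous_rJ ep, symmetric])
        (rule continuous_map_borel_measurable[OF continuous_J], simp)
    also have "\<dots> = (\<integral>x. ?g x \<partial>the_normalized_haar J)"
      by (simp add: quot_emb[OF b] cintegral_positive[OF p] J.the_normalized_haar_eq[OF \<eta>])
    finally show ?thesis .
  qed
  then have "has_hyperdim H (pull quot \<pi>) = has_hyperdim J \<pi>"
    by (simp add: has_hyperdim_def fun_eq_iff)
  then show ?thesis by (simp add: hyperdim_def)
qed

text \<open>The lifted coefficients vanish on \<open>J'\<close> and agree with the old ones on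
  \<open>K\<close>, where the Haar measure of \<open>H\<close> is \<open>1 / c\<close> times that of
  \<open>K\<close>. All orthogonality integrals are divided by \<open>c\<close>, so the
  hyperdimension is multiplied by \<open>c\<close>.\<close>

lemma hyperdim_pull_res:
  assumes \<eta>: "J.left_invariant \<eta>" and c: "c > 0" "\<eta> {e} = complex_of_real (1 / c)"
    and \<pi>: "irreducible_representation K \<pi>" and nt: "\<not> trivial_representation K \<pi>"
  shows "hyperdim H (pull res \<pi>) = hyperdim K \<pi> * c"
proof (rule hyperdim_scale[OF pull_res_irreducible[OF \<pi> nt] \<pi> c(1)])
  fix k
  have p: "\<eta> \<in> positive_measures TJ" by (rule J.left_invariant_positive[OF \<eta>])
  have ep: "emb \<eta> \<in> positive_measures TH" by (rule measure_map_positive[OF emb_map p])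
  have rep: "hypergroup_representation K \<pi>" and repH: "hypergroup_representation H (pull res \<pi>)"
    using \<pi> pull_res_irreducible[OF \<pi> nt] by (auto intro: irreducible_rep)
  interpret V: hilbert_space "rep_space \<pi>" by (rule hypergroup_representation.rep_hilbert[OF rep])
  let ?V = "hs_set (rep_space \<pi>)"
  have int: "(\<integral>x. rep_coeff H (pull res \<pi>) i j x * cnj (rep_coeff H (pull res \<pi>) k' l x) \<partial>the_normalized_haar H) =
      of_real (1 / c) * (\<integral>x. rep_coeff K \<pi> i j x * cnj (rep_coeff K \<pi> k' l x) \<partial>the_normalized_haar K)"
    if ij: "i \<in> ?V" "j \<in> ?V" "k' \<in> ?V" "l \<in> ?V" for i j k' l
  proof -
    let ?F = "\<lambda>x. rep_coeff H (pull res \<pi>) i j x * cnj (rep_coeff H (pull res \<pi>) k' l x)"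
    let ?G = "\<lambda>x. rep_coeff K \<pi> i j x * cnj (rep_coeff K \<pi> k' l x)"
    have F: "continuous_map TH euclidean ?F"
      using ij by (intro continuous_map_mult_cnj H.rep_coeff_continuous[OF repH]) simp_all
    have F0: "?F t = 0" if "t \<in> J'" for t
    proof -
      have "rep_op \<pi> (\<lambda>A. 0) j = hs_zero (rep_space \<pi>)"
        using rep_scale_measure[OF rep lam_bounded ij(2), of 0] rep_closed[OF rep lam_bounded ij(2)]
        by (simp add: V.scale_zero)
      then show ?thesis using that ij by (simp add: rep_coeff_def res_dirac(2) V.inner_zero_left)
    qed
    have FG: "?F x = ?G x" if "x \<in> topspace TK" for x
      using that by (simp add: rep_coeff_def res_dirac(1))
    have "(\<integral>x. ?F x \<partial>the_normalized_haar H) = cintegral TH (emb \<eta>) ?F"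
      by (simp add: H.the_normalized_haar_eq[OF emb_left_invariant[OF \<eta>]] cintegral_positive[OF ep])
    also have "\<dots> = (\<Sum>t\<in>topspace TJ. \<eta> {t} * (if t = e then cintegral TK lam ?F else ?F t))"
      by (rule cintegral_emb[OF p F])
    also have "\<dots> = (\<Sum>t\<in>topspace TJ. if t = e then \<eta> {t} * cintegral TK lam ?F else 0)"
      using F0 by (intro sum.cong refl) (simp split: if_splits)
    also have "\<dots> = \<eta> {e} * cintegral TK lam ?F" using finite_J e_in(2) by simp
    also have "cintegral TK lam ?F = cintegral TK lam ?G" by (rule cintegral_cong[OF lam_pos FG])
    also have "\<dots> = (\<integral>x. ?G x \<partial>the_normalized_haar K)"
      by (simp add: the_normalized_haar_K cintegral_positive[OF lam_pos])
    finally show ?thesis by (simp add: c(2))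
  qed
  have arith: "of_real (1 / c) * z = (if P then complex_of_real (1 / (k * c)) else 0) \<longleftrightarrow>
      z = (if P then complex_of_real (1 / k) else 0)" for z P
    using c(1) by (auto simp: field_simps)
  have pos: "k * c > 0 \<longleftrightarrow> k > 0" using c(1) by (simp add: zero_less_mult_iff)
  have "(\<forall>i\<in>B. \<forall>j\<in>B. \<forall>k'\<in>B. \<forall>l\<in>B.
      (\<integral>x. rep_coeff H (pull res \<pi>) i j x * cnj (rep_coeff H (pull res \<pi>) k' l x) \<partial>the_normalized_haar H) =
      (if i = k' \<and> j = l then complex_of_real (1 / (k * c)) else 0)) \<longleftrightarrow>
    (\<forall>i\<in>B. \<forall>j\<in>B. \<forall>k'\<in>B. \<forall>l\<in>B.
      (\<integral>x. rep_coeff K \<pi> i j x * cnj (rep_coeff K \<pi> k' l x) \<partial>the_normalized_haar K) =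
      (if i = k' \<and> j = l then complex_of_real (1 / k) else 0))"
    if B: "orthonormal_basis (rep_space \<pi>) B" for B
  proof -
    have "B \<subseteq> ?V" using B by (simp add: orthonormal_basis_def)
    then show ?thesis by (intro ball_cong refl) (simp only: int arith subset_iff)
  qed
  then show "has_hyperdim H (pull res \<pi>) (k * c) \<longleftrightarrow> has_hyperdim K \<pi> k"
    unfolding has_hyperdim_def pull_simps pos by (intro conj_cong refl iff_allI imp_cong)
qed

end

section \<open>Normalization of Haar measure and the bijection of the duals\<close>

lemma (in compact_hypergroup) haar_normalize:
  assumes M: "haar_measure H M" and c: "c = measure M (topspace T)" "c > 0"
  shows "left_invariant (\<lambda>A. of_real (1 / c) * cmeasure_of M A)"
proof -
  note M = haar_measure_cmeasure_of[OF M]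
  have p: "(\<lambda>A. of_real (1 / c) * cmeasure_of M A) \<in> positive_measures T"
    using M(1) c(2) by (intro positive_measures_scale) auto
  have "conv (dirac T x) (\<lambda>A. of_real (1 / c) * cmeasure_of M A) = (\<lambda>A. of_real (1 / c) * cmeasure_of M A)"
    if "x \<in> topspace T" for x
    by (subst measure_map_scale[OF conv_map(1)[OF dirac_pos[OF that]] positive_measures_bounded[OF M(1)]])
      (simp only: M(3)[OF that])
  moreover have "of_real (1 / c) * cmeasure_of M (topspace T) = 1"
    using c by (simp add: cmeasure_of_def)
  ultimately show ?thesis using p by (simp add: left_invariant_def probability_measures_def)
qed

theorem theorem2p8:
  fixes K J H :: "'a hypergroup"
    and lamK lamJ :: "'a measure"
    and Khat Jhat Hhat :: "('a, 'h) hg_rep set"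
  assumes "hypergroup K" and "compact_space (hg_top K)"
    and "hypergroup J" and "finite (hg_set J)" and "hg_set J \<noteq> {hg_unit J}"
    and "hypergroup_join K J lamK H"
    and "haar_measure J lamJ" and "measure lamJ {hg_unit J} = 1"
    and "hypergroup_dual K Khat" and "hypergroup_dual J Jhat" and "hypergroup_dual H Hhat"
  shows "\<exists>\<Phi> :: ('a, 'h) hg_rep + ('a, 'h) hg_rep \<Rightarrow> ('a, 'h) hg_rep.
    bij_betw \<Phi> ({\<pi> \<in> Khat. \<not> trivial_representation K \<pi>} <+> Jhat) Hhat \<and>
    (\<forall>\<pi> \<in> {\<pi> \<in> Khat. \<not> trivial_representation K \<pi>}.
       rep_dim (\<Phi> (Inl \<pi>)) = rep_dim \<pi> \<and>
       hyperdim H (\<Phi> (Inl \<pi>)) = hyperdim K \<pi> * measure lamJ (hg_set J)) \<and>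
    (\<forall>\<pi> \<in> Jhat.
       rep_dim (\<Phi> (Inr \<pi>)) = rep_dim \<pi> \<and>
       hyperdim H (\<Phi> (Inr \<pi>)) = hyperdim J \<pi>)"
proof -
  interpret finite_join K J H lamK by (rule finite_join.intro[OF assms(6,4)])
  define c where "c = measure lamJ (hg_set J)"
  have lamJ: "finite_measure lamJ" "sets lamJ = sets (borel_of TJ)"
    using J.haar_measure_cmeasure_of(1,2)[OF assms(7)] finite_measure_borel_measure sets_borel_measure by metis+
  \<comment> \<open>The total mass is at least the mass 1 of the unit, so division by
    \<open>c\<close> is legitimate.\<close>
  have "measure lamJ {hg_unit J} \<le> c"
    unfolding c_def using J.unit_closed by (intro finite_measure.finite_measure_mono[OF lamJ(1)]) (auto simp: lamJ(2))
  then have c: "c > 0" using assms(8) by simp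
  define \<eta> where "\<eta> A = of_real (1 / c) * cmeasure_of lamJ A" for A
  have \<eta>: "J.left_invariant \<eta>" unfolding \<eta>_def by (rule J.haar_normalize[OF assms(7) c_def c])
  \<comment> \<open>The normalization of \<open>lamJ\<close> at the unit becomes the weight
    \<open>1 / c\<close> of \<open>K\<close> in the Haar measure of \<open>H\<close>.\<close>
  have \<eta>e: "\<eta> {e} = complex_of_real (1 / c)" using assms(8) topology(2) by (simp add: \<eta>_def cmeasure_of_def)
  define lift :: "('a, 'h) hg_rep + ('a, 'h) hg_rep \<Rightarrow> ('a, 'h) hg_rep" where
    "lift x = (case x of Inl \<pi> \<Rightarrow> pull res \<pi> | Inr \<pi> \<Rightarrow> pull quot \<pi>)" for x
  \<comment> \<open>The given dual \<open>Hhat\<close> need not contain the lifted representations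
    themselves, only equivalent ones, so a representative is chosen.\<close>
  define \<Phi> where "\<Phi> x = (SOME \<rho>. \<rho> \<in> Hhat \<and> equivalent_representations H (lift x) \<rho>)" for x
  let ?K = "{\<pi> \<in> Khat. \<not> trivial_representation K \<pi>}"
  have K: "irreducible_representation K \<pi>" "\<not> trivial_representation K \<pi>" if "\<pi> \<in> ?K" for \<pi>
    using that dual_irreducible[OF assms(9)] by auto
  have J: "irreducible_representation J \<pi>" if "\<pi> \<in> Jhat" for \<pi>
    using that dual_irreducible[OF assms(10)] by auto
  have lift: "irreducible_representation H (lift x)" if "x \<in> ?K <+> Jhat" for x
    using that pull_res_irreducible[OF K] pull_quot_irreducible[OF J] by (auto simp: lift_def)
  have \<Phi>: "\<Phi> x \<in> Hhat" "equivalent_representations H (lift x) (\<Phi> x)" if "x \<in> ?K <+> Jhat" for x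
    using someI_ex[of "\<lambda>\<rho>. \<rho> \<in> Hhat \<and> equivalent_representations H (lift x) \<rho>"]
      dual_member[OF assms(11) lift[OF that]] unfolding \<Phi>_def by blast+
  have \<Phi>_eqI: "\<Phi> x = \<rho>" if "x \<in> ?K <+> Jhat" "\<rho> \<in> Hhat" "equivalent_representations H (lift x) \<rho>" for x \<rho>
    using dual_eqI[OF assms(11) \<Phi>(1)[OF that(1)] that(2)]
      equivalent_trans[OF equivalent_sym[OF irreducible_rep[OF lift[OF that(1)]] \<Phi>(2)[OF that(1)]] that(3)] .
  have "inj_on \<Phi> (?K <+> Jhat)"
  proof (rule inj_onI)
    fix x y assume x: "x \<in> ?K <+> Jhat" and y: "y \<in> ?K <+> Jhat" and eq: "\<Phi> x = \<Phi> y"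
    have xy: "equivalent_representations H (lift x) (lift y)"
      using equivalent_trans[OF \<Phi>(2)[OF x]] equivalent_sym[OF irreducible_rep[OF lift[OF y]] \<Phi>(2)[OF y]] eq by simp
    have yx: "equivalent_representations H (lift y) (lift x)"
      by (rule equivalent_sym[OF irreducible_rep[OF lift[OF x]] xy])
    from x y consider \<pi> \<sigma> where "x = Inl \<pi>" "y = Inl \<sigma>" "\<pi> \<in> ?K" "\<sigma> \<in> ?K"
      | \<pi> \<sigma> where "x = Inr \<pi>" "y = Inr \<sigma>" "\<pi> \<in> Jhat" "\<sigma> \<in> Jhat"
      | \<pi> \<sigma> where "x = Inl \<pi>" "y = Inr \<sigma>" "\<pi> \<in> ?K" "\<sigma> \<in> Jhat"
      | \<pi> \<sigma> where "x = Inr \<pi>" "y = Inl \<sigma>" "\<pi> \<in> Jhat" "\<sigma> \<in> ?K"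
      by blast
    then show "x = y"
    proof cases
      case 1
      then show ?thesis using pull_res_equivalent[of \<pi> \<sigma>] xy dual_eqI[OF assms(9)] by (auto simp: lift_def)
    next
      case 2
      then show ?thesis using pull_quot_equivalent[of \<pi> \<sigma>] xy dual_eqI[OF assms(10)] by (auto simp: lift_def)
    next
      case 3
      then show ?thesis using pull_res_quot_inequivalent[OF K J] xy by (simp add: lift_def)
    next
      case 4
      then show ?thesis using pull_res_quot_inequivalent[OF K J] yx by (simp add: lift_def)
    qed
  qed
  moreover have "\<exists>x\<in>?K <+> Jhat. \<Phi> x = \<sigma>" if \<sigma>: "\<sigma> \<in> Hhat" for \<sigma>
  proof -
    have irr: "irreducible_representation H \<sigma>" by (rule dual_irreducible[OF assms(11) \<sigma>])
    have rep: "hypergroup_representation H \<sigma>" by (rule irreducible_rep[OF irr])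
    \<comment> \<open>The action of \<open>Lam\<close> decides from which factor
      \<open>\<sigma>\<close> comes.\<close>
    consider "\<And>\<xi>. \<xi> \<in> hs_set (rep_space \<sigma>) \<Longrightarrow> rep_op \<sigma> Lam \<xi> = hs_zero (rep_space \<sigma>)"
      | "\<And>\<xi>. \<xi> \<in> hs_set (rep_space \<sigma>) \<Longrightarrow> rep_op \<sigma> Lam \<xi> = \<xi>"
      using rep_Lam_dichotomy[OF irr] by blast
    then show ?thesis
    proof cases
      case 1
      have K\<sigma>: "irreducible_representation K (pull ext \<sigma>)" "\<not> trivial_representation K (pull ext \<sigma>)"
        using pull_ext_irreducible[OF irr] 1 by blast+
      obtain \<pi> where \<pi>: "\<pi> \<in> Khat" "equivalent_representations K (pull ext \<sigma>) \<pi>"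
        using dual_member[OF assms(9) K\<sigma>(1)] by blast
      have \<pi>': "equivalent_representations K \<pi> (pull ext \<sigma>)"
        by (rule equivalent_sym[OF irreducible_rep[OF K\<sigma>(1)] \<pi>(2)])
      have "\<not> trivial_representation K \<pi>"
        using trivial_equivalent[OF irreducible_rep[OF K\<sigma>(1)] \<pi>'] K\<sigma>(2) by blast
      then have x: "Inl \<pi> \<in> ?K <+> Jhat" using \<pi>(1) by blast
      have "equivalent_representations H (pull res \<pi>) (pull res (pull ext \<sigma>))"
        by (rule pull_equivalent[OF \<pi>' res_bounded])
      \<comment> \<open>Both sides have the same operators on the same space, so the identity map
        intertwines them.\<close>
      moreover have "equivalent_representations H (pull res (pull ext \<sigma>)) \<sigma>"
        by (rule equivalent_cong[OF equivalent_refl]) (use rep_ext_res[OF rep] 1 in simp_all)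
      ultimately have "equivalent_representations H (lift (Inl \<pi>)) \<sigma>"
        using equivalent_trans by (simp add: lift_def) blast
      then show ?thesis using \<Phi>_eqI[OF x \<sigma>] x by blast
    next
      case 2
      have J\<sigma>: "irreducible_representation J (pull emb \<sigma>)"
        using pull_emb_irreducible(1)[OF irr] 2 by blast
      obtain \<pi> where \<pi>: "\<pi> \<in> Jhat" "equivalent_representations J (pull emb \<sigma>) \<pi>"
        using dual_member[OF assms(10) J\<sigma>] by blast
      have \<pi>': "equivalent_representations J \<pi> (pull emb \<sigma>)"
        by (rule equivalent_sym[OF irreducible_rep[OF J\<sigma>] \<pi>(2)])
      have x: "Inr \<pi> \<in> ?K <+> Jhat" using \<pi>(1) by blast
      have "equivalent_representations H (pull quot \<pi>) (pull quot (pull emb \<sigma>))"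
        by (rule pull_equivalent[OF \<pi>' measure_map_bounded[OF quot_map]])
      moreover have "equivalent_representations H (pull quot (pull emb \<sigma>)) \<sigma>"
        by (rule equivalent_cong[OF equivalent_refl]) (use pull_emb_irreducible(2)[OF irr] 2 in simp_all)
      ultimately have "equivalent_representations H (lift (Inr \<pi>)) \<sigma>"
        using equivalent_trans by (simp add: lift_def) blast
      then show ?thesis using \<Phi>_eqI[OF x \<sigma>] x by blast
    qed
  qed
  ultimately have "bij_betw \<Phi> (?K <+> Jhat) Hhat"
    using \<Phi>(1) unfolding bij_betw_def by blast
  moreover have dim: "rep_dim (\<Phi> x) = rep_dim (lift x)" "hyperdim H (\<Phi> x) = hyperdim H (lift x)"
    if x: "x \<in> ?K <+> Jhat" for x
  proof -
    have r: "hypergroup_representation H (lift x)" "hypergroup_representation H (\<Phi> x)"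
      using lift[OF x] dual_irreducible[OF assms(11) \<Phi>(1)[OF x]] by (auto intro: irreducible_rep)
    show "rep_dim (\<Phi> x) = rep_dim (lift x)" by (rule equivalent_dim[OF r \<Phi>(2)[OF x]])
    have "space (the_normalized_haar H) = hg_set H"
      by (simp add: H.the_normalized_haar_eq[OF emb_left_invariant[OF \<eta>]])
    from hyperdim_equivalent[OF r \<Phi>(2)[OF x] this H.dirac_bounded]
    show "hyperdim H (\<Phi> x) = hyperdim H (lift x)" by simp
  qed
  moreover have "rep_dim (lift (Inl \<pi>)) = rep_dim \<pi> \<and> hyperdim H (lift (Inl \<pi>)) = hyperdim K \<pi> * c" if "\<pi> \<in> ?K" for \<pi>
    using hyperdim_pull_res[OF \<eta> c \<eta>e K[OF that]] by (simp add: lift_def)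
  moreover have "rep_dim (lift (Inr \<pi>)) = rep_dim \<pi> \<and> hyperdim H (lift (Inr \<pi>)) = hyperdim J \<pi>" if "\<pi> \<in> Jhat" for \<pi>
    using hyperdim_pull_quot[OF \<eta> J[OF that]] by (simp add: lift_def)
  ultimately show ?thesis
    unfolding c_def by (intro exI[of _ \<Phi>] conjI ballI) (simp_all add: InlI InrI)
qed

end
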